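(* Let $\Omega$ be an open set in $\mathbb{R}^m$ containing the closed unit ball $\overline{\mathbb{B}^m}$. Let $h$ be a superfunction with coefficients in $C^2(\Omega)$ satisfying $\nabla^2h=0$ in $\Omega$. Then \[ \int_{SS}h=\frac{2\pi^{M/2}}{\Gamma(M/2)}\,h(0), \] where $h(0)\in\Lambda_{2n}$ denotes $h$ evaluated at $\underline{x}=0$, and where for $M\in\{0,-2,-4,\dots\}$ the constant $\frac{2\pi^{M/2}}{\Gamma(M/2)}$ is $0$ (as $1/\Gamma$ vanishes at its poles).
   Context: Fix integers $m\ge1$, $n\ge0$ and put $M=m-2n$. Let $\Lambda_{2n}$ be the complex Grassmann algebra generated by anticommuting variables ${x\grave{}}_1,\dots,{x\grave{}}_{2n}$; superfunctions are $f=\sum_A{x\grave{}}_Af_A$ with $\mathbb{C}$-valued coefficients $f_A$ on $\Omega$. Bosonic coordinates $\underline{x}=(x_1,\dots,x_m)=r\underline\xi$. Fermionic derivatives $\partial_{{x\grave{}}_j}$ commute with the $x_i$ and satisfy $\partial_{{x\grave{}}_j}({x\grave{}}_k g)=\delta_{jk}g-{x\grave{}}_k\partial_{{x\grave{}}_j}g$. Put $\underline{x}\grave{}^2=\sum_{j=1}^n{x\grave{}}_{2j-1}{x\grave{}}_{2j}$. The super Laplace operator is $\nabla^2=\sum_{i=1}^m\partial_{x_i}^2-4\sum_{j=1}^n\partial_{{x\grave{}}_{2j-1}}\partial_{{x\grave{}}_{2j}}$. Berezin integral $\int_B=\pi^{-n}\partial_{{x\grave{}}_{2n}}\cdots\partial_{{x\grave{}}_1}$.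 With $\frac{\partial}{\partial r^2}=\frac1{2r}\frac{\partial}{\partial r}$ and $d\underline\xi$ the surface measure on $\mathbb{S}^{m-1}$, the supersphere integral is $\int_{SS}f=\sum_{j=0}^n\int_{\mathbb{S}^{m-1}}d\underline{\xi}\int_B\frac{\underline{x}\grave{}^{2j}}{j!}\big[(\frac{\partial}{\partial r^2})^jr^{m-2}f\big]_{r=1}$.
   Formalization: Here h(0) is the scalar part of h at the origin (the coefficient h_∅(0)), not the full element of Λ_{2n}: with the full element the claim fails, e.g. for m=3, n=1, h = x̀_1x̀_2 − (2/3)|x|², where the left side is 0 and the right side is 2x̀_1x̀_2. *)

theory Defs
  imports "HOL-Analysis.Analysis"
begin

text \<open>An element of the Grassmann algebra is represented by its coefficient function
  on finite index sets A (subsets of {1..2n}); the basis monomial for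
  A = {a1 < ... < ak} is x_{a1} ... x_{ak}.\<close>

type_synonym grass = "nat set \<Rightarrow> complex"

definition gsign :: "nat set \<Rightarrow> nat set \<Rightarrow> complex" where
  "gsign A B = (-1) ^ card {(a, b). a \<in> A \<and> b \<in> B \<and> b < a}"

text \<open>Product: x_A x_B = gsign A B x_{A union B} if A, B disjoint, 0 otherwise.\<close>
definition gmult :: "grass \<Rightarrow> grass \<Rightarrow> grass" where
  "gmult a b = (\<lambda>C. \<Sum>A\<in>Pow C. gsign A (C - A) * a A * b (C - A))"

definition gone :: grass where
  "gone = (\<lambda>A. if A = {} then 1 else 0)"

primrec gpow :: "grass \<Rightarrow> nat \<Rightarrow> grass" where
  "gpow a 0 = gone"
| "gpow a (Suc k) = gmult a (gpow a k)"

text \<open>The element x`^2 = sum_{j=1}^n x`_{2j-1} x`_{2j}.\<close>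
definition xsq :: "nat \<Rightarrow> grass" where
  "xsq n = (\<lambda>A. if \<exists>j\<in>{1..n}. A = {2*j - 1, 2*j} then 1 else 0)"

text \<open>Fermionic derivative d/dx`_j, determined by
  d_j (x`_k g) = delta_{jk} g - x`_k d_j g:
  d_j x_A = (-1)^{#{a in A. a < j}} x_{A - {j}} if j in A, and 0 otherwise.\<close>
definition fder :: "nat \<Rightarrow> grass \<Rightarrow> grass" where
  "fder j a = (\<lambda>B. if j \<notin> B then (-1) ^ card {b\<in>B. b < j} * a (insert j B) else 0)"

primrec fder_seq :: "nat \<Rightarrow> grass \<Rightarrow> grass" where
  "fder_seq 0 a = a"
| "fder_seq (Suc k) a = fder (Suc k) (fder_seq k a)"

text \<open>Berezin integral pi^{-n} d_{2n} ... d_1 (a number, the resulting element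
  of degree 0).\<close>
definition berezin :: "nat \<Rightarrow> grass \<Rightarrow> complex" where
  "berezin n a = fder_seq (2 * n) a {} / complex_of_real (pi ^ n)"

definition pd :: "'m::finite \<Rightarrow> (real^'m \<Rightarrow> complex) \<Rightarrow> real^'m \<Rightarrow> complex" where
  "pd i g x = vector_derivative (\<lambda>t. g (x + t *\<^sub>R axis i 1)) (at 0)"

definition C2_on :: "(real^'m::finite) set \<Rightarrow> (real^'m \<Rightarrow> complex) \<Rightarrow> bool" where
  "C2_on S g \<longleftrightarrow> continuous_on S g \<and>
     (\<forall>i. (\<forall>x\<in>S. (\<lambda>t. g (x + t *\<^sub>R axis i 1)) differentiable (at 0)) \<and>
          continuous_on S (pd i g) \<and>
          (\<forall>j. (\<forall>x\<in>S. (\<lambda>t. pd i g (x + t *\<^sub>R axis j 1)) differentiable (at 0)) \<and>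
               continuous_on S (pd j (pd i g))))"

definition is_superfunction :: "nat \<Rightarrow> (real^'m::finite \<Rightarrow> grass) \<Rightarrow> bool" where
  "is_superfunction n f \<longleftrightarrow> (\<forall>x A. \<not> A \<subseteq> {1..2*n} \<longrightarrow> f x A = 0)"

definition super_laplace :: "nat \<Rightarrow> (real^'m::finite \<Rightarrow> grass) \<Rightarrow> real^'m \<Rightarrow> grass" where
  "super_laplace n f x = (\<lambda>A.
      (\<Sum>i\<in>UNIV. pd i (pd i (\<lambda>y. f y A)) x)
      - 4 * (\<Sum>j\<in>{1..n}. fder (2*j - 1) (fder (2*j) (f x)) A))"

text \<open>Surface measure on S^{m-1} defined via the cone construction:
  sigma(E) = m * Lebesgue measure of {r xi. 0 < r <= 1, xi in E}.\<close>
definition sphere_measure :: "(real^'m::finite) measure" where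
  "sphere_measure = measure_of (sphere 0 1) {E. E \<subseteq> sphere 0 1 \<and> E \<in> sets borel}
     (\<lambda>E. of_nat CARD('m) * emeasure lborel {r *\<^sub>R \<xi> | r \<xi>. 0 < r \<and> r \<le> 1 \<and> \<xi> \<in> E})"

text \<open>The operator d/d(r^2) = (1/(2r)) d/dr acting on a function of r.\<close>
definition rdop :: "(real \<Rightarrow> complex) \<Rightarrow> real \<Rightarrow> complex" where
  "rdop \<phi> = (\<lambda>r. vector_derivative \<phi> (at r) / complex_of_real (2 * r))"

definition radial_term :: "nat \<Rightarrow> (real^'m::finite \<Rightarrow> grass) \<Rightarrow> real^'m \<Rightarrow> grass" where
  "radial_term j f \<xi> = (\<lambda>A. (rdop ^^ j)
      (\<lambda>r. complex_of_real (r powi (int CARD('m) - 2)) * f (r *\<^sub>R \<xi>) A) 1)"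

definition supersphere_integral :: "nat \<Rightarrow> (real^'m::finite \<Rightarrow> grass) \<Rightarrow> complex" where
  "supersphere_integral n f = (\<Sum>j = 0..n.
      integral\<^sup>L sphere_measure (\<lambda>\<xi>.
        berezin n (\<lambda>A. gmult (gpow (xsq n) j) (radial_term j f \<xi>) A / of_nat (fact j))))"

end

theory Submission
  imports Defs
begin

text \<open>Super harmonicity couples the coefficients of h into chains with
  \<Delta> f_k = -4 (k+1) f_(k+1), which end after finitely many steps. A solid mean
  A_K[f] (t), the integral of f over the ball of radius \<surd>t about x with weight (t - |y-x|^2)^K, divided
  by t^(K+m/2), satisfies d/dt A_K[f] = A_(K+1)[\<Delta> f] / (4 (K+1)). Hence the solid means of
  a chain are polynomials in t (Pizzetti's formula), and differentiating the unweighted integral over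
  balls gives the same for spherical means:
  \<integral> f_k(r \<xi>) d\<xi> = 2 \<pi>^(m/2) \<Sum>_l (-1)^l (k+l choose l) f_(k+l)(0) r^(2l) / \<Gamma>(m/2+l).
  Solving Pizzetti's formula for f_k(x) also expresses f_k by integrals against the kernels
  (t - |y-x|^2)_+^K, for K as large as desired, so that the radial derivatives of every order in the supersphere integral exist and commute with the
  integral over the sphere. The Berezin integral of the j-th term extracts f_(n-j) from the chain
  starting at h_{}, and in the resulting double sum the factor of each f_i(0) with i > 0
  is an alternating sum of binomial coefficients, hence 0.\<close>

section \<open>Weighted integrals over balls\<close>

text \<open>The coefficients are only C^2, while the supersphere integral differentiates them up to
  n times in r, so regularity has to be proved. A chain replaces them: each \<open>f k\<close> is
  C^2, and its Laplacian is a multiple of the next member, which is C^2 again. The weight (t -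
  |y-x|^2)^K serves two purposes. For K >= 1 it vanishes on the boundary sphere, so that integration
  by parts leaves no surface term; and it has K - 1 continuous derivatives in the centre x, which
  transfers smoothness from the kernel to \<open>f k\<close>. The variable t is the squared radius
  because d/dt then lowers the exponent of the weight by one, and because d/d(r^2) is the operator
  in the supersphere integral. All constants are written with \<open>rGamma\<close>, an entire
  function. The falling factorials produced by d/d(r^2) only shift its argument, so the case M = 0,
  -2, -4, ... is covered by the same computation.\<close>

lemma has_vector_derivative_iff_tendsto:
  fixes f :: "real \<Rightarrow> 'a::real_normed_vector"
  shows "(f has_vector_derivative D) (at t) \<longleftrightarrow> ((\<lambda>s. (f s - f t) /\<^sub>R (s - t)) \<longlongrightarrow> D) (at t)"
proof -
  have eq: "norm (f s - f t - (s - t) *\<^sub>R D) / norm (s - t) = norm ((f s - f t) /\<^sub>R (s - t) - D)"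
    if "s \<noteq> t" for s
  proof -
    have "f s - f t - (s - t) *\<^sub>R D = (s - t) *\<^sub>R ((f s - f t) /\<^sub>R (s - t) - D)"
      using that by (simp add: scaleR_diff_right)
    then show ?thesis using that by simp
  qed
  have "(f has_vector_derivative D) (at t) \<longleftrightarrow>
      ((\<lambda>s. norm (f s - f t - (s - t) *\<^sub>R D) / norm (s - t)) \<longlongrightarrow> 0) (at t)"
    unfolding has_vector_derivative_def has_derivative_iff_norm by (simp add: bounded_linear_scaleR_left)
  also have "\<dots> \<longleftrightarrow> ((\<lambda>s. norm ((f s - f t) /\<^sub>R (s - t) - D)) \<longlongrightarrow> 0) (at t)"
    by (intro filterlim_cong refl) (auto simp: eventually_at_filter simp del: real_norm_def intro!: always_eventually eq)
  also have "\<dots> \<longleftrightarrow> ((\<lambda>s. (f s - f t) /\<^sub>R (s - t)) \<longlongrightarrow> D) (at t)"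
    by (simp add: tendsto_norm_zero_iff LIM_zero_iff)
  finally show ?thesis .
qed

lemma vector_differentiable_bound:
  fixes f :: "real \<Rightarrow> 'a::real_normed_vector"
  assumes "convex S" "\<And>s. s \<in> S \<Longrightarrow> (f has_vector_derivative f' s) (at s within S)"
    "\<And>s. s \<in> S \<Longrightarrow> norm (f' s) \<le> B" "a \<in> S" "b \<in> S"
  shows "norm (f a - f b) \<le> B * \<bar>a - b\<bar>"
proof -
  have "norm (f a - f b) \<le> B * norm (a - b)"
  proof (rule differentiable_bound[OF assms(1) _ _ assms(4,5)])
    fix s assume s: "s \<in> S"
    show "(f has_derivative (\<lambda>h. h *\<^sub>R f' s)) (at s within S)"
      using assms(2)[OF s] by (simp add: has_vector_derivative_def)
    show "onorm (\<lambda>h. h *\<^sub>R f' s) \<le> B"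
      using onorm_scaleR_left[OF bounded_linear_ident, of "f' s"] assms(3)[OF s]
      by (simp add: onorm_id)
  qed
  then show ?thesis by simp
qed

text \<open>Dominated convergence applied to difference quotients along sequences. Domination is
  asked as a Lipschitz bound in \<open>s\<close> against the single point \<open>t\<close>, and the
  derivative only almost everywhere at \<open>t\<close>; both are what integrands with a kink on a
  moving sphere can provide.\<close>

lemma has_vector_derivative_integral:
  fixes u :: "real \<Rightarrow> 'a \<Rightarrow> 'b::{banach, second_countable_topology}"
  assumes J: "open J" "t \<in> J"
    and int: "\<And>s. s \<in> J \<Longrightarrow> integrable M (u s)"
    and B: "integrable M B"
    and bound: "\<And>s y. s \<in> J \<Longrightarrow> y \<in> space M \<Longrightarrow> norm (u s y - u t y) \<le> \<bar>s - t\<bar> * B y"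
    and deriv: "AE y in M. ((\<lambda>s. u s y) has_vector_derivative u' y) (at t)"
    and meas: "u' \<in> borel_measurable M"
  shows "((\<lambda>s. LINT y|M. u s y) has_vector_derivative (LINT y|M. u' y)) (at t)"
proof -
  let ?Q = "\<lambda>s y. (u s y - u t y) /\<^sub>R (s - t)"
  have "((\<lambda>s. LINT y|M. ?Q s y) \<longlongrightarrow> (LINT y|M. u' y)) (at t within J)"
    unfolding tendsto_at_iff_sequentially
  proof safe
    fix X :: "nat \<Rightarrow> real"
    assume X: "\<forall>i. X i \<in> J - {t}" "X \<longlonglongrightarrow> t"
    show "((\<lambda>s. LINT y|M. ?Q s y) \<circ> X) \<longlonglongrightarrow> (LINT y|M. u' y)"
      unfolding comp_def
    proof (rule integral_dominated_convergence[OF meas _ B])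
      show "?Q (X i) \<in> borel_measurable M" for i
        using int[of "X i"] int[OF J(2)] X(1) by (auto intro!: borel_measurable_scaleR borel_measurable_diff)
      show "AE y in M. (\<lambda>i. ?Q (X i) y) \<longlonglongrightarrow> u' y"
        using deriv
      proof eventually_elim
        fix y assume "((\<lambda>s. u s y) has_vector_derivative u' y) (at t)"
        then have "((\<lambda>s. ?Q s y) \<longlongrightarrow> u' y) (at t)"
          by (simp add: has_vector_derivative_iff_tendsto)
        then have "((\<lambda>s. ?Q s y) \<circ> X) \<longlonglongrightarrow> u' y"
          using X unfolding tendsto_at_iff_sequentially by auto
        then show "(\<lambda>i. ?Q (X i) y) \<longlonglongrightarrow> u' y" by (simp add: comp_def)
      qed
      show "AE y in M. norm (?Q (X i) y) \<le> B y" for i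
      proof (rule AE_I2)
        fix y assume "y \<in> space M"
        then have "norm (u (X i) y - u t y) \<le> \<bar>X i - t\<bar> * B y" using bound X by auto
        moreover have "X i \<noteq> t" using X by auto
        ultimately show "norm (?Q (X i) y) \<le> B y" by (simp add: pos_divide_le_eq mult.commute flip: divide_inverse_commute)
      qed
    qed
  qed
  then have "((\<lambda>s. LINT y|M. ?Q s y) \<longlongrightarrow> (LINT y|M. u' y)) (at t)"
    using at_within_open[OF J(2,1)] by simp
  moreover have "\<forall>\<^sub>F s in at t. (LINT y|M. ?Q s y) = ((LINT y|M. u s y) - (LINT y|M. u t y)) /\<^sub>R (s - t)"
  proof -
    have "\<forall>\<^sub>F s in at t. s \<in> J" using J by (simp add: eventually_at_in_open')
    then show ?thesis
      by eventually_elim (use int J in \<open>simp\<close>)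
  qed
  ultimately show ?thesis
    unfolding has_vector_derivative_iff_tendsto by (auto elim: Lim_transform_eventually)
qed

lemma compact_norm_bound:
  fixes f :: "'a::topological_space \<Rightarrow> 'b::real_normed_vector"
  assumes "compact S" "continuous_on S f"
  obtains C where "0 \<le> C" "\<And>y. y \<in> S \<Longrightarrow> norm (f y) \<le> C"
proof -
  obtain C where "\<forall>y\<in>f ` S. norm y \<le> C"
    using compact_imp_bounded[OF compact_continuous_image[OF assms(2,1)]] bounded_iff by blast
  then show ?thesis using that[of "max 0 C"] by (auto simp: le_max_iff_disj)
qed

lemma power_diff_bound:
  fixes a b T :: real
  assumes "0 \<le> a" "a \<le> T" "0 \<le> b" "b \<le> T"
  shows "\<bar>a ^ k - b ^ k\<bar> \<le> real k * T ^ (k - 1) * \<bar>a - b\<bar>"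
proof -
  have "norm (a ^ k - b ^ k) \<le> real k * T ^ (k - 1) * \<bar>a - b\<bar>"
  proof (rule vector_differentiable_bound[where S="{0..T}"])
    show "((\<lambda>s. s ^ k) has_vector_derivative real k * s ^ (k - 1)) (at s within {0..T})" for s
      unfolding has_real_derivative_iff_has_vector_derivative[symmetric]
      by (auto intro!: derivative_eq_intros)
    show "norm (real k * s ^ (k - 1)) \<le> real k * T ^ (k - 1)" if "s \<in> {0..T}" for s
      using that by (auto simp: abs_mult power_abs intro!: mult_left_mono power_mono)
  qed (use assms in auto)
  then show ?thesis by simp
qed

text \<open>The weight with exponent 1 has a kink on a sphere, both in \<open>t\<close> and under
  translation; this is the null set where its derivative is missing. The lemma also identifies open
  with closed balls under the integral.\<close>

lemma AE_not_sphere: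
  fixes x :: "real ^ 'm::finite"
  shows "AE y in lborel. norm (y - x) \<noteq> r"
proof -
  have "sphere x r \<in> null_sets lebesgue" using negligible_sphere negligible_iff_null_sets by blast
  then have "AE y in lebesgue. y \<notin> sphere x r" by (rule AE_not_in)
  then have "AE y in lborel. y \<notin> sphere x r" using AE_completion_iff by blast
  then show ?thesis by eventually_elim (auto simp: dist_norm norm_minus_commute)
qed

lemma integral_lborel_translate:
  fixes G :: "real ^ 'm::finite \<Rightarrow> complex"
  assumes "integrable lborel G"
  shows "integrable lborel (\<lambda>y. G (y + c))" "(LINT y|lborel. G (y + c)) = (LINT y|lborel. G y)"
proof -
  have m: "(+) c \<in> measurable lborel borel" by simp
  have "integrable (distr lborel borel ((+) c)) G" using assms by (simp add: lborel_distr_plus)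
  then show "integrable lborel (\<lambda>y. G (y + c))"
    using integrable_distr[OF m] by (simp add: add.commute)
  have "(LINT y|distr lborel borel ((+) c). G y) = (LINT y|lborel. G (c + y))"
    by (rule integral_distr) (use assms in auto)
  then show "(LINT y|lborel. G (y + c)) = (LINT y|lborel. G y)"
    by (simp add: lborel_distr_plus add.commute)
qed

section \<open>Integrals over balls with a power weight\<close>

definition weight :: "nat \<Rightarrow> real ^ 'm::finite \<Rightarrow> real \<Rightarrow> real ^ 'm \<Rightarrow> real" where
  "weight k x t y = (if (norm (y - x))\<^sup>2 < t then (t - (norm (y - x))\<^sup>2) ^ k else 0)"

definition solid :: "nat \<Rightarrow> real ^ 'm::finite \<Rightarrow> real \<Rightarrow> (real ^ 'm \<Rightarrow> complex) \<Rightarrow> complex" where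
  "solid k x t f = (LINT y|lborel. weight k x t y *\<^sub>R f y)"

lemma mem_ball_sqrt_iff: "y \<in> ball x (sqrt t) \<longleftrightarrow> (norm (y - x))\<^sup>2 < t" for x y :: "'a::real_normed_vector"
proof -
  have "norm (y - x) < sqrt t \<longleftrightarrow> sqrt ((norm (y - x))\<^sup>2) < sqrt t" by simp
  then show ?thesis unfolding real_sqrt_less_iff by (simp add: dist_norm norm_minus_commute)
qed

lemma mem_cball_sqrt_iff: "y \<in> cball x (sqrt t) \<longleftrightarrow> (norm (y - x))\<^sup>2 \<le> t" for x y :: "'a::real_normed_vector"
proof -
  have "norm (y - x) \<le> sqrt t \<longleftrightarrow> sqrt ((norm (y - x))\<^sup>2) \<le> sqrt t" by simp
  then show ?thesis unfolding real_sqrt_le_iff by (simp add: dist_norm norm_minus_commute)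
qed

lemma weight_eq_indicator:
  "weight k x t y = indicator (ball x (sqrt t)) y * (t - (norm (y - x))\<^sup>2) ^ k"
  unfolding weight_def using mem_ball_sqrt_iff[of y x t] by (auto simp: indicator_def)

text \<open>A power of the positive part is locally Lipschitz in \<open>t\<close>, and with exponent
  \<open>k + 1\<close> it has \<open>k\<close> continuous derivatives. The formula fails for
  exponent 0, where \<open>0 ^ 0 = 1\<close> would charge the outside of the ball;
  \<open>weight\<close> is therefore defined by cases.\<close>

lemma weight_Suc_max: "weight (Suc k) x t y = (max 0 (t - (norm (y - x))\<^sup>2)) ^ Suc k"
  by (auto simp: weight_def max_def)

lemma weight_nonneg: "0 \<le> weight k x t y"
  by (simp add: weight_def)

lemma weight_le: "0 \<le> t \<Longrightarrow> weight k x t y \<le> t ^ k"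
  by (auto simp: weight_def intro!: power_mono)

lemma weight_Suc: "weight (Suc k) x t y = (t - (norm (y - x))\<^sup>2) * weight k x t y"
  by (simp add: weight_def)

lemma weight_measurable [measurable]: "weight k x t \<in> borel_measurable borel"
  unfolding weight_def by measurable

lemma integrable_weight:
  fixes f :: "real ^ 'm::finite \<Rightarrow> complex"
  assumes "continuous_on (cball x (sqrt t)) f"
  shows "integrable lborel (\<lambda>y. weight k x t y *\<^sub>R f y)"
proof (cases "0 \<le> t")
  case True
  have "integrable lborel (\<lambda>y. indicator (cball x (sqrt t)) y *\<^sub>R ((t - (norm (y - x))\<^sup>2) ^ k *\<^sub>R f y))"
    by (intro borel_integrable_compact continuous_intros assms) auto
  from integrable_mult_indicator[OF _ this, of "ball x (sqrt t)"]
  show ?thesis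
    by (rule Bochner_Integration.integrable_cong[THEN iffD1, rotated -1])
      (auto simp: weight_eq_indicator indicator_def)
next
  case False
  then have "weight k x t y = 0" for y
    using zero_le_power2[of "norm (y - x)"] unfolding weight_def by (smt (verit))
  then show ?thesis by simp
qed

lemma solid_add:
  assumes "continuous_on (cball x (sqrt t)) f" "continuous_on (cball x (sqrt t)) g"
  shows "solid k x t (\<lambda>y. f y + g y) = solid k x t f + solid k x t g"
  unfolding solid_def scaleR_add_right
  by (intro Bochner_Integration.integral_add integrable_weight assms)

lemma solid_sum:
  assumes "\<And>i. i \<in> I \<Longrightarrow> continuous_on (cball x (sqrt t)) (f i)"
  shows "solid k x t (\<lambda>y. \<Sum>i\<in>I. f i y) = (\<Sum>i\<in>I. solid k x t (f i))"
  unfolding solid_def scaleR_sum_right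
  by (intro Bochner_Integration.integral_sum integrable_weight assms)

lemma solid_mult: "solid k x t (\<lambda>y. c * f y) = c * solid k x t f"
  by (simp add: solid_def flip: mult_scaleR_right)

lemma solid_cong:
  assumes "\<And>y. y \<in> cball x (sqrt t) \<Longrightarrow> f y = g y"
  shows "solid k x t f = solid k x t g"
  unfolding solid_def
proof (rule Bochner_Integration.integral_cong[OF refl])
  show "weight k x t y *\<^sub>R f y = weight k x t y *\<^sub>R g y" for y
    using assms[of y] mem_cball_sqrt_iff[of y x t] by (auto simp: weight_def)
qed

text \<open>Integration by parts by translation invariance: the integral of the weight times g, shifted by
  s e_i, does not depend on s, so that its s-derivative at 0, taken under the integral, vanishes.\<close>
lemma solid_by_parts:
  fixes g :: "real ^ 'm::finite \<Rightarrow> complex"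
  assumes t: "t > 0" and \<Omega>: "cball x (sqrt t) \<subseteq> \<Omega>"
    and g: "continuous_on \<Omega> g" "continuous_on \<Omega> g'"
    and deriv: "\<And>y. y \<in> \<Omega> \<Longrightarrow> ((\<lambda>s. g (y + s *\<^sub>R axis i 1)) has_vector_derivative g' y) (at 0)"
  shows "solid (Suc k) x t g' = (2 * of_nat (Suc k)) * solid k x t (\<lambda>y. (y $ i - x $ i) *\<^sub>R g y)"
proof -
  define e :: "real ^ 'm" where "e = axis i 1"
  define R where "R = sqrt t"
  define G where "G y = weight (Suc k) x t y *\<^sub>R g y" for y
  define G' where "G' y = weight (Suc k) x t y *\<^sub>R g' y
      - (2 * real (Suc k)) *\<^sub>R (weight k x t y *\<^sub>R ((y $ i - x $ i) *\<^sub>R g y))" for y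
  have ne: "norm e = 1" by (simp add: e_def)
  have R: "R > 0" "R\<^sup>2 = t" using t by (auto simp: R_def)
  have gc: "continuous_on (cball x (sqrt t)) g" "continuous_on (cball x (sqrt t)) g'"
    using g \<Omega> continuous_on_subset by blast+
  obtain C where C0: "0 \<le> C" and C: "\<And>y. y \<in> cball x R \<Longrightarrow> norm (g y) \<le> C"
    using compact_norm_bound[OF compact_cball gc(1)] unfolding R_def by blast
  obtain C' where C'0: "0 \<le> C'" and C': "\<And>y. y \<in> cball x R \<Longrightarrow> norm (g' y) \<le> C'"
    using compact_norm_bound[OF compact_cball gc(2)] unfolding R_def by blast
  have intG: "integrable lborel G"
    unfolding G_def by (rule integrable_weight[OF gc(1)])
  have intG': "integrable lborel G'"
    unfolding G'_def by (intro Bochner_Integration.integrable_diff integrable_scaleR_right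
      integrable_weight continuous_intros gc)
  have nsq: "(norm (y + s *\<^sub>R e - x))\<^sup>2 = (norm (y - x))\<^sup>2 + 2 * s * (y $ i - x $ i) + s\<^sup>2" for y s
  proof -
    have eq: "y + s *\<^sub>R e - x = (y - x) + s *\<^sub>R e" by simp
    have "(y - x) \<bullet> e = y $ i - x $ i" by (simp add: e_def inner_axis)
    then show ?thesis
      unfolding eq using dot_norm[of "y - x" "s *\<^sub>R e"] ne by (simp add: power2_eq_square)
  qed
  have deriv_in: "((\<lambda>s. G (y + s *\<^sub>R e)) has_vector_derivative G' y) (at 0)" if y: "y \<in> ball x R" for y
  proof (rule has_vector_derivative_transform_within_open)
    let ?p = "\<lambda>s. (t - ((norm (y - x))\<^sup>2 + 2 * s * (y $ i - x $ i) + s\<^sup>2)) ^ Suc k"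
    have yt: "(norm (y - x))\<^sup>2 < t" using y mem_ball_sqrt_iff[of y x t] by (simp add: R_def)
    have "(?p has_real_derivative (- 2 * real (Suc k) * (y $ i - x $ i) * weight k x t y)) (at 0)"
    proof -
      have "((\<lambda>s. t - ((norm (y - x))\<^sup>2 + 2 * s * (y $ i - x $ i) + s\<^sup>2)) has_real_derivative
          (- 2 * (y $ i - x $ i))) (at 0)"
        by (auto intro!: derivative_eq_intros)
      from DERIV_power[OF this, of "Suc k"] show ?thesis
        by (rule DERIV_cong) (use yt in \<open>simp add: weight_def, simp add: algebra_simps\<close>)
    qed
    then have p: "(?p has_vector_derivative (- 2 * real (Suc k) * (y $ i - x $ i) * weight k x t y)) (at 0)"
      by (simp only: has_real_derivative_iff_has_vector_derivative)
    have "y \<in> \<Omega>" using y \<Omega> ball_subset_cball[of x R] by (auto simp: R_def)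
    then have "((\<lambda>s. g (y + s *\<^sub>R e)) has_vector_derivative g' y) (at 0)"
      using deriv by (simp add: e_def)
    from has_vector_derivative_scaleR[OF p[folded has_real_derivative_iff_has_vector_derivative] this]
    show "((\<lambda>s. ?p s *\<^sub>R g (y + s *\<^sub>R e)) has_vector_derivative G' y) (at 0)"
      by (rule has_vector_derivative_eq_rhs) (simp add: G'_def weight_def yt algebra_simps)
    let ?U = "(\<lambda>s::real. y + s *\<^sub>R e) -` ball x R"
    show "open ?U" by (intro open_vimage continuous_intros) auto
    show "0 \<in> ?U" using y by simp
    fix s assume "s \<in> ?U"
    then have "(norm (y + s *\<^sub>R e - x))\<^sup>2 < t"
      using mem_ball_sqrt_iff[of "y + s *\<^sub>R e" x t] by (simp add: R_def)
    then show "?p s *\<^sub>R g (y + s *\<^sub>R e) = G (y + s *\<^sub>R e)"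
      by (simp only: G_def weight_def if_True nsq)
  qed
  have deriv_out: "((\<lambda>s. G (y + s *\<^sub>R e)) has_vector_derivative G' y) (at 0)" if y: "norm (y - x) > R" for y
  proof (rule has_vector_derivative_transform_within_open)
    let ?U = "(\<lambda>s::real. y + s *\<^sub>R e) -` (- cball x R)"
    have out: "weight j x t z = 0" if "z \<notin> cball x R" for z j
      using that mem_cball_sqrt_iff[of z x t] by (simp add: weight_def R_def)
    have yn: "y \<notin> cball x R" using y by (simp add: dist_norm norm_minus_commute)
    have "G' y = 0" using out[OF yn] by (simp add: G'_def)
    then show "((\<lambda>s. 0) has_vector_derivative G' y) (at 0)" by simp
    show "open ?U" by (intro open_vimage continuous_intros) auto
    show "0 \<in> ?U" using yn by simp
    fix s assume "s \<in> ?U"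
    then show "0 = G (y + s *\<^sub>R e)" using out[of "y + s *\<^sub>R e"] by (simp add: G_def)
  qed
  \<comment> \<open>The first summand bounds \<open>G'\<close> inside the ball, the second controls
    steps across the boundary; their sum is a common Lipschitz constant for \<open>G\<close> in the
    direction \<open>e\<close>.\<close>
  define L where "L = (t ^ Suc k * C' + 2 * real (Suc k) * (t ^ k * (R * C))) + t ^ k * (2 * R + 1) * C"
  have LL: "t ^ Suc k * C' + 2 * real (Suc k) * (t ^ k * (R * C)) \<le> L" "t ^ k * (2 * R + 1) * C \<le> L" "0 \<le> L"
    unfolding L_def using t R C0 C'0 by auto
  \<comment> \<open>Crossing the boundary: \<open>G b = 0\<close>, and one factor of the weight at
    \<open>a\<close>, namely \<open>t - |a-x|^2\<close>, is at most
    \<open>|b-x|^2 - |a-x|^2\<close>, which is of order \<open>\<sigma>\<close>.\<close>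
  have in_out: "norm (G a - G b) \<le> \<sigma> * L"
    if a: "a \<in> ball x R" and b: "b \<notin> ball x R" and s: "norm (b - a) \<le> \<sigma>" "\<sigma> \<le> 1" for a b \<sigma>
  proof -
    have at: "(norm (a - x))\<^sup>2 < t" using a mem_ball_sqrt_iff[of a x t] by (simp add: R_def)
    have bt: "t \<le> (norm (b - x))\<^sup>2" using b mem_ball_sqrt_iff[of b x t] by (simp add: R_def)
    have "a \<in> cball x R" using a by simp
    then have ga: "norm (g a) \<le> C" by (rule C)
    have na: "norm (a - x) < R" using a by (simp add: dist_norm norm_minus_commute)
    have nb: "norm (b - x) \<le> norm (a - x) + \<sigma>"
      using norm_triangle_ineq[of "b - a" "a - x"] s by simp
    have "t - (norm (a - x))\<^sup>2 \<le> (norm (b - x) - norm (a - x)) * (norm (b - x) + norm (a - x))"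
      using bt by (simp add: power2_eq_square algebra_simps)
    also have "\<dots> \<le> \<sigma> * (2 * R + 1)"
    proof (rule mult_mono)
      show "norm (b - x) - norm (a - x) \<le> \<sigma>" using nb by simp
      show "norm (b - x) + norm (a - x) \<le> 2 * R + 1" using nb na s by linarith
      show "0 \<le> \<sigma>" using s(1) norm_ge_zero[of "b - a"] by linarith
    qed simp
    finally have d: "t - (norm (a - x))\<^sup>2 \<le> \<sigma> * (2 * R + 1)" .
    have "weight (Suc k) x t a \<le> \<sigma> * (2 * R + 1) * t ^ k"
      unfolding weight_Suc
      by (rule mult_mono[OF d weight_le]) (use t at d weight_nonneg in auto)
    then have "weight (Suc k) x t a * norm (g a) \<le> \<sigma> * (2 * R + 1) * t ^ k * C"
      by (rule mult_mono) (use ga t at d in auto)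
    also have "\<dots> = \<sigma> * (t ^ k * (2 * R + 1) * C)" by simp
    also have "\<dots> \<le> \<sigma> * L"
      using LL(2) s(1) norm_ge_zero[of "b - a"] by (intro mult_left_mono) linarith+
    finally have "norm (G a) \<le> \<sigma> * L" by (simp add: G_def weight_nonneg)
    moreover have "G b = 0" using bt by (simp add: G_def weight_def)
    ultimately show ?thesis by simp
  qed
  \<comment> \<open>By convexity of the ball the whole segment stays inside, so the mean value
    inequality with the bound on \<open>G'\<close> applies.\<close>
  have in_in: "norm (G (b + s *\<^sub>R e) - G b) \<le> \<bar>s\<bar> * L"
    if a: "b + s *\<^sub>R e \<in> ball x R" and b: "b \<in> ball x R" for b s
  proof -
    let ?S = "{\<tau>. b + \<tau> *\<^sub>R e \<in> ball x R}"
    have "convex ?S"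
    proof (rule convexI)
      fix p q u v :: real
      assume H: "p \<in> ?S" "q \<in> ?S" "0 \<le> u" "0 \<le> v" "u + v = 1"
      have "b + (u *\<^sub>R p + v *\<^sub>R q) *\<^sub>R e = (u + v) *\<^sub>R b + (u *\<^sub>R p + v *\<^sub>R q) *\<^sub>R e"
        using H by simp
      also have "\<dots> = u *\<^sub>R (b + p *\<^sub>R e) + v *\<^sub>R (b + q *\<^sub>R e)"
        by (simp add: algebra_simps)
      finally show "u *\<^sub>R p + v *\<^sub>R q \<in> ?S"
        using convexD[OF convex_ball, of "b + p *\<^sub>R e" x R "b + q *\<^sub>R e" u v] H by simp
    qed
    then have "norm (G (b + s *\<^sub>R e) - G (b + 0 *\<^sub>R e)) \<le> L * \<bar>s - 0\<bar>"
    proof (rule vector_differentiable_bound[where f' = "\<lambda>\<tau>. G' (b + \<tau> *\<^sub>R e)"])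
      fix \<tau> assume \<tau>: "\<tau> \<in> ?S"
      have "((\<lambda>s. s - \<tau>) has_vector_derivative 1) (at \<tau>)"
        by (auto intro!: derivative_eq_intros)
      moreover have "((\<lambda>s. G (b + \<tau> *\<^sub>R e + s *\<^sub>R e)) has_vector_derivative G' (b + \<tau> *\<^sub>R e)) (at (\<tau> - \<tau>))"
        using deriv_in[of "b + \<tau> *\<^sub>R e"] \<tau> by simp
      ultimately have "(((\<lambda>s. G (b + \<tau> *\<^sub>R e + s *\<^sub>R e)) \<circ> (\<lambda>s. s - \<tau>)) has_vector_derivative 1 *\<^sub>R G' (b + \<tau> *\<^sub>R e)) (at \<tau>)"
        by (rule vector_diff_chain_at)
      then have "((\<lambda>s. G (b + s *\<^sub>R e)) has_vector_derivative G' (b + \<tau> *\<^sub>R e)) (at \<tau>)"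
        by (simp add: comp_def algebra_simps)
      then show "((\<lambda>s. G (b + s *\<^sub>R e)) has_vector_derivative G' (b + \<tau> *\<^sub>R e)) (at \<tau> within ?S)"
        by (rule has_vector_derivative_at_within)
      let ?y = "b + \<tau> *\<^sub>R e"
      have y: "?y \<in> cball x R" using \<tau> by auto
      have "\<bar>?y $ i - x $ i\<bar> \<le> norm (?y - x)"
        using component_le_norm_cart[of "?y - x" i] by simp
      also have "\<dots> \<le> R" using y by (simp add: dist_norm norm_minus_commute)
      finally have yi: "\<bar>?y $ i - x $ i\<bar> \<le> R" .
      have "norm (G' ?y) \<le> weight (Suc k) x t ?y * norm (g' ?y)
          + 2 * real (Suc k) * (weight k x t ?y * (\<bar>?y $ i - x $ i\<bar> * norm (g ?y)))"
        unfolding G'_def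
        by (rule order_trans[OF norm_triangle_ineq4]) (simp add: weight_nonneg abs_mult)
      also have "\<dots> \<le> t ^ Suc k * C' + 2 * real (Suc k) * (t ^ k * (R * C))"
        by (intro add_mono mult_mono weight_le C C' y yi)
            (use t R C0 C'0 in \<open>auto intro!: mult_nonneg_nonneg weight_nonneg\<close>)
      also have "\<dots> \<le> L" by (rule LL)
      finally show "norm (G' ?y) \<le> L" .
    qed (use a b in auto)
    then show ?thesis by (simp add: mult.commute)
  qed
  have lip: "norm (G (b + s *\<^sub>R e) - G b) \<le> \<bar>s\<bar> * L" if s: "\<bar>s\<bar> < 1" for b s
  proof -
    consider "b + s *\<^sub>R e \<in> ball x R" "b \<in> ball x R" | "b + s *\<^sub>R e \<in> ball x R" "b \<notin> ball x R"
      | "b + s *\<^sub>R e \<notin> ball x R" "b \<in> ball x R" | "b + s *\<^sub>R e \<notin> ball x R" "b \<notin> ball x R" by blast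
    then show ?thesis
    proof cases
      case 1 then show ?thesis by (rule in_in)
    next
      case 2 then show ?thesis using in_out[of "b + s *\<^sub>R e" b "\<bar>s\<bar>"] s ne by simp
    next
      case 3 then show ?thesis using in_out[of b "b + s *\<^sub>R e" "\<bar>s\<bar>"] s ne by (simp add: norm_minus_commute)
    next
      case 4
      have "G z = 0" if "z \<notin> ball x R" for z
        using that mem_ball_sqrt_iff[of z x t] by (simp add: G_def weight_def R_def)
      then show ?thesis using 4 LL by simp
    qed
  qed
  \<comment> \<open>Shifts with \<open>|s| < 1\<close> keep the support in the ball of radius
    \<open>R + 1\<close>, whose indicator times \<open>L\<close> dominates.\<close>
  have "((\<lambda>s. LINT y|lborel. G (y + s *\<^sub>R e)) has_vector_derivative (LINT y|lborel. G' y)) (at 0)"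
  proof (rule has_vector_derivative_integral[where J = "{-1<..<1}"
        and B = "\<lambda>y. indicator (cball x (R + 1)) y *\<^sub>R L"])
    show "integrable lborel (\<lambda>y. indicat_real (cball x (R + 1)) y *\<^sub>R L)"
      by (intro borel_integrable_compact) auto
    show "integrable lborel (\<lambda>y. G (y + s *\<^sub>R e))" for s
      by (rule integral_lborel_translate[OF intG])
    show "G' \<in> borel_measurable lborel" using intG' by (rule borel_measurable_integrable)
    show "norm (G (y + s *\<^sub>R e) - G (y + 0 *\<^sub>R e)) \<le> \<bar>s - 0\<bar> * (indicat_real (cball x (R + 1)) y *\<^sub>R L)"
      if s: "s \<in> {-1<..<1}" for s y
    proof (cases "y \<in> cball x (R + 1)")
      case True
      have "\<bar>s\<bar> < 1" using s by (simp add: abs_if)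
      then show ?thesis using lip[of s y] True by simp
    next
      case False
      have n: "norm (y - x) > R + 1" using False by (simp add: dist_norm norm_minus_commute)
      have out: "G z = 0" if "norm (z - x) > R" for z
        using that mem_ball_sqrt_iff[of z x t]
        by (simp add: G_def weight_def R_def dist_norm norm_minus_commute)
      have "norm (y - x) \<le> norm (y + s *\<^sub>R e - x) + norm (s *\<^sub>R e)"
        using norm_triangle_ineq4[of "y + s *\<^sub>R e - x" "s *\<^sub>R e"] by (simp add: algebra_simps)
      then have "norm (y + s *\<^sub>R e - x) > R" using n s ne by (auto simp: abs_if split: if_splits)
      then show ?thesis using out[of y] out[of "y + s *\<^sub>R e"] n False by simp
    qed
    show "AE y in lborel. ((\<lambda>s. G (y + s *\<^sub>R e)) has_vector_derivative G' y) (at 0)"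
      using AE_not_sphere[of x R]
    proof eventually_elim
      case (elim y)
      then show ?case
        using deriv_in[of y] deriv_out[of y] by (cases "norm (y - x) < R") (auto simp: dist_norm norm_minus_commute)
    qed
  qed auto
  moreover have "(\<lambda>s. LINT y|lborel. G (y + s *\<^sub>R e)) = (\<lambda>s. LINT y|lborel. G y)"
    by (simp add: integral_lborel_translate[OF intG])
  ultimately have "(LINT y|lborel. G' y) = 0"
    using vector_derivative_unique_at[OF _ has_vector_derivative_const] by fastforce
  moreover have "(LINT y|lborel. G' y) = solid (Suc k) x t g'
      - (2 * real (Suc k)) *\<^sub>R solid k x t (\<lambda>y. (y $ i - x $ i) *\<^sub>R g y)"
  proof -
    have i1: "integrable lborel (\<lambda>y. weight (Suc k) x t y *\<^sub>R g' y)"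
      by (rule integrable_weight[OF gc(2)])
    have i2: "integrable lborel (\<lambda>y. weight k x t y *\<^sub>R ((y $ i - x $ i) *\<^sub>R g y))"
      by (intro integrable_weight continuous_intros gc(1))
    show ?thesis
      unfolding G'_def solid_def Bochner_Integration.integral_diff[OF i1 integrable_scaleR_right[OF i2]]
        integral_scaleR_right ..
  qed
  ultimately show ?thesis by (simp add: scaleR_conv_of_real)
qed

section \<open>Laplacians and Green's identity against the weight\<close>

definition has_partial :: "(real ^ 'm::finite) set \<Rightarrow> 'm \<Rightarrow> (real ^ 'm \<Rightarrow> complex) \<Rightarrow> (real ^ 'm \<Rightarrow> complex) \<Rightarrow> bool" where
  "has_partial \<Omega> i g g' \<longleftrightarrow> continuous_on \<Omega> g \<and> continuous_on \<Omega> g' \<and>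
    (\<forall>y\<in>\<Omega>. ((\<lambda>s. g (y + s *\<^sub>R axis i 1)) has_vector_derivative g' y) (at 0))"

text \<open>The partial derivatives are hidden behind existential quantifiers, so that
  \<open>L\<close> is determined only on \<open>\<Omega>\<close> and finite sums of coefficients fit
  the notion without recomputing \<open>pd\<close>.\<close>

definition has_laplacian :: "(real ^ 'm::finite) set \<Rightarrow> (real ^ 'm \<Rightarrow> complex) \<Rightarrow> (real ^ 'm \<Rightarrow> complex) \<Rightarrow> bool" where
  "has_laplacian \<Omega> f L \<longleftrightarrow> (\<exists>g q. (\<forall>i. has_partial \<Omega> i f (g i) \<and> has_partial \<Omega> i (g i) (q i)) \<and>
    (\<forall>y\<in>\<Omega>. L y = (\<Sum>i\<in>UNIV. q i y)))"

lemma has_partial_sum: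
  assumes "\<And>a. a \<in> I \<Longrightarrow> has_partial \<Omega> i (f a) (g a)"
  shows "has_partial \<Omega> i (\<lambda>y. \<Sum>a\<in>I. f a y) (\<lambda>y. \<Sum>a\<in>I. g a y)"
  using assms unfolding has_partial_def
  by (auto intro!: continuous_on_sum has_vector_derivative_sum)

lemma has_laplacian_sum:
  assumes "\<And>a. a \<in> I \<Longrightarrow> has_laplacian \<Omega> (f a) (L a)"
  shows "has_laplacian \<Omega> (\<lambda>y. \<Sum>a\<in>I. f a y) (\<lambda>y. \<Sum>a\<in>I. L a y)"
proof -
  have "\<forall>a\<in>I. \<exists>g q. (\<forall>i. has_partial \<Omega> i (f a) (g i) \<and> has_partial \<Omega> i (g i) (q i)) \<and>
      (\<forall>y\<in>\<Omega>. L a y = (\<Sum>i\<in>UNIV. q i y))"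
    using assms unfolding has_laplacian_def by blast
  then obtain g q where gq: "\<And>a i. a \<in> I \<Longrightarrow> has_partial \<Omega> i (f a) (g a i)"
      "\<And>a i. a \<in> I \<Longrightarrow> has_partial \<Omega> i (g a i) (q a i)"
      "\<And>a y. a \<in> I \<Longrightarrow> y \<in> \<Omega> \<Longrightarrow> L a y = (\<Sum>i\<in>UNIV. q a i y)"
    unfolding bchoice_iff by metis
  have "(\<Sum>a\<in>I. L a y) = (\<Sum>i\<in>UNIV. \<Sum>a\<in>I. q a i y)" if "y \<in> \<Omega>" for y
    using gq(3) that by (subst sum.swap) (intro sum.cong refl)
  then show ?thesis
    unfolding has_laplacian_def
    by (intro exI[where x = "\<lambda>i y. \<Sum>a\<in>I. g a i y"] exI[where x = "\<lambda>i y. \<Sum>a\<in>I. q a i y"]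
        conjI allI ballI has_partial_sum gq(1,2))
qed

lemma has_laplacian_cong:
  "has_laplacian \<Omega> f L \<Longrightarrow> (\<And>y. y \<in> \<Omega> \<Longrightarrow> L y = L' y) \<Longrightarrow> has_laplacian \<Omega> f L'"
  unfolding has_laplacian_def by metis

lemma has_laplacian_const: "has_laplacian \<Omega> (\<lambda>_. c) (\<lambda>_. 0)"
  unfolding has_laplacian_def has_partial_def
  by (intro exI[of _ "\<lambda>_ _. 0"]) auto

lemma has_laplacian_continuous: "has_laplacian \<Omega> f L \<Longrightarrow> continuous_on \<Omega> f"
  unfolding has_laplacian_def has_partial_def by blast

text \<open>Two integrations by parts move the Laplacian onto the weight. With
  \<open>\<rho> = |y-x|\<close> and \<open>K = k + 2\<close>, the Laplacian of
  \<open>(t - \<rho>^2)^K\<close> is \<open>4 K (K-1) \<rho>^2 (t - \<rho>^2)^(K-2) - 2 K m (t -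
  \<rho>^2)^(K-1)\<close>; the right side results from replacing \<open>\<rho>^2\<close> by
  \<open>t - (t - \<rho>^2)\<close>.\<close>

lemma solid_laplacian:
  fixes f :: "real ^ 'm::finite \<Rightarrow> complex"
  assumes t: "t > 0" and \<Omega>: "cball x (sqrt t) \<subseteq> \<Omega>" and L: "has_laplacian \<Omega> f L"
  shows "solid (Suc (Suc k)) x t L =
    4 * of_nat (Suc (Suc k)) * of_nat (Suc k) * (of_real t * solid k x t f - solid (Suc k) x t f)
    - 2 * of_nat (Suc (Suc k)) * of_nat CARD('m) * solid (Suc k) x t f"
proof -
  obtain g q where gq: "\<And>i. has_partial \<Omega> i f (g i)" "\<And>i. has_partial \<Omega> i (g i) (q i)"
    "\<And>y. y \<in> \<Omega> \<Longrightarrow> L y = (\<Sum>i\<in>UNIV. q i y)"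
    using L unfolding has_laplacian_def by blast
  have cont\<Omega>: "continuous_on \<Omega> f" "continuous_on \<Omega> (g i)" "continuous_on \<Omega> (q i)" for i
    using gq(1)[of i] gq(2)[of i] by (auto simp: has_partial_def)
  have cont: "continuous_on (cball x (sqrt t)) f" "continuous_on (cball x (sqrt t)) (g i)"
    "continuous_on (cball x (sqrt t)) (q i)" for i
    by (rule continuous_on_subset[OF cont\<Omega>(1) \<Omega>] continuous_on_subset[OF cont\<Omega>(2) \<Omega>]
      continuous_on_subset[OF cont\<Omega>(3) \<Omega>])+
  let ?d = "\<lambda>i y. y $ i - x $ i"
  have "solid (Suc (Suc k)) x t L = solid (Suc (Suc k)) x t (\<lambda>y. \<Sum>i\<in>UNIV. q i y)"
    by (rule solid_cong, rule gq(3)) (use \<Omega> in blast)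
  also have "\<dots> = (\<Sum>i\<in>UNIV. solid (Suc (Suc k)) x t (q i))"
    by (rule solid_sum[OF cont(3)])
  also have "\<dots> = (\<Sum>i\<in>UNIV. 2 * of_nat (Suc (Suc k)) * solid (Suc k) x t (\<lambda>y. ?d i y *\<^sub>R g i y))"
    using gq(2) cont\<Omega> by (intro sum.cong refl solid_by_parts[OF t \<Omega>]) (auto simp: has_partial_def)
  also have "\<dots> = 2 * of_nat (Suc (Suc k)) * (\<Sum>i\<in>UNIV. solid (Suc k) x t (\<lambda>y. ?d i y *\<^sub>R g i y))"
    by (simp add: sum_distrib_left)
  also have "(\<Sum>i\<in>UNIV. solid (Suc k) x t (\<lambda>y. ?d i y *\<^sub>R g i y)) =
      (\<Sum>i\<in>UNIV. 2 * of_nat (Suc k) * solid k x t (\<lambda>y. (?d i y)\<^sup>2 *\<^sub>R f y) - solid (Suc k) x t f)"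
  proof (intro sum.cong refl)
    fix i :: 'm
    \<comment> \<open>The second integration by parts acts on the product
      \<open>(y_i - x_i) f\<close>, whose partial derivative is \<open>f + (y_i - x_i) g_i\<close>.
      The extra \<open>f\<close>, summed over \<open>i\<close>, is the source of the dimension in
      the result.\<close>
    have "solid (Suc k) x t (\<lambda>y. f y + ?d i y *\<^sub>R g i y) =
        (2 * of_nat (Suc k)) * solid k x t (\<lambda>y. ?d i y *\<^sub>R (?d i y *\<^sub>R f y))"
    proof (rule solid_by_parts[OF t \<Omega>])
      fix y assume y: "y \<in> \<Omega>"
      have "((\<lambda>s. f (y + s *\<^sub>R axis i 1)) has_vector_derivative g i y) (at 0)"
        using gq(1) y by (simp add: has_partial_def)
      moreover have "((\<lambda>s. ?d i (y + s *\<^sub>R axis i 1)) has_real_derivative 1) (at 0)"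
        by (auto intro!: derivative_eq_intros simp: axis_def)
      ultimately show "((\<lambda>s. ?d i (y + s *\<^sub>R axis i 1) *\<^sub>R f (y + s *\<^sub>R axis i 1))
          has_vector_derivative f y + ?d i y *\<^sub>R g i y) (at 0)"
        by (intro has_vector_derivative_eq_rhs[OF has_vector_derivative_scaleR[of "\<lambda>s. ?d i (y + s *\<^sub>R axis i 1)"]]) auto
    qed (intro continuous_intros cont\<Omega>)+
    moreover have "solid (Suc k) x t (\<lambda>y. f y + ?d i y *\<^sub>R g i y) =
        solid (Suc k) x t f + solid (Suc k) x t (\<lambda>y. ?d i y *\<^sub>R g i y)"
      by (intro solid_add continuous_intros cont)
    ultimately show "solid (Suc k) x t (\<lambda>y. ?d i y *\<^sub>R g i y) =
        2 * of_nat (Suc k) * solid k x t (\<lambda>y. (?d i y)\<^sup>2 *\<^sub>R f y) - solid (Suc k) x t f"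
      by (simp add: power2_eq_square eq_diff_eq add.commute)
  qed
  also have "\<dots> = 2 * of_nat (Suc k) * (\<Sum>i\<in>UNIV. solid k x t (\<lambda>y. (?d i y)\<^sup>2 *\<^sub>R f y))
      - of_nat CARD('m) * solid (Suc k) x t f"
    by (simp add: sum_subtractf sum_distrib_left)
  also have "(\<Sum>i\<in>UNIV. solid k x t (\<lambda>y. (?d i y)\<^sup>2 *\<^sub>R f y)) =
      of_real t * solid k x t f - solid (Suc k) x t f"
  proof -
    have "(\<Sum>i\<in>UNIV. solid k x t (\<lambda>y. (?d i y)\<^sup>2 *\<^sub>R f y)) = solid k x t (\<lambda>y. \<Sum>i\<in>UNIV. (?d i y)\<^sup>2 *\<^sub>R f y)"
      by (intro solid_sum[symmetric] continuous_intros cont)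
    also have "(\<lambda>y. \<Sum>i\<in>UNIV. (?d i y)\<^sup>2 *\<^sub>R f y) = (\<lambda>y. (norm (y - x))\<^sup>2 *\<^sub>R f y)"
    proof
      fix y
      have "(norm (y - x))\<^sup>2 = (\<Sum>i\<in>UNIV. (?d i y)\<^sup>2)"
        by (simp add: norm_vec_def L2_set_def sum_nonneg)
      then show "(\<Sum>i\<in>UNIV. (?d i y)\<^sup>2 *\<^sub>R f y) = (norm (y - x))\<^sup>2 *\<^sub>R f y"
        by (simp only: scaleR_left.sum)
    qed
    also have "solid k x t \<dots> = (LINT y|lborel. t *\<^sub>R (weight k x t y *\<^sub>R f y) - weight (Suc k) x t y *\<^sub>R f y)"
      unfolding solid_def weight_Suc by (simp add: algebra_simps)
    also have "\<dots> = of_real t * solid k x t f - solid (Suc k) x t f"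
    proof -
      have i: "integrable lborel (\<lambda>y. weight j x t y *\<^sub>R f y)" for j
        by (rule integrable_weight[OF cont(1)])
      show ?thesis
        unfolding solid_def Bochner_Integration.integral_diff[OF integrable_scaleR_right[OF i] i]
          integral_scaleR_right by (simp add: scaleR_conv_of_real)
    qed
    finally show ?thesis .
  qed
  finally show ?thesis by (simp add: algebra_simps)
qed

text \<open>With exponent at least 1 the weight is Lipschitz in the squared radius, also at points
  which the growing ball has yet to reach. The margin up to \<open>T\<close> leaves room on both
  sides of \<open>t\<close> for domination.\<close>

lemma has_vector_derivative_solid:
  fixes f :: "real ^ 'm::finite \<Rightarrow> complex"
  assumes t: "0 < t" "t < T" and f: "continuous_on (cball x (sqrt T)) f"
  shows "((\<lambda>s. solid (Suc k) x s f) has_vector_derivative of_nat (Suc k) * solid k x t f) (at t)"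
proof -
  have fs: "continuous_on (cball x (sqrt s)) f" if "s \<le> T" for s
    by (rule continuous_on_subset[OF f subset_cball]) (use that in simp)
  have "((\<lambda>s. LINT y|lborel. weight (Suc k) x s y *\<^sub>R f y) has_vector_derivative
      (LINT y|lborel. (real (Suc k) * weight k x t y) *\<^sub>R f y)) (at t)"
  proof (rule has_vector_derivative_integral[where J = "{0<..<T}" and
      B = "\<lambda>y. (real (Suc k) * T ^ k) *\<^sub>R (indicator (cball x (sqrt T)) y *\<^sub>R norm (f y))"])
    show "integrable lborel (\<lambda>y. weight (Suc k) x s y *\<^sub>R f y)" if "s \<in> {0<..<T}" for s
      using that by (intro integrable_weight fs) auto
    show "integrable lborel (\<lambda>y. (real (Suc k) * T ^ k) *\<^sub>R (indicat_real (cball x (sqrt T)) y *\<^sub>R norm (f y)))"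
      by (intro integrable_scaleR_right borel_integrable_compact continuous_intros f) auto
    have "(\<lambda>y. (real (Suc k) * weight k x t y) *\<^sub>R f y) = (\<lambda>y. real (Suc k) *\<^sub>R (weight k x t y *\<^sub>R f y))"
      by simp
    also have "\<dots> \<in> borel_measurable lborel"
      using t by (intro borel_measurable_scaleR borel_measurable_const
        borel_measurable_integrable[OF integrable_weight] fs) auto
    finally show "(\<lambda>y. (real (Suc k) * weight k x t y) *\<^sub>R f y) \<in> borel_measurable lborel" .
    show "norm (weight (Suc k) x s y *\<^sub>R f y - weight (Suc k) x t y *\<^sub>R f y) \<le>
        \<bar>s - t\<bar> * (real (Suc k) * T ^ k) *\<^sub>R (indicat_real (cball x (sqrt T)) y *\<^sub>R norm (f y))"
      if s: "s \<in> {0<..<T}" for s y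
    proof (cases "y \<in> cball x (sqrt T)")
      case False
      then show ?thesis using s t mem_cball_sqrt_iff[of y x T] by (auto simp: weight_def)
    next
      case True
      let ?m = "\<lambda>s. max 0 (s - (norm (y - x))\<^sup>2)"
      have "\<bar>?m s ^ Suc k - ?m t ^ Suc k\<bar> \<le> real (Suc k) * T ^ (Suc k - 1) * \<bar>?m s - ?m t\<bar>"
      proof (rule power_diff_bound)
        show "?m s \<le> T" "?m t \<le> T"
          using s t zero_le_power2[of "norm (y - x)"]
          by (intro max.boundedI; simp del: zero_le_power2; linarith)+
      qed auto
      also have "\<dots> \<le> real (Suc k) * T ^ (Suc k - 1) * \<bar>s - t\<bar>"
        using t by (intro mult_left_mono) auto
      finally have "\<bar>weight (Suc k) x s y - weight (Suc k) x t y\<bar> \<le> real (Suc k) * T ^ k * \<bar>s - t\<bar>"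
        by (simp only: weight_Suc_max diff_Suc_1)
      then have "\<bar>weight (Suc k) x s y - weight (Suc k) x t y\<bar> * norm (f y)
          \<le> real (Suc k) * T ^ k * \<bar>s - t\<bar> * norm (f y)"
        by (rule mult_right_mono) simp
      then show ?thesis using True
        by (simp add: mult_ac flip: scaleR_diff_left)
    qed
    show "AE y in lborel. ((\<lambda>s. weight (Suc k) x s y *\<^sub>R f y) has_vector_derivative
        (real (Suc k) * weight k x t y) *\<^sub>R f y) (at t)"
      using AE_not_sphere[of x "sqrt t"]
    proof eventually_elim
      case (elim y)
      let ?\<sigma> = "(norm (y - x))\<^sup>2"
      have ne: "?\<sigma> \<noteq> t" using elim by (metis norm_ge_zero real_sqrt_unique)
      have "((\<lambda>s. weight (Suc k) x s y) has_real_derivative (real (Suc k) * weight k x t y)) (at t)"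
      proof (cases "?\<sigma> < t")
        case True
        have "((\<lambda>s. s - ?\<sigma>) has_real_derivative 1) (at t)" by (auto intro!: derivative_eq_intros)
        from DERIV_power[OF this, of "Suc k"]
        have "((\<lambda>s. (s - ?\<sigma>) ^ Suc k) has_real_derivative (real (Suc k) * weight k x t y)) (at t)"
          by (rule DERIV_cong) (use True in \<open>simp add: weight_def\<close>)
        then show ?thesis
          by (rule has_field_derivative_transform_within_open[where S="{?\<sigma><..}"])
            (use True in \<open>auto simp: weight_def\<close>)
      next
        case False
        have "((\<lambda>s. 0) has_real_derivative (real (Suc k) * weight k x t y)) (at t)"
          using False by (simp add: weight_def)
        then show ?thesis
          by (rule has_field_derivative_transform_within_open[where S="{..<?\<sigma>}"])
            (use False ne in \<open>auto simp: weight_def\<close>)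
      qed
      from has_vector_derivative_scaleR[OF this has_vector_derivative_const, of "f y"]
      show ?case by simp
    qed
  qed (use t in auto)
  moreover have "(LINT y|lborel. (real (Suc k) * weight k x t y) *\<^sub>R f y) = of_nat (Suc k) * solid k x t f"
    by (simp only: solid_def scaleR_scaleR[symmetric] integral_scaleR_right)
      (simp add: scaleR_conv_of_real)
  ultimately show ?thesis by (simp only: solid_def)
qed

section \<open>Exact integrals of constants and the limit at radius zero\<close>

definition ball_const :: "nat \<Rightarrow> nat \<Rightarrow> real" where
  "ball_const m k = pi powr (m / 2) * fact k * rGamma (m / 2 + k + 1)"

lemma ball_const_pos: "0 < ball_const m k"
  unfolding ball_const_def rGamma_inverse_Gamma by (auto intro!: mult_pos_pos Gamma_real_pos)

text \<open>\<open>ball_const\<close> is the Beta-type integral of \<open>(1 - |y|^2)^k\<close> over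
  the unit ball. The base of the induction is the ball volume; since the Laplacian of a constant is
  0, \<open>solid_laplacian\<close> becomes a recursion linking the exponents \<open>k\<close> and
  \<open>k + 1\<close>.\<close>

lemma solid_const:
  fixes x :: "real ^ 'm::finite"
  assumes t: "t > 0"
  shows "solid k x t (\<lambda>_. c) = c * of_real (ball_const CARD('m) k * t powr (CARD('m) / 2 + k))"
proof -
  have "solid k x t (\<lambda>_. 1) = of_real (ball_const CARD('m) k * t powr (CARD('m) / 2 + k))"
  proof (induction k)
    case 0
    have "solid 0 x t (\<lambda>_. 1) = (LINT y|lborel. indicat_real (ball x (sqrt t)) y *\<^sub>R (1::complex))"
      unfolding solid_def by (simp add: weight_eq_indicator)
    also have "\<dots> = of_real (measure lborel (ball x (sqrt t)))"
    proof -
      have "integrable lborel (indicat_real (ball x (sqrt t)))"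
        by (rule integrable_real_indicator) (use t in \<open>auto simp: emeasure_ball\<close>)
      then show ?thesis by (simp add: scaleR_conv_of_real)
    qed
    also have "\<dots> = of_real (ball_const CARD('m) 0 * t powr (CARD('m) / 2 + 0))"
    proof -
      have "sqrt t ^ CARD('m) = (t powr (1 / 2)) powr CARD('m)"
        using t by (simp add: powr_half_sqrt powr_realpow)
      also have "\<dots> = t powr (CARD('m) / 2)" by (simp add: powr_powr)
      finally have "measure lborel (ball x (sqrt t)) = unit_ball_vol CARD('m) * t powr (CARD('m) / 2)"
        using content_ball[of "sqrt t" x] t by simp
      then show ?thesis
        by (simp only: unit_ball_vol_def ball_const_def rGamma_inverse_Gamma divide_inverse
          fact_0 of_nat_0 add_0_right mult_1_right)
    qed
    finally show ?case by simp
  next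
    case (Suc k)
    let ?m = "real CARD('m)"
    let ?S = "\<lambda>k. ball_const CARD('m) k * t powr (?m / 2 + k)"
    have "solid (Suc (Suc k)) x t (\<lambda>_. 0) = 0" by (simp add: solid_def)
    then have "0 = complex_of_real (4 * real (Suc (Suc k)) * real (Suc k)) * (of_real (t * ?S k) - solid (Suc k) x t (\<lambda>_. 1))
        - of_real (2 * real (Suc (Suc k)) * ?m) * solid (Suc k) x t (\<lambda>_. 1)"
      using solid_laplacian[OF t subset_UNIV has_laplacian_const, of k x 1] Suc by simp
    also have "\<dots> = of_real (2 * real (Suc (Suc k))) * (of_real (2 * real (Suc k) * t * ?S k) -
        of_real (2 * real (Suc k) + ?m) * solid (Suc k) x t (\<lambda>_. 1))"
      by (simp add: algebra_simps)
    finally have "of_real (2 * real (Suc (Suc k))) * (of_real (2 * real (Suc k) * t * ?S k) -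
        of_real (2 * real (Suc k) + ?m) * solid (Suc k) x t (\<lambda>_. 1)) = (0 :: complex)" by (rule sym)
    moreover have "complex_of_real (2 * real (Suc (Suc k))) \<noteq> 0" by (simp only: of_real_eq_0_iff) simp
    ultimately have "of_real (2 * real (Suc k) + ?m) * solid (Suc k) x t (\<lambda>_. 1) = complex_of_real (2 * real (Suc k) * t * ?S k)"
      by (simp only: mult_eq_0_iff simp_thms eq_iff_diff_eq_0[symmetric])
    moreover have "2 * real (Suc k) * t * ?S k = (2 * real (Suc k) + ?m) * ?S (Suc k)"
    proof -
      have p: "t powr (?m / 2 + real (Suc k)) = t * t powr (?m / 2 + k)"
        using t by (simp add: powr_add algebra_simps)
      have "(?m / 2 + k + 1) * rGamma (?m / 2 + k + 1 + 1) = rGamma (?m / 2 + k + 1)"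
        by (rule rGamma_plus1)
      then have "ball_const CARD('m) k * real (Suc k) = (?m / 2 + real k + 1) * ball_const CARD('m) (Suc k)"
        unfolding ball_const_def by (simp add: algebra_simps)
      then have c: "2 * real (Suc k) * ball_const CARD('m) k = (2 * real (Suc k) + ?m) * ball_const CARD('m) (Suc k)"
        by (simp add: field_simps)
      have "2 * real (Suc k) * t * ?S k = (2 * real (Suc k) * ball_const CARD('m) k) * (t * t powr (?m / 2 + k))"
        by (simp only: mult_ac)
      also have "\<dots> = (2 * real (Suc k) + ?m) * ?S (Suc k)" unfolding c p by (simp only: mult_ac)
      finally show ?thesis .
    qed
    ultimately have "of_real (2 * real (Suc k) + ?m) * solid (Suc k) x t (\<lambda>_. 1) =
        complex_of_real (2 * real (Suc k) + ?m) * of_real (?S (Suc k))"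
      by (simp only: of_real_mult)
    moreover have "complex_of_real (2 * real (Suc k) + ?m) \<noteq> 0"
      using of_real_eq_0_iff[of "2 * real (Suc k) + ?m"] by (simp del: of_real_add)
    ultimately show ?case by (simp only: mult_cancel_left) simp
  qed
  then show ?thesis using solid_mult[of k x t c "\<lambda>_. 1"] by simp
qed

lemma norm_solid_le:
  fixes f :: "real ^ 'm::finite \<Rightarrow> complex"
  assumes t: "t > 0" and f: "continuous_on (cball x (sqrt t)) f"
    and b: "\<And>y. y \<in> cball x (sqrt t) \<Longrightarrow> norm (f y) \<le> b"
  shows "norm (solid k x t f) \<le> b * (ball_const CARD('m) k * t powr (CARD('m) / 2 + k))"
proof -
  have i1: "integrable lborel (\<lambda>y. weight k x t y *\<^sub>R f y)" by (rule integrable_weight[OF f])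
  have i2: "complex_integrable lborel (\<lambda>y. weight k x t y *\<^sub>R of_real b)"
    by (rule integrable_weight) simp
  have "norm (solid k x t f) \<le> (LINT y|lborel. norm (weight k x t y *\<^sub>R f y))"
    unfolding solid_def by (rule integral_norm_bound)
  also have "\<dots> \<le> (LINT y|lborel. Re (weight k x t y *\<^sub>R of_real b))"
  proof (rule integral_mono[OF integrable_norm[OF i1] integrable_Re[OF i2]])
    fix y
    show "norm (weight k x t y *\<^sub>R f y) \<le> Re (weight k x t y *\<^sub>R of_real b)"
      using b[of y] mem_cball_sqrt_iff[of y x t] mult_left_mono[OF _ weight_nonneg]
      by (cases "(norm (y - x))\<^sup>2 < t") (auto simp: weight_nonneg weight_def)
  qed
  also have "\<dots> = Re (solid k x t (\<lambda>_. of_real b))"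
    unfolding solid_def by (rule integral_Re[OF i2])
  finally show ?thesis by (simp add: solid_const[OF t])
qed

text \<open>After normalisation the weights form an approximate identity at \<open>x\<close> with
  total mass \<open>ball_const\<close>. The limit is the initial value that fixes the solid means
  once their derivatives are known.\<close>

lemma tendsto_solid:
  fixes f :: "real ^ 'm::finite \<Rightarrow> complex"
  assumes T: "T > 0" and f: "continuous_on (cball x (sqrt T)) f"
  shows "((\<lambda>t. of_real (t powr - (CARD('m) / 2 + k)) * solid k x t f) \<longlongrightarrow>
    of_real (ball_const CARD('m) k) * f x) (at_right 0)"
  unfolding tendsto_iff
proof (intro allI impI)
  let ?w = "ball_const CARD('m) k"
  fix e :: real assume e: "e > 0"
  define e' where "e' = e / (2 * ?w)"
  have e': "e' > 0" "e' * ?w < e" using e ball_const_pos[of "CARD('m)" k] by (auto simp: e'_def)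
  have "x \<in> cball x (sqrt T)" using T by simp
  then obtain d where d: "d > 0" "\<And>y. y \<in> cball x (sqrt T) \<Longrightarrow> dist y x < d \<Longrightarrow> dist (f y) (f x) < e'"
    using f e' unfolding continuous_on_iff by metis
  have "\<forall>\<^sub>F t in at_right 0. t \<in> {0<..<min T (d\<^sup>2)}"
    using T d by (intro eventually_at_right_real) auto
  then show "\<forall>\<^sub>F t in at_right 0. dist (of_real (t powr - (CARD('m) / 2 + k)) * solid k x t f) (of_real ?w * f x) < e"
  proof eventually_elim
    case (elim t)
    let ?c = "CARD('m) / 2 + k"
    have t: "t > 0" "t < T" "t < d\<^sup>2" using elim by auto
    have sd: "sqrt t < d" using t d real_sqrt_less_mono[OF t(3)] by simp
    have sub: "cball x (sqrt t) \<subseteq> cball x (sqrt T)" using t by (intro subset_cball) simp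
    have ft: "continuous_on (cball x (sqrt t)) f" by (rule continuous_on_subset[OF f sub])
    have "solid k x t f = solid k x t (\<lambda>y. (f y - f x) + f x)" by simp
    also have "\<dots> = solid k x t (\<lambda>y. f y - f x) + solid k x t (\<lambda>y. f x)"
      by (intro solid_add continuous_intros ft)
    also have "solid k x t (\<lambda>y. f x) = f x * of_real (?w * t powr ?c)" by (rule solid_const[OF t(1)])
    finally have "of_real (t powr - ?c) * solid k x t f - of_real ?w * f x =
        of_real (t powr - ?c) * solid k x t (\<lambda>y. f y - f x)
        + (of_real (t powr - ?c * t powr ?c) - 1) * of_real ?w * f x"
      by (simp add: algebra_simps)
    also have pw: "t powr - ?c * t powr ?c = 1" unfolding powr_add[symmetric] using t(1) by simp
    finally have "dist (of_real (t powr - ?c) * solid k x t f) (of_real ?w * f x) =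
        t powr - ?c * norm (solid k x t (\<lambda>y. f y - f x))"
      by (simp add: dist_norm norm_mult)
    also have "\<dots> \<le> t powr - ?c * (e' * (?w * t powr ?c))"
    proof (intro mult_left_mono norm_solid_le t continuous_intros ft)
      fix y assume y: "y \<in> cball x (sqrt t)"
      then have "dist y x < d" using sd by (simp add: dist_commute)
      then show "norm (f y - f x) \<le> e'" using d(2)[of y] y sub by (auto simp: dist_norm)
    qed simp
    also have "\<dots> = e' * ?w * (t powr - ?c * t powr ?c)" by (simp only: mult_ac)
    also have "\<dots> = e' * ?w" unfolding pw by simp
    also have "\<dots> < e" by (rule e')
    finally show ?case .
  qed
qed

lemma has_vector_derivative_zero_unique:
  fixes f :: "real \<Rightarrow> 'a::real_normed_vector"
  assumes d: "\<And>s. s \<in> {0<..<T} \<Longrightarrow> (f has_vector_derivative 0) (at s)"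
    and lim: "(f \<longlongrightarrow> 0) (at_right 0)" and t: "t \<in> {0<..<T}"
  shows "f t = 0"
proof -
  have "f s = f t" if "s \<in> {0<..<T}" for s
    using vector_differentiable_bound[of "{0<..<T}" f "\<lambda>_. 0" 0 s t] d that t
    by (auto intro: has_vector_derivative_at_within)
  moreover have "\<forall>\<^sub>F s in at_right 0. s \<in> {0<..<T}"
    using t by (intro eventually_at_right_real) auto
  ultimately have "\<forall>\<^sub>F s in at_right 0. f s = f t" by (auto elim: eventually_mono)
  then have "((\<lambda>_. f t) \<longlongrightarrow> 0) (at_right (0::real))"
    using lim by (rule Lim_transform_eventually[rotated])
  then show ?thesis by (simp add: tendsto_const_iff)
qed

text \<open>Classically the coefficient of \<open>t^l\<close> is
  \<open>pi^(m/2) K! / (4^l l! Gamma(m/2 + K + l + 1))\<close> times the \<open>l\<close>-th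
  iterated Laplacian. Along a chain this Laplacian is formally
  \<open>(-4)^l (k+1)...(k+l) f (k+l)\<close>; powers of 4 and factorial combine to the signed
  binomial.\<close>

definition pizzetti_coeff :: "nat \<Rightarrow> nat \<Rightarrow> nat \<Rightarrow> nat \<Rightarrow> real" where
  "pizzetti_coeff m K k l = (-1) ^ l * real ((k + l) choose l) * (pi powr (m / 2) * fact K * rGamma (m / 2 + K + l + 1))"

lemma pizzetti_coeff_0: "pizzetti_coeff m K k 0 = ball_const m K"
  by (simp add: pizzetti_coeff_def ball_const_def)

text \<open>Coefficient comparison for the derivative of the Pizzetti polynomial. The Gamma
  arguments agree because \<open>K + (l + 1) = (K + 1) + l\<close>; the factors \<open>Suc l\<close>
  and \<open>Suc k\<close> are exchanged by absorption in the binomial coefficient.\<close>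

lemma pizzetti_coeff_Suc:
  "real (Suc l) * pizzetti_coeff m K k (Suc l) = - (real (Suc k) / real (Suc K)) * pizzetti_coeff m (Suc K) (Suc k) l"
proof -
  have "Suc l * ((k + Suc l) choose Suc l) = Suc k * ((Suc k + l) choose l)"
  proof -
    have "Suc l * (Suc (k + l) choose Suc l) = Suc (k + l) * ((k + l) choose l)"
      by (rule Suc_times_binomial)
    also have "\<dots> = Suc k * (Suc (k + l) choose Suc k)"
      using Suc_times_binomial[of k "k + l"] by (simp add: binomial_symmetric[of l "k + l"])
    also have "Suc (k + l) choose Suc k = (Suc k + l) choose l"
      using binomial_symmetric[of l "Suc k + l"] by simp
    finally show ?thesis by simp
  qed
  then have b: "real (Suc l) * real ((k + Suc l) choose Suc l) = real (Suc k) * real ((Suc k + l) choose l)"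
    by (metis of_nat_mult)
  have "real (Suc l) * pizzetti_coeff m K k (Suc l) =
      (-1) ^ Suc l * (real (Suc l) * real ((k + Suc l) choose Suc l)) * (pi powr (m / 2) * fact K * rGamma (m / 2 + K + Suc l + 1))"
    by (simp only: pizzetti_coeff_def mult_ac)
  also have "\<dots> = - (real (Suc k) / real (Suc K)) * pizzetti_coeff m (Suc K) (Suc k) l"
    unfolding b pizzetti_coeff_def by (simp add: field_simps)
  finally show ?thesis .
qed

section \<open>Pizzetti formula for solid means\<close>

text \<open>The factor \<open>Suc k\<close> is the multiplicity found by double counting in
  \<open>sum_insert_pair_supersets\<close>. With \<open>vanish\<close> the last member
  \<open>f n\<close> is harmonic in \<open>\<Omega>\<close>, and the downward inductions on
  \<open>k\<close> have a trivial start at \<open>Suc n\<close>.\<close>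

locale polyharmonic_chain =
  fixes \<Omega> :: "(real ^ 'm::finite) set" and f :: "nat \<Rightarrow> real ^ 'm \<Rightarrow> complex" and n :: nat
  assumes laplacian: "\<And>k. has_laplacian \<Omega> (f k) (\<lambda>x. - 4 * of_nat (Suc k) * f (Suc k) x)"
    and vanish: "\<And>k x. k > n \<Longrightarrow> f k x = 0"
begin

lemma continuous_on_f: "continuous_on \<Omega> (f k)"
  using laplacian by (rule has_laplacian_continuous)

definition solid_mean :: "nat \<Rightarrow> nat \<Rightarrow> real ^ 'm \<Rightarrow> real \<Rightarrow> complex" where
  "solid_mean K k x t = of_real (t powr - (CARD('m) / 2 + K)) * solid K x t (f k)"

definition pizzetti_sum :: "nat \<Rightarrow> nat \<Rightarrow> real ^ 'm \<Rightarrow> real \<Rightarrow> complex" where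
  "pizzetti_sum K k x t = (\<Sum>l\<le>n. of_real (pizzetti_coeff CARD('m) K k l * t ^ l) * f (k + l) x)"

text \<open>The product rule leaves integrals of \<open>f k\<close> with exponents \<open>K\<close>
  and \<open>K + 1\<close>. Exactly this combination is equated by \<open>solid_laplacian\<close>
  with the exponent \<open>K + 2\<close> integral of the Laplacian, so that the derivative involves
  \<open>f (Suc k)\<close> alone.\<close>

lemma has_vector_derivative_solid_mean:
  assumes t: "0 < t" "t < T" and \<Omega>: "cball x (sqrt T) \<subseteq> \<Omega>"
  shows "((\<lambda>s. solid_mean (Suc K) k x s) has_vector_derivative
    - of_real (real (Suc k) / real (Suc (Suc K))) * solid_mean (Suc (Suc K)) (Suc k) x t) (at t)"
proof -
  let ?c = "CARD('m) / 2 + real (Suc K)"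
  have sub: "cball x (sqrt t) \<subseteq> \<Omega>"
    using \<Omega> t subset_cball[of "sqrt t" "sqrt T" x] by auto
  have "((\<lambda>s. s powr - ?c) has_real_derivative - ?c * t powr (- ?c - 1)) (at t)"
    using t by (auto intro!: derivative_eq_intros)
  then have p: "((\<lambda>s. of_real (s powr - ?c)) has_vector_derivative complex_of_real (- ?c * t powr (- ?c - 1))) (at t)"
    by (intro has_vector_derivative_of_real) (simp add: has_real_derivative_iff_has_vector_derivative)
  have q: "((\<lambda>s. solid (Suc K) x s (f k)) has_vector_derivative of_nat (Suc K) * solid K x t (f k)) (at t)"
    by (rule has_vector_derivative_solid[OF t continuous_on_subset[OF continuous_on_f \<Omega>]])
  let ?S0 = "solid K x t (f k)" and ?S1 = "solid (Suc K) x t (f k)" and ?S2 = "solid (Suc (Suc K)) x t (f (Suc k))"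
  have e1: "t powr - (CARD('m) / 2 + real (Suc (Suc K))) = t powr (- ?c - 1)" by (simp add: algebra_simps)
  have e2: "t powr - ?c = t * t powr (- ?c - 1)" using t powr_add[of t 1 "- ?c - 1"] by (simp add: algebra_simps)
  have "- 4 * of_nat (Suc k) * ?S2 = 4 * of_nat (Suc (Suc K)) * of_nat (Suc K) * (of_real t * ?S0 - ?S1)
      - 2 * of_nat (Suc (Suc K)) * of_nat CARD('m) * ?S1"
    using solid_laplacian[OF t(1) sub laplacian, of K k] by (simp only: solid_mult)
  \<comment> \<open>The identity of \<open>solid_laplacian\<close> divided by four, with
    \<open>m\<close> standing for half the dimension.\<close>
  moreover have "a * (A * \<tau> * S0 - (m + A) * S1) = - b * S2"
    if "- 4 * b * S2 = 4 * a * A * (\<tau> * S0 - S1) - 2 * a * (2 * m) * S1" for a A b m \<tau> S0 S1 S2 :: complex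
  proof -
    have "4 * (a * (A * \<tau> * S0 - (m + A) * S1)) = 4 * (- b * S2)"
      using that by (simp add: algebra_simps)
    then show ?thesis by (subst (asm) mult_left_cancel) simp_all
  qed
  from this[where m = "of_real (CARD('m) / 2)"]
  have "- 4 * of_nat (Suc k) * ?S2 = 4 * of_nat (Suc (Suc K)) * of_nat (Suc K) * (of_real t * ?S0 - ?S1)
      - 2 * of_nat (Suc (Suc K)) * of_nat CARD('m) * ?S1 \<Longrightarrow>
      of_nat (Suc (Suc K)) * (of_nat (Suc K) * of_real t * ?S0 - of_real ?c * ?S1) = - of_nat (Suc k) * ?S2"
    by (simp del: of_nat_Suc)
  ultimately have "of_nat (Suc (Suc K)) * (of_nat (Suc K) * of_real t * ?S0 - of_real ?c * ?S1) = - of_nat (Suc k) * ?S2"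
    by blast
  then have "of_nat (Suc K) * of_real t * ?S0 - of_real ?c * ?S1 = - of_real (real (Suc k) / real (Suc (Suc K))) * ?S2"
    by (simp add: field_simps del: of_nat_Suc)
  then have "of_real (t powr (- ?c - 1)) * (of_nat (Suc K) * of_real t * ?S0 - of_real ?c * ?S1) =
      of_real (t powr (- ?c - 1)) * (- of_real (real (Suc k) / real (Suc (Suc K))) * ?S2)" by simp
  then have "of_real (t powr - ?c) * (of_nat (Suc K) * ?S0) + complex_of_real (- ?c * t powr (- ?c - 1)) * ?S1
      = - of_real (real (Suc k) / real (Suc (Suc K))) * solid_mean (Suc (Suc K)) (Suc k) x t"
    unfolding solid_mean_def e1 unfolding e2 by (simp only: of_real_mult of_real_minus) (simp add: algebra_simps)
  then show ?thesis
    using has_vector_derivative_mult[OF p q] unfolding solid_mean_def[of "Suc K"] by simp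
qed

lemma has_vector_derivative_pizzetti_sum:
  "((\<lambda>s. pizzetti_sum K k x s) has_vector_derivative
    - of_real (real (Suc k) / real (Suc K)) * pizzetti_sum (Suc K) (Suc k) x t) (at t)"
proof -
  have "((\<lambda>s. pizzetti_sum K k x s) has_vector_derivative
      (\<Sum>l\<le>n. of_real (pizzetti_coeff CARD('m) K k l * (real l * t ^ (l - 1))) * f (k + l) x)) (at t)"
    unfolding pizzetti_sum_def
  proof (intro has_vector_derivative_sum has_vector_derivative_mult_left has_vector_derivative_of_real)
    fix l
    show "((\<lambda>s. pizzetti_coeff CARD('m) K k l * s ^ l) has_real_derivative
        pizzetti_coeff CARD('m) K k l * (real l * t ^ (l - 1))) (at t)"
      by (auto intro!: derivative_eq_intros)
  qed
  \<comment> \<open>The added summand \<open>l = Suc n\<close> contains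
    \<open>f (k + Suc n) = 0\<close>; it makes the sum keep its range \<open>l \<le> n\<close> after
    the index shift.\<close>
  also have "(\<Sum>l\<le>n. of_real (pizzetti_coeff CARD('m) K k l * (real l * t ^ (l - 1))) * f (k + l) x) =
      (\<Sum>l\<le>Suc n. of_real (pizzetti_coeff CARD('m) K k l * (real l * t ^ (l - 1))) * f (k + l) x)"
    by (simp add: vanish)
  also have "\<dots> = (\<Sum>l\<le>n. of_real (pizzetti_coeff CARD('m) K k (Suc l) * (real (Suc l) * t ^ l)) * f (Suc k + l) x)"
    by (subst sum.atMost_Suc_shift) simp
  also have "\<dots> = (\<Sum>l\<le>n. - of_real (real (Suc k) / real (Suc K)) *
      (of_real (pizzetti_coeff CARD('m) (Suc K) (Suc k) l * t ^ l) * f (Suc k + l) x))"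
  proof (intro sum.cong refl)
    fix l
    have "pizzetti_coeff CARD('m) K k (Suc l) * (real (Suc l) * t ^ l) =
        - (real (Suc k) / real (Suc K)) * (pizzetti_coeff CARD('m) (Suc K) (Suc k) l * t ^ l)"
    proof -
      have "pizzetti_coeff CARD('m) K k (Suc l) * (real (Suc l) * t ^ l) =
          (real (Suc l) * pizzetti_coeff CARD('m) K k (Suc l)) * t ^ l"
        by (simp only: mult_ac)
      then show ?thesis unfolding pizzetti_coeff_Suc by (simp only: mult.assoc)
    qed
    then show "of_real (pizzetti_coeff CARD('m) K k (Suc l) * (real (Suc l) * t ^ l)) * f (Suc k + l) x =
        - of_real (real (Suc k) / real (Suc K)) * (of_real (pizzetti_coeff CARD('m) (Suc K) (Suc k) l * t ^ l) * f (Suc k + l) x)"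
      by (simp only: of_real_mult of_real_minus mult.assoc)
  qed
  finally show ?thesis by (simp only: pizzetti_sum_def sum_distrib_left)
qed

lemma tendsto_solid_mean:
  assumes "T > 0" "cball x (sqrt T) \<subseteq> \<Omega>"
  shows "((\<lambda>t. solid_mean K k x t) \<longlongrightarrow> of_real (ball_const CARD('m) K) * f k x) (at_right 0)"
  unfolding solid_mean_def
  by (rule tendsto_solid[OF assms(1) continuous_on_subset[OF continuous_on_f assms(2)]])

lemma tendsto_pizzetti_sum:
  "((\<lambda>t. pizzetti_sum K k x t) \<longlongrightarrow> of_real (ball_const CARD('m) K) * f k x) (at_right 0)"
proof -
  have "continuous (at_right 0) (pizzetti_sum K k x)"
    unfolding pizzetti_sum_def by (intro continuous_intros)
  then have "((\<lambda>t. pizzetti_sum K k x t) \<longlongrightarrow> pizzetti_sum K k x 0) (at_right 0)"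
    by (simp add: continuous_within)
  moreover have "pizzetti_sum K k x 0 = of_real (ball_const CARD('m) K) * f k x"
    unfolding pizzetti_sum_def by (simp add: sum.atMost_shift pizzetti_coeff_0)
  ultimately show ?thesis by simp
qed

text \<open>Downward induction on \<open>k\<close> from \<open>Suc n\<close>, where both sides
  vanish. Differentiation raises \<open>k\<close> and the exponent together, so the induction runs
  over all \<open>K\<close> at once; both sides then have equal derivatives, and the common limit at
  0 excludes an additive constant.\<close>

theorem solid_mean_eq:
  assumes t: "0 < t" "t < T" and \<Omega>: "cball x (sqrt T) \<subseteq> \<Omega>"
  shows "solid_mean (Suc K) k x t = pizzetti_sum (Suc K) k x t"
proof -
  have "\<forall>t\<in>{0<..<T}. solid_mean (Suc K) k x t = pizzetti_sum (Suc K) k x t" if "k \<le> Suc n" for K k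
    using that
  proof (induction k arbitrary: K rule: inc_induct)
    case base
    then show ?case
      by (simp add: solid_mean_def pizzetti_sum_def solid_def vanish)
  next
    case (step k)
    show ?case
    proof
      fix t assume t: "t \<in> {0<..<T}"
      have "solid_mean (Suc K) k x t - pizzetti_sum (Suc K) k x t = 0"
      proof (rule has_vector_derivative_zero_unique[OF _ _ t])
        show "((\<lambda>t. solid_mean (Suc K) k x t - pizzetti_sum (Suc K) k x t) \<longlongrightarrow> 0) (at_right 0)"
          using tendsto_diff[OF tendsto_solid_mean[OF _ \<Omega>, of "Suc K" k] tendsto_pizzetti_sum[of "Suc K" k x]] t
          by simp
        fix s assume s: "s \<in> {0<..<T}"
        show "((\<lambda>t. solid_mean (Suc K) k x t - pizzetti_sum (Suc K) k x t) has_vector_derivative 0) (at s)"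
          using has_vector_derivative_diff[OF has_vector_derivative_solid_mean[OF _ _ \<Omega>, of s K k]
            has_vector_derivative_pizzetti_sum[of "Suc K" k x s]] step.IH[of "Suc K"] s
          by simp
      qed
      then show "solid_mean (Suc K) k x t = pizzetti_sum (Suc K) k x t" by simp
    qed
  qed
  moreover have "solid_mean (Suc K) k x t = pizzetti_sum (Suc K) k x t" if "k > n"
    using that by (simp add: solid_mean_def pizzetti_sum_def solid_def vanish)
  ultimately show ?thesis using t by (cases "k \<le> n") auto
qed

end

section \<open>Spherical means\<close>

text \<open>\<open>measure_of\<close> falls back to the zero measure unless the given set function
  is countably additive. Recognising it as the push-forward of \<open>m\<close> times Lebesgue
  measure on the punctured ball under radial projection settles this and supplies the integration
  formula.\<close>

lemma sphere_measure_eq: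
  "(sphere_measure :: (real ^ 'm::finite) measure) =
    distr (density (restrict_space lborel (cball 0 1 - {0})) (\<lambda>_. ennreal (real CARD('m))))
      (restrict_space borel (sphere 0 1)) (\<lambda>x. x /\<^sub>R norm x)"
  (is "_ = ?\<mu>")
proof -
  let ?D = "cball 0 1 - {0} :: (real ^ 'm) set" and ?S = "sphere 0 1 :: (real ^ 'm) set"
  let ?g = "\<lambda>x :: real ^ 'm. x /\<^sub>R norm x"
  have g: "?g \<in> restrict_space lborel ?D \<rightarrow>\<^sub>M restrict_space borel ?S"
    by (rule measurable_restrict_space3) auto
  have S: "sets (restrict_space borel ?S) = {E. E \<subseteq> ?S \<and> E \<in> sets borel}"
    by (auto simp: sets_restrict_space image_iff)
  have "sphere_measure = measure_of ?S {E. E \<subseteq> ?S \<and> E \<in> sets borel} (emeasure ?\<mu>)"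
    unfolding sphere_measure_def
  proof (rule measure_of_eq)
    fix E assume "E \<in> sigma_sets ?S {E. E \<subseteq> ?S \<and> E \<in> sets borel}"
    then have E: "E \<in> sets (restrict_space borel ?S)"
      unfolding S[symmetric] using sets.sigma_sets_eq[of "restrict_space borel ?S"] by (simp add: space_restrict_space)
    \<comment> \<open>The preimage of \<open>E\<close> under radial projection is the cone in the
      definition of the surface measure.\<close>
    have pre: "?g -` E \<inter> ?D = {r *\<^sub>R \<xi> | r \<xi>. 0 < r \<and> r \<le> 1 \<and> \<xi> \<in> E}"
    proof (intro equalityI subsetI)
      fix x assume "x \<in> ?g -` E \<inter> ?D"
      then show "x \<in> {r *\<^sub>R \<xi> | r \<xi>. 0 < r \<and> r \<le> 1 \<and> \<xi> \<in> E}"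
        by (auto intro!: exI[of _ "norm x"] exI[of _ "?g x"])
    next
      fix x assume "x \<in> {r *\<^sub>R \<xi> | r \<xi>. 0 < r \<and> r \<le> 1 \<and> \<xi> \<in> E}"
      then obtain r \<xi> where x: "x = r *\<^sub>R \<xi>" "0 < r" "r \<le> 1" "\<xi> \<in> E" by auto
      then have "norm \<xi> = 1" using E S by auto
      then show "x \<in> ?g -` E \<inter> ?D" using x by auto
    qed
    have sp: "space (restrict_space lborel ?D) = ?D" by (simp add: space_restrict_space)
    have m: "?g -` E \<inter> ?D \<in> sets (restrict_space lborel ?D)"
      using measurable_sets[OF g E] unfolding sp .
    have "emeasure ?\<mu> E = emeasure (density (restrict_space lborel ?D) (\<lambda>_. ennreal (real CARD('m)))) (?g -` E \<inter> ?D)"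
      by (subst emeasure_distr) (use g E in \<open>auto simp: space_restrict_space measurable_cong_sets[OF sets_density refl]\<close>)
    also have "\<dots> = ennreal (real CARD('m)) * emeasure (restrict_space lborel ?D) (?g -` E \<inter> ?D)"
      by (rule emeasure_density_const[OF m])
    also have "emeasure (restrict_space lborel ?D) (?g -` E \<inter> ?D) = emeasure lborel (?g -` E \<inter> ?D)"
      by (rule emeasure_restrict_space) auto
    finally show "of_nat CARD('m) * emeasure lborel {r *\<^sub>R \<xi> | r \<xi>. 0 < r \<and> r \<le> 1 \<and> \<xi> \<in> E} = emeasure ?\<mu> E"
      unfolding pre by (simp add: ennreal_of_nat_eq_real_of_nat)
  qed auto
  also have "\<dots> = measure_of (space ?\<mu>) (sets ?\<mu>) (emeasure ?\<mu>)"
    by (simp add: S space_restrict_space)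
  also have "\<dots> = ?\<mu>" by (rule measure_of_of_measure)
  finally show ?thesis .
qed

lemma space_sphere_measure: "space (sphere_measure :: (real ^ 'm::finite) measure) = sphere 0 1"
  unfolding sphere_measure_eq by (simp add: space_restrict_space)

lemma sets_sphere_measure:
  "sets (sphere_measure :: (real ^ 'm::finite) measure) = sets (restrict_space borel (sphere 0 1))"
  unfolding sphere_measure_eq by simp

lemma finite_measure_sphere_measure: "finite_measure (sphere_measure :: (real ^ 'm::finite) measure)"
proof (rule finite_measureI)
  let ?D = "cball 0 1 - {0} :: (real ^ 'm) set"
  have g: "(\<lambda>x. x /\<^sub>R norm x) \<in> restrict_space lborel ?D \<rightarrow>\<^sub>M restrict_space borel (sphere 0 1)"
    by (rule measurable_restrict_space3) auto
  have "emeasure sphere_measure (sphere 0 1 :: (real ^ 'm) set) \<le>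
      ennreal (real CARD('m)) * emeasure (restrict_space lborel ?D) (space (restrict_space lborel ?D))"
    unfolding sphere_measure_eq
  proof (subst emeasure_distr)
    show "emeasure (density (restrict_space lborel ?D) (\<lambda>_. ennreal (real CARD('m))))
        ((\<lambda>x. x /\<^sub>R norm x) -` sphere 0 1 \<inter> space (density (restrict_space lborel ?D) (\<lambda>_. ennreal (real CARD('m)))))
        \<le> ennreal (real CARD('m)) * emeasure (restrict_space lborel ?D) (space (restrict_space lborel ?D))"
      by (rule order_trans[OF emeasure_space])
        (simp only: space_density emeasure_density_const[OF sets.top] order_refl)
  qed (use g in \<open>auto simp: measurable_cong_sets[OF sets_density refl] sets_restrict_space\<close>)
  also have "\<dots> \<le> ennreal (real CARD('m)) * emeasure lborel (cball 0 1 :: (real ^ 'm) set)"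
    by (intro mult_left_mono) (auto simp: emeasure_restrict_space space_restrict_space intro!: emeasure_mono)
  also have "\<dots> < \<infinity>" by (simp add: emeasure_cball ennreal_mult_less_top)
  finally show "emeasure sphere_measure (space (sphere_measure :: (real ^ 'm) measure)) \<noteq> \<infinity>"
    by (simp add: space_sphere_measure)
qed

lemma integral_sphere_measure:
  fixes \<phi> :: "real ^ 'm::finite \<Rightarrow> complex"
  assumes \<phi>: "continuous_on (sphere 0 1) \<phi>"
  shows "integral\<^sup>L sphere_measure \<phi> =
    of_nat CARD('m) * (LINT x|lborel. indicator (cball 0 1 - {0}) x *\<^sub>R \<phi> (x /\<^sub>R norm x))"
proof -
  let ?D = "cball 0 1 - {0} :: (real ^ 'm) set"
  have g: "(\<lambda>x. x /\<^sub>R norm x) \<in> restrict_space lborel ?D \<rightarrow>\<^sub>M restrict_space borel (sphere 0 1)"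
    by (rule measurable_restrict_space3) auto
  have m: "\<phi> \<in> borel_measurable (restrict_space borel (sphere 0 1))"
    by (rule borel_measurable_continuous_on_restrict[OF \<phi>])
  have mg: "(\<lambda>x. \<phi> (x /\<^sub>R norm x)) \<in> borel_measurable (restrict_space lborel ?D)"
    using measurable_compose[OF g m] .
  have "integral\<^sup>L sphere_measure \<phi> =
      (LINT x|density (restrict_space lborel ?D) (\<lambda>_. ennreal (real CARD('m))). \<phi> (x /\<^sub>R norm x))"
    unfolding sphere_measure_eq
    by (rule integral_distr) (use g m in \<open>auto simp: measurable_cong_sets[OF sets_density refl]\<close>)
  also have "\<dots> = (LINT x|restrict_space lborel ?D. real CARD('m) *\<^sub>R \<phi> (x /\<^sub>R norm x))"
    by (rule integral_density) (use mg in auto)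
  also have "\<dots> = of_nat CARD('m) * (LINT x|restrict_space lborel ?D. \<phi> (x /\<^sub>R norm x))"
    by (simp add: scaleR_conv_of_real)
  also have "(LINT x|restrict_space lborel ?D. \<phi> (x /\<^sub>R norm x)) =
      (LINT x|lborel. indicator ?D x *\<^sub>R \<phi> (x /\<^sub>R norm x))"
    by (rule integral_restrict_space) auto
  finally show ?thesis .
qed

lemma integral_lborel_scale:
  fixes G :: "real ^ 'm::finite \<Rightarrow> complex"
  assumes c: "c > 0" and G: "G \<in> borel_measurable borel"
  shows "(LINT y|lborel. G y) = of_real (c ^ CARD('m)) * (LINT y|lborel. G (c *\<^sub>R y))"
proof -
  have "(LINT y|lborel. G y) =
      (LINT y|density (distr lborel borel (\<lambda>x. 0 + c *\<^sub>R x)) (\<lambda>_. ennreal (\<bar>c\<bar> ^ DIM(real ^ 'm))). G y)"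
    using c by (subst lborel_affine[of c 0]) auto
  also have "\<dots> = (LINT y|distr lborel borel (\<lambda>x. 0 + c *\<^sub>R x). (\<bar>c\<bar> ^ DIM(real ^ 'm)) *\<^sub>R G y)"
    by (rule integral_density) (use G in auto)
  also have "\<dots> = (LINT y|lborel. (\<bar>c\<bar> ^ DIM(real ^ 'm)) *\<^sub>R G (0 + c *\<^sub>R y))"
    by (rule integral_distr) (use G in auto)
  also have "\<dots> = of_real (c ^ CARD('m)) * (LINT y|lborel. G (c *\<^sub>R y))"
    using c by (simp add: scaleR_conv_of_real)
  finally show ?thesis .
qed

text \<open>Compare f with the function H that is constant along rays and agrees with f on the sphere of
  radius \<surd>t. The ball integral W of H scales exactly, and the ball integral of f - H has derivative 0
  at t because f - H is uniformly small on thin shells around that sphere.\<close>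
lemma has_vector_derivative_solid_0:
  fixes f :: "real ^ 'm::finite \<Rightarrow> complex"
  assumes t: "0 < t" "t < T" and f: "continuous_on (cball 0 (sqrt T)) f"
  shows "((\<lambda>s. solid 0 0 s f) has_vector_derivative
    of_real (t powr (CARD('m) / 2 - 1) / 2) * (LINT \<xi>|sphere_measure. f (sqrt t *\<^sub>R \<xi>))) (at t)"
proof -
  let ?m = "real CARD('m)" and ?c = "ball_const CARD('m) 0"
  define p where "p s = s powr (?m / 2)" for s :: real
  define H where "H y = f (sqrt t *\<^sub>R (y /\<^sub>R norm y))" for y
  define W where "W s = (LINT y|lborel. weight 0 0 s y *\<^sub>R H y)" for s
  have T: "sqrt t < sqrt T" "0 < sqrt t" "0 < sqrt T" using t by auto
  have sub: "cball 0 (sqrt s) \<subseteq> cball (0 :: real ^ 'm) (sqrt T)" if "s < T" for s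
    using that by (intro subset_cball) simp
  have inT: "sqrt t *\<^sub>R (y /\<^sub>R norm y) \<in> cball 0 (sqrt T)" for y :: "real ^ 'm"
    using T by (cases "y = 0") (auto simp: less_imp_le mult.assoc)
  have Hm: "H \<in> borel_measurable borel"
  proof -
    \<comment> \<open>\<open>f\<close> is controlled only on the closed ball. Cut off by the
      indicator it is Borel on the whole space, and the argument at which \<open>H\<close> evaluates
      it never leaves the ball.\<close>
    have "(\<lambda>y. indicator (cball 0 (sqrt T)) y *\<^sub>R f y) \<in> borel_measurable borel"
      by (intro borel_measurable_continuous_on_indicator f) auto
    then have "(\<lambda>y. indicat_real (cball 0 (sqrt T)) (sqrt t *\<^sub>R (y /\<^sub>R norm y)) *\<^sub>R f (sqrt t *\<^sub>R (y /\<^sub>R norm y))) \<in> borel_measurable borel"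
      by (rule measurable_compose[rotated]) auto
    then show ?thesis using inT unfolding H_def by simp
  qed
  obtain C where C: "0 \<le> C" "\<And>y. y \<in> cball 0 (sqrt T) \<Longrightarrow> norm (f y) \<le> C"
    using compact_norm_bound[OF compact_cball f] by blast
  have HC: "norm (H y) \<le> C" for y unfolding H_def by (rule C(2)[OF inT])
  have iH: "integrable lborel (\<lambda>y. weight 0 0 s y *\<^sub>R H y)" for s
  proof (rule Bochner_Integration.integrable_bound)
    show "complex_integrable lborel (\<lambda>y::real ^ 'm. weight 0 0 s y *\<^sub>R of_real C)"
      by (rule integrable_weight) simp
    show "(\<lambda>y. weight 0 0 s y *\<^sub>R H y) \<in> borel_measurable lborel"
      using Hm by measurable
    show "AE y in lborel. norm (weight 0 0 s y *\<^sub>R H y) \<le> norm (weight 0 0 s y *\<^sub>R complex_of_real C)"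
      using HC C by (intro AE_I2) (auto simp: weight_nonneg intro!: mult_left_mono)
  qed
  have W_scale: "W s = of_real (p s) * W 1" if s: "s > 0" for s
  proof -
    have "W s = of_real (sqrt s ^ CARD('m)) * (LINT y|lborel. weight 0 0 s (sqrt s *\<^sub>R y) *\<^sub>R H (sqrt s *\<^sub>R y))"
      unfolding W_def using s Hm by (intro integral_lborel_scale) auto
    also have "(\<lambda>y. weight 0 0 s (sqrt s *\<^sub>R y) *\<^sub>R H (sqrt s *\<^sub>R y)) = (\<lambda>y. weight 0 0 1 y *\<^sub>R H y)"
    proof
      fix y :: "real ^ 'm"
      have "(norm (sqrt s *\<^sub>R y))\<^sup>2 < s \<longleftrightarrow> (norm y)\<^sup>2 < 1"
        using s by (simp add: power_mult_distrib)
      moreover have "sqrt s *\<^sub>R y /\<^sub>R norm (sqrt s *\<^sub>R y) = y /\<^sub>R norm y" using s by simp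
      ultimately show "weight 0 0 s (sqrt s *\<^sub>R y) *\<^sub>R H (sqrt s *\<^sub>R y) = weight 0 0 1 y *\<^sub>R H y"
        by (simp only: weight_def H_def diff_zero power_0)
    qed
    also have "sqrt s ^ CARD('m) = p s"
    proof -
      have "sqrt s ^ CARD('m) = (s powr (1 / 2)) powr CARD('m)"
        using s by (simp add: powr_half_sqrt powr_realpow)
      then show ?thesis by (simp add: p_def powr_powr)
    qed
    finally show ?thesis by (simp add: W_def)
  qed
  have sphere: "(LINT \<xi>|sphere_measure. f (sqrt t *\<^sub>R \<xi>)) = of_real ?m * W 1"
  proof -
    have "continuous_on (sphere 0 1) (\<lambda>\<xi>. f (sqrt t *\<^sub>R \<xi>))"
      by (rule continuous_on_compose2[OF f]) (use T in \<open>auto intro!: continuous_intros simp: less_imp_le\<close>)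
    from integral_sphere_measure[OF this]
    have "(LINT \<xi>|sphere_measure. f (sqrt t *\<^sub>R \<xi>)) =
        of_real ?m * (LINT x|lborel. indicat_real (cball 0 1 - {0}) x *\<^sub>R H x)"
      by (simp add: H_def)
    also have "(LINT x|lborel. indicat_real (cball 0 1 - {0}) x *\<^sub>R H x) = W 1"
      unfolding W_def
    proof (rule integral_cong_AE)
      show "AE x in lborel. indicat_real (cball 0 1 - {0}) x *\<^sub>R H x = weight 0 0 1 x *\<^sub>R H x"
        using AE_not_sphere[of 0 1] AE_lborel_singleton[of 0]
      proof eventually_elim
        case (elim x)
        then show ?case using mem_ball_sqrt_iff[of x 0 1]
          by (cases "norm x < 1") (auto simp: weight_def indicator_def)
      qed
    qed (use Hm in \<open>auto intro!: borel_measurable_scaleR borel_measurable_indicator\<close>)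
    finally show ?thesis .
  qed
  define g where "g s = solid 0 0 s f - W s" for s
  have p': "(p has_real_derivative ?m / 2 * t powr (?m / 2 - 1)) (at t)"
    unfolding p_def using t by (auto intro!: derivative_eq_intros)
  let ?L = "?m / 2 * t powr (?m / 2 - 1)"
  define B where "B = norm ?L + 1"
  have "((\<lambda>s. norm ((p s - p t) /\<^sub>R (s - t))) \<longlongrightarrow> norm ?L) (at t)"
    using p' unfolding has_real_derivative_iff_has_vector_derivative has_vector_derivative_iff_tendsto
    by (rule tendsto_norm)
  from order_tendstoD(2)[OF this, of B]
  have B: "B > 0" "\<forall>\<^sub>F s in at t. norm ((p s - p t) /\<^sub>R (s - t)) \<le> B"
    by (auto simp: B_def elim: eventually_mono intro!: add_nonneg_pos)
  have g': "(g has_vector_derivative 0) (at t)"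
    unfolding has_vector_derivative_iff_tendsto
  proof (rule tendstoI)
    fix e :: real assume e: "e > 0"
    \<comment> \<open>\<open>e'\<close> bounds \<open>|f - H|\<close> on the shell between the two
      radii. The shell has volume \<open>?c * |p s - p t|\<close>, and \<open>B\<close> bounds the
      difference quotient of \<open>p\<close>, so the quotient of \<open>g\<close> stays below
      \<open>e' * ?c * B = e / 2\<close>.\<close>
    define e' where "e' = e / (2 * ?c * B)"
    have c: "?c > 0" by (rule ball_const_pos)
    have e': "e' > 0" "e' * ?c * B < e" using e B c by (auto simp: e'_def)
    have "uniformly_continuous_on (cball 0 (sqrt T)) f"
      by (rule compact_uniformly_continuous[OF f compact_cball])
    then obtain d where d: "d > 0" "\<And>x y. x \<in> cball 0 (sqrt T) \<Longrightarrow> y \<in> cball 0 (sqrt T) \<Longrightarrow> dist x y < d \<Longrightarrow> dist (f x) (f y) < e'"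
      using e' unfolding uniformly_continuous_on_def by metis
    have "isCont sqrt t" by (rule isCont_real_sqrt)
    then have "\<forall>\<^sub>F s in at t. dist (sqrt s) (sqrt t) < d"
      using d(1) by (simp add: isCont_def tendstoD)
    moreover have "\<forall>\<^sub>F s in at t. s \<in> {0<..<T}" using t by (intro eventually_at_in_open') auto
    moreover have "\<forall>\<^sub>F s in at t. s \<noteq> t" by (simp add: eventually_at_filter)
    ultimately show "\<forall>\<^sub>F s in at t. dist ((g s - g t) /\<^sub>R (s - t)) 0 < e"
      using B(2)
    proof eventually_elim
      case (elim s)
      let ?v = "\<lambda>y::real ^ 'm. weight 0 0 s y - weight 0 0 t y"
      have if': "complex_integrable lborel (\<lambda>y. weight 0 0 r y *\<^sub>R f y)" if "r < T" for r
        by (intro integrable_weight continuous_on_subset[OF f sub[OF that]])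
      have ig: "complex_integrable lborel (\<lambda>y. ?v y *\<^sub>R (f y - H y))"
        using Bochner_Integration.integrable_diff[OF Bochner_Integration.integrable_diff[OF if'[of s] iH[of s]]
          Bochner_Integration.integrable_diff[OF if'[of t] iH[of t]]] elim t
        by (simp add: algebra_simps)
      have iv: "integrable lborel ?v"
      proof -
        have "integrable lborel (\<lambda>y::real ^ 'm. Re (weight 0 0 r y *\<^sub>R 1))" for r
          by (intro integrable_Re integrable_weight) simp
        then show ?thesis by simp
      qed
      have Iv: "(LINT y|lborel. ?v y) = ?c * (p s - p t)"
      proof -
        have "(LINT y|lborel. weight 0 (0::real ^ 'm) r y) = ?c * p r" if "r > 0" for r
        proof -
          have "complex_of_real (LINT y|lborel. weight 0 (0::real ^ 'm) r y) = solid 0 (0::real ^ 'm) r (\<lambda>_. 1)"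
            unfolding solid_def by (simp add: scaleR_conv_of_real integral_complex_of_real)
          also have "\<dots> = of_real (?c * p r)"
            using solid_const[OF that, of 0 "0::real ^ 'm" 1] by (simp add: p_def)
          finally show ?thesis by (simp only: of_real_eq_iff)
        qed
        moreover have "integrable lborel (\<lambda>y::real ^ 'm. weight 0 0 r y)" for r
          using integrable_Re[OF integrable_weight[of "0::real ^ 'm" r "\<lambda>_. 1" 0]] by simp
        ultimately show ?thesis using elim t by (simp add: algebra_simps)
      qed
      have "g s - g t = (LINT y|lborel. ?v y *\<^sub>R (f y - H y))"
      proof -
        have "g s - g t = (LINT y|lborel. (weight 0 0 s y *\<^sub>R f y - weight 0 0 s y *\<^sub>R H y)
            - (weight 0 0 t y *\<^sub>R f y - weight 0 0 t y *\<^sub>R H y))"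
          unfolding g_def W_def solid_def using elim t if' iH by simp
        also have "\<dots> = (LINT y|lborel. ?v y *\<^sub>R (f y - H y))"
          by (intro Bochner_Integration.integral_cong refl) (simp add: algebra_simps)
        finally show ?thesis .
      qed
      also have "norm \<dots> \<le> (LINT y|lborel. norm (?v y *\<^sub>R (f y - H y)))"
        by (rule integral_norm_bound)
      \<comment> \<open>\<open>?v\<close> is the signed indicator of a shell with the sign of
        \<open>s - t\<close> throughout, so its absolute value is \<open>sgn (s - t) * ?v\<close>,
        whose integral is known from \<open>Iv\<close>.\<close>
      also have "\<dots> \<le> (LINT y|lborel. (e' * sgn (s - t)) * ?v y)"
      proof (rule integral_mono[OF integrable_norm[OF ig]])
        show "integrable lborel (\<lambda>y. (e' * sgn (s - t)) * ?v y)" using iv by simp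
        fix y :: "real ^ 'm"
        show "norm (?v y *\<^sub>R (f y - H y)) \<le> (e' * sgn (s - t)) * ?v y"
        proof (cases "?v y = 0")
          case False
          then have v: "sgn (s - t) * ?v y = 1 \<and> \<bar>?v y\<bar> = 1 \<and> (norm y)\<^sup>2 < max s t \<and> min s t \<le> (norm y)\<^sup>2"
            by (auto simp: weight_def sgn_if split: if_splits)
          have ny: "norm y < sqrt (max s t)" "sqrt (min s t) \<le> norm y"
            using v real_less_rsqrt[of "norm y"] real_le_lsqrt[of "norm y" "min s t"] by auto
          then have yT: "y \<in> cball 0 (sqrt T)" using elim t
            by (auto intro: order_trans[OF less_imp_le] simp: max_def split: if_splits)
          have y0: "y \<noteq> 0" using ny(2) elim t by (auto simp: min_def split: if_splits)
          have "y - sqrt t *\<^sub>R (y /\<^sub>R norm y) = (norm y - sqrt t) *\<^sub>R (y /\<^sub>R norm y)"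
            using y0 by (simp add: scaleR_diff_left left_diff_distrib)
          then have "dist y (sqrt t *\<^sub>R (y /\<^sub>R norm y)) = \<bar>norm y - sqrt t\<bar>"
            using y0 by (simp add: dist_norm abs_mult mult.assoc)
          \<comment> \<open>\<open>y\<close> lies between the spheres of radii \<open>sqrt s\<close>
            and \<open>sqrt t\<close>, and \<open>H\<close> evaluates \<open>f\<close> at the
            projection of \<open>y\<close> to the latter.\<close>
          also have "\<dots> \<le> \<bar>sqrt s - sqrt t\<bar>"
            using ny by (auto simp: max_def min_def split: if_splits)
          also have "\<dots> < d" using elim by (simp add: dist_real_def)
          finally have "norm (f y - H y) < e'"
            using d(2)[OF yT inT] by (simp add: H_def dist_norm)
          moreover have "e' * sgn (s - t) * ?v y = e'" using v by (simp add: mult.assoc)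
          ultimately show ?thesis using v by (simp add: mult.assoc)
        qed simp
      qed
      also have "\<dots> = (e' * sgn (s - t)) * (LINT y|lborel. ?v y)" by simp
      also have "\<dots> \<le> e' * ?c * \<bar>p s - p t\<bar>"
        unfolding Iv using e' c by (auto simp: sgn_if abs_if mult_left_mono)
      finally have "norm (g s - g t) \<le> e' * ?c * \<bar>p s - p t\<bar>" .
      then have "norm ((g s - g t) /\<^sub>R (s - t)) \<le> e' * ?c * norm ((p s - p t) /\<^sub>R (s - t))"
        using mult_left_mono[of _ _ "\<bar>inverse (s - t)\<bar>"] by (fastforce simp: abs_mult mult_ac)
      also have "\<dots> \<le> e' * ?c * B" using elim e' c by (intro mult_left_mono) auto
      also have "\<dots> < e" by (rule e')
      finally show ?case by simp
    qed
  qed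
  have W': "(W has_vector_derivative of_real (?m / 2 * t powr (?m / 2 - 1)) * W 1) (at t)"
  proof (rule has_vector_derivative_transform_within_open[where S = "{0<..}"])
    show "((\<lambda>s. of_real (p s) * W 1) has_vector_derivative of_real (?m / 2 * t powr (?m / 2 - 1)) * W 1) (at t)"
      by (intro has_vector_derivative_mult_left has_vector_derivative_of_real p')
  qed (use t in \<open>auto simp only: greaterThan_iff open_greaterThan W_scale[symmetric]\<close>)
  have "((\<lambda>s. g s + W s) has_vector_derivative 0 + of_real (?m / 2 * t powr (?m / 2 - 1)) * W 1) (at t)"
    by (intro has_vector_derivative_add g' W')
  then show ?thesis unfolding sphere g_def by (simp add: mult_ac)
qed

context polyharmonic_chain
begin

text \<open>Solid means are known from exponent 1 on, so two differentiations in \<open>t\<close>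
  lead to the sphere, by way of the unweighted ball integral. They multiply the \<open>l\<close>-th
  coefficient by \<open>(m/2 + l + 1) (m/2 + l)\<close>, which turns
  \<open>rGamma (m/2 + l + 2)\<close> into \<open>rGamma (m/2 + l)\<close>. The factor 2 comes from
  \<open>t powr (m/2 - 1) / 2\<close> in \<open>has_vector_derivative_solid_0\<close>.\<close>

theorem sphere_mean_eq:
  assumes t: "0 < t" "t < T" and \<Omega>: "cball 0 (sqrt T) \<subseteq> \<Omega>"
  shows "(LINT \<xi>|sphere_measure. f k (sqrt t *\<^sub>R \<xi>)) =
    (\<Sum>l\<le>n. of_real ((-1) ^ l * real ((k + l) choose l) * (2 * pi powr (CARD('m) / 2) * rGamma (CARD('m) / 2 + l)) * t ^ l) * f (k + l) 0)"
proof -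
  let ?m = "real CARD('m)"
  let ?a = "pizzetti_coeff CARD('m) 1 k"
  have fT: "continuous_on (cball 0 (sqrt T)) (f k)"
    by (rule continuous_on_subset[OF continuous_on_f \<Omega>])
  have s1: "solid 1 0 s (f k) = (\<Sum>l\<le>n. of_real (?a l * s powr (?m / 2 + 1 + l)) * f (k + l) 0)"
    if s: "s \<in> {0<..<T}" for s
  proof -
    have "solid_mean 1 k 0 s = pizzetti_sum 1 k 0 s"
      using solid_mean_eq[OF _ _ \<Omega>, of s 0 k] s by simp
    then have "of_real (s powr (?m / 2 + 1)) * (of_real (s powr - (?m / 2 + 1)) * solid 1 0 s (f k)) =
        of_real (s powr (?m / 2 + 1)) * (\<Sum>l\<le>n. of_real (?a l * s ^ l) * f (k + l) 0)"
      by (simp add: solid_mean_def pizzetti_sum_def)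
    moreover have "s powr (?m / 2 + 1) * s powr - (?m / 2 + 1) = 1"
      unfolding powr_add[symmetric] using s by simp
    ultimately have "solid 1 0 s (f k) = of_real (s powr (?m / 2 + 1)) * (\<Sum>l\<le>n. of_real (?a l * s ^ l) * f (k + l) 0)"
      by (simp only: mult.assoc[symmetric] of_real_mult[symmetric]) simp
    also have "\<dots> = (\<Sum>l\<le>n. of_real (?a l * s powr (?m / 2 + 1 + l)) * f (k + l) 0)"
      unfolding sum_distrib_left
      by (intro sum.cong refl) (use s in \<open>simp add: powr_add powr_realpow\<close>)
    finally show ?thesis .
  qed
  have D: "((\<lambda>s. \<Sum>l\<le>n. of_real (b l * s powr (c l)) * f (k + l) 0) has_vector_derivative
      (\<Sum>l\<le>n. of_real (b l * c l * s powr (c l - 1)) * f (k + l) 0)) (at s)"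
    if "s \<in> {0<..<T}" for s and b c :: "nat \<Rightarrow> real"
    using that
    by (intro has_vector_derivative_sum has_vector_derivative_mult_left has_vector_derivative_of_real)
      (auto intro!: derivative_eq_intros)
  have s0: "solid 0 0 s (f k) = (\<Sum>l\<le>n. of_real (?a l * (?m / 2 + 1 + l) * s powr (?m / 2 + l)) * f (k + l) 0)"
    if s: "s \<in> {0<..<T}" for s
  proof -
    have "((\<lambda>s. solid 1 0 s (f k)) has_vector_derivative
        (\<Sum>l\<le>n. of_real (?a l * (?m / 2 + 1 + l) * s powr (?m / 2 + 1 + l - 1)) * f (k + l) 0)) (at s)"
      by (rule has_vector_derivative_transform_within_open[where S = "{0<..<T}", OF D[OF s]]) (use s s1 in auto)
    moreover have "((\<lambda>s. solid 1 0 s (f k)) has_vector_derivative solid 0 0 s (f k)) (at s)"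
      using has_vector_derivative_solid[OF _ _ fT, of s 0] s by simp
    ultimately show ?thesis
      using vector_derivative_unique_at by (fastforce simp: algebra_simps)
  qed
  have "((\<lambda>s. solid 0 0 s (f k)) has_vector_derivative
      (\<Sum>l\<le>n. of_real ((?a l * (?m / 2 + 1 + l)) * (?m / 2 + l) * t powr (?m / 2 + l - 1)) * f (k + l) 0)) (at t)"
    by (rule has_vector_derivative_transform_within_open[where S = "{0<..<T}", OF D]) (use t s0 in auto)
  with has_vector_derivative_solid_0[OF t fT]
  have "of_real (t powr (?m / 2 - 1) / 2) * (LINT \<xi>|sphere_measure. f k (sqrt t *\<^sub>R \<xi>)) =
      (\<Sum>l\<le>n. of_real ((?a l * (?m / 2 + 1 + l)) * (?m / 2 + l) * t powr (?m / 2 + l - 1)) * f (k + l) 0)"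
    by (rule vector_derivative_unique_at)
  also have "\<dots> = of_real (t powr (?m / 2 - 1) / 2) * (\<Sum>l\<le>n. of_real ((-1) ^ l * real ((k + l) choose l) * (2 * pi powr (?m / 2) * rGamma (?m / 2 + l)) * t ^ l) * f (k + l) 0)"
    unfolding sum_distrib_left
  proof (intro sum.cong refl)
    fix l :: nat
    have "t powr (?m / 2 + l - 1) = t powr ((?m / 2 - 1) + l)" by (simp add: algebra_simps)
    also have "\<dots> = t powr (?m / 2 - 1) * t ^ l" using t by (simp add: powr_add powr_realpow)
    finally have tp: "t powr (?m / 2 + l - 1) = t powr (?m / 2 - 1) * t ^ l" .
    have "(?m / 2 + l + 1) * rGamma (?m / 2 + l + 1 + 1) = rGamma (?m / 2 + l + 1)"
      "(?m / 2 + l) * rGamma (?m / 2 + l + 1) = rGamma (?m / 2 + l)"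
      by (rule rGamma_plus1)+
    then have g: "(?m / 2 + l) * ((?m / 2 + 1 + l) * rGamma (?m / 2 + real 1 + real l + 1)) = rGamma (?m / 2 + l)"
      by (simp add: add_ac)
    have "(?a l * (?m / 2 + 1 + l)) * (?m / 2 + l) * t powr (?m / 2 + l - 1) =
        (-1) ^ l * real ((k + l) choose l) * pi powr (?m / 2) * ((?m / 2 + l) * ((?m / 2 + 1 + l) * rGamma (?m / 2 + real 1 + real l + 1)))
          * (t powr (?m / 2 - 1) * t ^ l)"
      unfolding tp pizzetti_coeff_def by simp
    also have "\<dots> = t powr (?m / 2 - 1) / 2 * ((-1) ^ l * real ((k + l) choose l) * (2 * pi powr (?m / 2) * rGamma (?m / 2 + l)) * t ^ l)"
      unfolding g by simp
    finally have e: "(?a l * (?m / 2 + 1 + l)) * (?m / 2 + l) * t powr (?m / 2 + l - 1) =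
      t powr (?m / 2 - 1) / 2 * ((-1) ^ l * real ((k + l) choose l) * (2 * pi powr (?m / 2) * rGamma (?m / 2 + l)) * t ^ l)" .
    show "of_real ((?a l * (?m / 2 + 1 + l)) * (?m / 2 + l) * t powr (?m / 2 + l - 1)) * f (k + l) 0 =
        of_real (t powr (?m / 2 - 1) / 2) * (of_real ((-1) ^ l * real ((k + l) choose l) * (2 * pi powr (?m / 2) * rGamma (?m / 2 + l)) * t ^ l) * f (k + l) 0)"
      unfolding e by simp
  qed
  finally show ?thesis
    by (rule mult_left_cancel[THEN iffD1, rotated]) (use t in simp)
qed

end

section \<open>Smoothness in the radial variable\<close>

text \<open>The derivatives in r up to order k exist and are jointly continuous in r and the parameter p.\<close>
primrec rsmooth :: "nat \<Rightarrow> real set \<Rightarrow> 'p::metric_space set \<Rightarrow> (real \<Rightarrow> 'p \<Rightarrow> complex) \<Rightarrow> bool" where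
  "rsmooth 0 I P \<phi> \<longleftrightarrow> continuous_on (I \<times> P) (\<lambda>z. \<phi> (fst z) (snd z))"
| "rsmooth (Suc k) I P \<phi> \<longleftrightarrow> continuous_on (I \<times> P) (\<lambda>z. \<phi> (fst z) (snd z)) \<and>
    (\<exists>\<phi>'. (\<forall>r\<in>I. \<forall>p\<in>P. ((\<lambda>r. \<phi> r p) has_vector_derivative \<phi>' r p) (at r)) \<and> rsmooth k I P \<phi>')"

lemma rsmooth_continuous: "rsmooth k I P \<phi> \<Longrightarrow> continuous_on (I \<times> P) (\<lambda>z. \<phi> (fst z) (snd z))"
  by (cases k) auto

lemma rsmooth_Suc_imp: "rsmooth (Suc k) I P \<phi> \<Longrightarrow> rsmooth k I P \<phi>"
proof (induction k arbitrary: \<phi>)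
  case (Suc k)
  then obtain \<phi>' where "\<forall>r\<in>I. \<forall>p\<in>P. ((\<lambda>r. \<phi> r p) has_vector_derivative \<phi>' r p) (at r)"
    "rsmooth (Suc k) I P \<phi>'" by auto
  then show ?case using Suc.IH[of \<phi>'] rsmooth_continuous[OF Suc.prems] by auto
qed auto

lemma rsmooth_SucI:
  assumes "rsmooth k I P \<phi>'" "continuous_on (I \<times> P) (\<lambda>z. \<phi> (fst z) (snd z))"
    "\<And>r p. r \<in> I \<Longrightarrow> p \<in> P \<Longrightarrow> ((\<lambda>r. \<phi> r p) has_vector_derivative \<phi>' r p) (at r)"
  shows "rsmooth (Suc k) I P \<phi>"
  using assms by auto

lemma rsmooth_cong:
  assumes "open I" "\<And>r p. r \<in> I \<Longrightarrow> p \<in> P \<Longrightarrow> \<phi> r p = \<psi> r p" "rsmooth k I P \<phi>"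
  shows "rsmooth k I P \<psi>"
proof -
  have c: "continuous_on (I \<times> P) (\<lambda>z. \<psi> (fst z) (snd z))"
    by (rule continuous_on_eq[OF rsmooth_continuous[OF assms(3)]]) (use assms(2) in auto)
  moreover have tr: "((\<lambda>r. \<psi> r p) has_vector_derivative D) (at r)"
    if "((\<lambda>r. \<phi> r p) has_vector_derivative D) (at r)" "r \<in> I" "p \<in> P" for r p D
    by (rule has_vector_derivative_transform_within_open[OF that(1) assms(1) that(2)])
      (use that assms(2) in auto)
  ultimately show ?thesis
  proof (cases k)
    case (Suc j)
    then obtain \<phi>' where *: "\<forall>r\<in>I. \<forall>p\<in>P. ((\<lambda>r. \<phi> r p) has_vector_derivative \<phi>' r p) (at r)"
      "rsmooth j I P \<phi>'" using assms(3) by auto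
    show ?thesis unfolding Suc
      by (rule rsmooth_SucI[OF *(2)]) (use * tr c in auto)
  qed simp
qed

lemma rsmooth_param: "continuous_on P g \<Longrightarrow> rsmooth k I P (\<lambda>r p. g p)"
proof (induction k arbitrary: g)
  case 0
  then show ?case by (auto intro!: continuous_on_compose2[OF 0] continuous_intros)
next
  case (Suc k)
  have "rsmooth k I P (\<lambda>r p. 0)" by (rule Suc.IH) simp
  then show ?case
    by (rule rsmooth_SucI) (auto intro!: continuous_on_compose2[OF Suc.prems] continuous_intros)
qed

lemma rsmooth_add:
  "rsmooth k I P \<phi> \<Longrightarrow> rsmooth k I P \<psi> \<Longrightarrow> rsmooth k I P (\<lambda>r p. \<phi> r p + \<psi> r p)"
proof (induction k arbitrary: \<phi> \<psi>)
  case 0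
  then show ?case by (auto intro!: continuous_intros)
next
  case (Suc k)
  then obtain \<phi>' \<psi>' where *:
    "\<forall>r\<in>I. \<forall>p\<in>P. ((\<lambda>r. \<phi> r p) has_vector_derivative \<phi>' r p) (at r)" "rsmooth k I P \<phi>'"
    "\<forall>r\<in>I. \<forall>p\<in>P. ((\<lambda>r. \<psi> r p) has_vector_derivative \<psi>' r p) (at r)" "rsmooth k I P \<psi>'"
    by auto
  show ?case
    by (rule rsmooth_SucI[OF Suc.IH[OF *(2,4)]])
      (use * Suc.prems in \<open>auto intro!: continuous_intros has_vector_derivative_add\<close>)
qed

lemma rsmooth_sum:
  "(\<And>a. a \<in> A \<Longrightarrow> rsmooth k I P (\<phi> a)) \<Longrightarrow> rsmooth k I P (\<lambda>r p. \<Sum>a\<in>A. \<phi> a r p)"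
  by (induction A rule: infinite_finite_induct) (auto intro: rsmooth_add rsmooth_param)

lemma rsmooth_mult:
  "rsmooth k I P \<phi> \<Longrightarrow> rsmooth k I P \<psi> \<Longrightarrow> rsmooth k I P (\<lambda>r p. \<phi> r p * \<psi> r p)"
proof (induction k arbitrary: \<phi> \<psi>)
  case 0
  then show ?case by (auto intro!: continuous_intros)
next
  case (Suc k)
  then obtain \<phi>' \<psi>' where *:
    "\<forall>r\<in>I. \<forall>p\<in>P. ((\<lambda>r. \<phi> r p) has_vector_derivative \<phi>' r p) (at r)" "rsmooth k I P \<phi>'"
    "\<forall>r\<in>I. \<forall>p\<in>P. ((\<lambda>r. \<psi> r p) has_vector_derivative \<psi>' r p) (at r)" "rsmooth k I P \<psi>'"
    by auto
  have "rsmooth k I P (\<lambda>r p. \<phi> r p * \<psi>' r p + \<phi>' r p * \<psi> r p)"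
    by (intro rsmooth_add Suc.IH * rsmooth_Suc_imp[OF Suc.prems(1)] rsmooth_Suc_imp[OF Suc.prems(2)])
  then show ?case
    by (rule rsmooth_SucI)
      (use * Suc.prems in \<open>auto intro!: continuous_intros has_vector_derivative_mult\<close>)
qed

lemma rsmooth_powr:
  assumes "I \<subseteq> {0<..}"
  shows "rsmooth k I P (\<lambda>r p. of_real (r powr a))"
proof (induction k arbitrary: a)
  case 0
  then show ?case using assms by (auto intro!: continuous_intros)
next
  case (Suc k)
  have "rsmooth k I P (\<lambda>r p. of_real a * of_real (r powr (a - 1)))"
    by (intro rsmooth_mult rsmooth_param Suc.IH) auto
  then show ?case
  proof (rule rsmooth_SucI)
    show "continuous_on (I \<times> P) (\<lambda>z. complex_of_real (fst z powr a))"
      using assms by (auto intro!: continuous_intros)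
    fix r assume "r \<in> I"
    then have "((\<lambda>r. r powr a) has_real_derivative a * r powr (a - 1)) (at r)"
      using assms by (auto intro!: derivative_eq_intros)
    from has_vector_derivative_of_real[OF this]
    show "((\<lambda>r. complex_of_real (r powr a)) has_vector_derivative of_real a * of_real (r powr (a - 1))) (at r)"
      by simp
  qed
qed

lemma DERIV_pos_part_power:
  "((\<lambda>s. (max 0 s) ^ Suc (Suc k)) has_real_derivative real (Suc (Suc k)) * (max 0 s) ^ Suc k) (at s)"
proof -
  consider "s > 0" | "s < 0" | "s = 0" by linarith
  then show ?thesis
  proof cases
    case 1
    have "((\<lambda>s. s ^ Suc (Suc k)) has_real_derivative real (Suc (Suc k)) * (max 0 s) ^ Suc k) (at s)"
      using DERIV_power[OF DERIV_ident, of "Suc (Suc k)" s] 1 by (simp add: max_def del: power_Suc of_nat_Suc)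
    then show ?thesis
      by (rule has_field_derivative_transform_within_open[where S = "{0<..}"]) (use 1 in auto)
  next
    case 2
    have "((\<lambda>s. 0) has_real_derivative real (Suc (Suc k)) * (max 0 s) ^ Suc k) (at s)"
      using 2 by (simp add: max_def)
    then show ?thesis
      by (rule has_field_derivative_transform_within_open[where S = "{..<0}"]) (use 2 in auto)
  next
    case 3
    have "((\<lambda>h. ((max 0 h) ^ Suc (Suc k) - (max 0 0) ^ Suc (Suc k)) /\<^sub>R (h - 0)) \<longlongrightarrow> 0) (at (0::real))"
    proof (rule Lim_null_comparison)
      show "((\<lambda>h. \<bar>h\<bar> ^ Suc k) \<longlongrightarrow> 0) (at (0::real))"
        by (auto intro!: tendsto_eq_intros)
      show "\<forall>\<^sub>F h in at (0::real). norm (((max 0 h) ^ Suc (Suc k) - (max 0 0) ^ Suc (Suc k)) /\<^sub>R (h - 0)) \<le> \<bar>h\<bar> ^ Suc k"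
      proof (intro always_eventually allI)
        fix h :: real
        show "norm (((max 0 h) ^ Suc (Suc k) - (max 0 0) ^ Suc (Suc k)) /\<^sub>R (h - 0)) \<le> \<bar>h\<bar> ^ Suc k"
        proof (cases "h > 0")
          case False
          then have "max 0 h = 0" by simp
          then show ?thesis by (simp del: power_Suc)
        qed (simp add: max_def abs_mult)
      qed
    qed
    then show ?thesis using 3
      unfolding has_real_derivative_iff_has_vector_derivative has_vector_derivative_iff_tendsto by simp
  qed
qed

text \<open>Each differentiation in \<open>r\<close> costs one power of the positive part, so
  exponent \<open>k + 1\<close> leaves \<open>k\<close> derivatives. The inner derivative is smooth
  to all orders, which keeps the product rule within the induction.\<close>

lemma rsmooth_pos_part_power:
  assumes u: "continuous_on (I \<times> P) (\<lambda>z. u (fst z) (snd z))"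
    and d: "\<And>r p. r \<in> I \<Longrightarrow> p \<in> P \<Longrightarrow> ((\<lambda>r. u r p) has_real_derivative u' r p) (at r)"
    and u': "\<And>k. rsmooth k I P (\<lambda>r p. of_real (u' r p))"
  shows "rsmooth k I P (\<lambda>r p. of_real ((max 0 (u r p)) ^ Suc k))"
proof (induction k)
  case 0
  then show ?case using u by (auto intro!: continuous_intros)
next
  case (Suc k)
  have "rsmooth k I P (\<lambda>r p. of_nat (Suc (Suc k)) * of_real ((max 0 (u r p)) ^ Suc k) * of_real (u' r p))"
    by (intro rsmooth_mult rsmooth_param Suc u') auto
  then show ?case
  proof (rule rsmooth_SucI)
    show "continuous_on (I \<times> P) (\<lambda>z. complex_of_real ((max 0 (u (fst z) (snd z))) ^ Suc (Suc k)))"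
      using u by (intro continuous_intros)
    fix r p assume "r \<in> I" "p \<in> P"
    from DERIV_chain2[OF DERIV_pos_part_power d[OF this], of k]
    have "((\<lambda>r. (max 0 (u r p)) ^ Suc (Suc k)) has_real_derivative
        real (Suc (Suc k)) * (max 0 (u r p)) ^ Suc k * u' r p) (at r)" .
    from has_vector_derivative_of_real[OF this]
    show "((\<lambda>r. complex_of_real ((max 0 (u r p)) ^ Suc (Suc k))) has_vector_derivative
        of_nat (Suc (Suc k)) * of_real ((max 0 (u r p)) ^ Suc k) * of_real (u' r p)) (at r)"
      by (simp only: of_real_mult of_real_of_nat_eq)
  qed
qed

section \<open>Parameter integrals over compact spaces\<close>

lemma continuous_on_slice:
  assumes "continuous_on (X \<times> Y) (\<lambda>z. \<phi> (fst z) (snd z))" "b \<in> X"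
  shows "continuous_on Y (\<phi> b)"
proof -
  have "continuous_on Y (\<lambda>y. (b, y))" by (intro continuous_intros)
  moreover have "(\<lambda>y. (b, y)) ` Y \<subseteq> X \<times> Y" using assms(2) by auto
  ultimately show ?thesis using continuous_on_compose2[OF assms(1)] by fastforce
qed

text \<open>Used for Lebesgue measure on a closed ball, where the kernels are integrated, and for
  the surface measure. Compactness turns joint continuity into the bounds that dominated convergence
  needs.\<close>

locale compact_finite_measure = finite_measure M for M :: "'y::metric_space measure" +
  fixes Y :: "'y set"
  assumes compact: "compact Y" and space_M: "space M = Y" and sets_M: "sets M = sets (restrict_space borel Y)"
begin

lemma measurable_continuous:
  fixes g :: "'y \<Rightarrow> complex"
  assumes "continuous_on Y g"
  shows "g \<in> borel_measurable M"
  unfolding measurable_cong_sets[OF sets_M refl] by (rule borel_measurable_continuous_on_restrict[OF assms])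

lemma integrable_continuous:
  fixes g :: "'y \<Rightarrow> complex"
  assumes "continuous_on Y g"
  shows "integrable M g"
proof -
  obtain C where "\<And>y. y \<in> Y \<Longrightarrow> norm (g y) \<le> C"
    using compact_norm_bound[OF compact assms] by blast
  then show ?thesis
    using measurable_continuous[OF assms] by (intro integrable_const_bound[of _ C]) (auto simp: space_M)
qed

lemma continuous_on_integral:
  fixes \<phi> :: "'x::heine_borel \<Rightarrow> 'y \<Rightarrow> complex"
  assumes "continuous_on (X \<times> Y) (\<lambda>z. \<phi> (fst z) (snd z))"
  shows "continuous_on X (\<lambda>x. LINT y|M. \<phi> x y)"
  unfolding continuous_on_sequentially
proof (intro allI ballI impI)
  fix x a assume a: "a \<in> X" and x: "(\<forall>n. x n \<in> X) \<and> x \<longlonglongrightarrow> a"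
  have slice: "continuous_on Y (\<phi> b)" if "b \<in> X" for b
    by (rule continuous_on_slice[OF assms that])
  \<comment> \<open>A convergent sequence together with its limit is compact, which bounds the
    integrands uniformly along it.\<close>
  define K where "K = insert a (range x)"
  have "compact (K \<times> Y)"
    unfolding K_def by (intro compact_Times compact compact_sequence_with_limit conjunct2[OF x])
  moreover have "K \<subseteq> X" using a x by (auto simp: K_def)
  ultimately obtain C where C: "\<And>z. z \<in> K \<times> Y \<Longrightarrow> norm (\<phi> (fst z) (snd z)) \<le> C"
    using compact_norm_bound[OF _ continuous_on_subset[OF assms, of "K \<times> Y"]] by (metis Sigma_mono order_refl)
  show "((\<lambda>x. LINT y|M. \<phi> x y) \<circ> x) \<longlonglongrightarrow> (LINT y|M. \<phi> a y)"
    unfolding comp_def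
  proof (rule integral_dominated_convergence[where w = "\<lambda>_. C"])
    show "\<phi> a \<in> borel_measurable M" "\<And>i. \<phi> (x i) \<in> borel_measurable M"
      using a x by (auto intro!: measurable_continuous slice)
    show "AE y in M. (\<lambda>i. \<phi> (x i) y) \<longlonglongrightarrow> \<phi> a y"
    proof (rule AE_I2)
      fix y assume y: "y \<in> space M"
      have "(\<lambda>i. (x i, y)) \<longlonglongrightarrow> (a, y)" using x by (intro tendsto_Pair) auto
      then show "(\<lambda>i. \<phi> (x i) y) \<longlonglongrightarrow> \<phi> a y"
        using continuous_on_tendsto_compose[OF assms, of "\<lambda>i. (x i, y)" "(a, y)" sequentially] a x y
        by (auto simp: space_M intro!: always_eventually)
    qed
    show "AE y in M. norm (\<phi> (x i) y) \<le> C" for i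
      using C by (intro AE_I2) (auto simp: K_def space_M)
  qed simp
qed

lemma has_vector_derivative_integral_param:
  fixes \<phi> :: "real \<Rightarrow> 'y \<Rightarrow> complex"
  assumes I: "open I" "r \<in> I" and \<phi>: "continuous_on (I \<times> Y) (\<lambda>z. \<phi> (fst z) (snd z))"
    and \<phi>': "continuous_on (I \<times> Y) (\<lambda>z. \<phi>' (fst z) (snd z))"
    and d: "\<And>r y. r \<in> I \<Longrightarrow> y \<in> Y \<Longrightarrow> ((\<lambda>r. \<phi> r y) has_vector_derivative \<phi>' r y) (at r)"
  shows "((\<lambda>r. LINT y|M. \<phi> r y) has_vector_derivative (LINT y|M. \<phi>' r y)) (at r)"
proof -
  have slice: "continuous_on Y (\<phi> b)" "continuous_on Y (\<phi>' b)" if "b \<in> I" for b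
    by (rule continuous_on_slice[OF \<phi> that] continuous_on_slice[OF \<phi>' that])+
  obtain e where e: "e > 0" "cball r e \<subseteq> I" using I open_contains_cball by blast
  then obtain C where C: "\<And>z. z \<in> cball r e \<times> Y \<Longrightarrow> norm (\<phi>' (fst z) (snd z)) \<le> C"
    using compact_norm_bound[OF compact_Times[OF compact_cball compact] continuous_on_subset[OF \<phi>', of "cball r e \<times> Y"]]
    by (metis Sigma_mono order_refl)
  have be: "ball r e \<subseteq> cball r e" by auto
  show ?thesis
  proof (rule has_vector_derivative_integral[where J = "ball r e" and B = "\<lambda>_. C"])
    show "integrable M (\<phi> s)" if "s \<in> ball r e" for s
      using that be e by (intro integrable_continuous slice) auto
    show "norm (\<phi> s y - \<phi> r y) \<le> \<bar>s - r\<bar> * C" if "s \<in> ball r e" "y \<in> space M" for s y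
    proof -
      have "norm (\<phi> s y - \<phi> r y) \<le> C * \<bar>s - r\<bar>"
      proof (rule vector_differentiable_bound[where S = "cball r e"])
        fix \<tau> assume "\<tau> \<in> cball r e"
        then show "((\<lambda>r. \<phi> r y) has_vector_derivative \<phi>' \<tau> y) (at \<tau> within cball r e)" "norm (\<phi>' \<tau> y) \<le> C"
          using d[of \<tau> y] C[of "(\<tau>, y)"] subsetD[OF e(2), of \<tau>] that
          by (auto simp: space_M intro: has_vector_derivative_at_within simp del: mem_cball)
      qed (use that be e in auto)
      then show ?thesis by (simp add: mult.commute)
    qed
    show "AE y in M. ((\<lambda>s. \<phi> s y) has_vector_derivative \<phi>' r y) (at r)"
      using d I by (intro AE_I2) (auto simp: space_M)
    show "\<phi>' r \<in> borel_measurable M" by (intro measurable_continuous slice I)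
  qed (use e in auto)
qed

text \<open>The integration variable is carried as a further parameter of \<open>rsmooth\<close>, so
  that each derivative is jointly continuous in it and can again be taken under the
  integral.\<close>

lemma rsmooth_integral:
  fixes P :: "'p::heine_borel set" and \<phi> :: "real \<Rightarrow> 'p \<Rightarrow> 'y \<Rightarrow> complex"
  assumes I: "open I"
  shows "rsmooth k I (P \<times> Y) (\<lambda>r z. \<phi> r (fst z) (snd z)) \<Longrightarrow> rsmooth k I P (\<lambda>r p. LINT y|M. \<phi> r p y)"
proof (induction k arbitrary: \<phi>)
  have cont: "continuous_on (I \<times> P) (\<lambda>z. LINT y|M. \<phi> (fst z) (snd z) y)"
    if "continuous_on (I \<times> P \<times> Y) (\<lambda>z. \<phi> (fst z) (fst (snd z)) (snd (snd z)))" for \<phi> :: "real \<Rightarrow> 'p \<Rightarrow> 'y \<Rightarrow> complex"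
  proof (rule continuous_on_integral)
    show "continuous_on ((I \<times> P) \<times> Y) (\<lambda>z. \<phi> (fst (fst z)) (snd (fst z)) (snd z))"
      by (rule continuous_on_compose2[OF that, of _ "\<lambda>z. (fst (fst z), snd (fst z), snd z)", simplified])
        (auto intro!: continuous_intros)
  qed
  {
    case 0
    then show ?case using cont by simp
  next
    case (Suc k)
    obtain \<phi>' where *: "\<forall>r\<in>I. \<forall>z\<in>P \<times> Y. ((\<lambda>r. \<phi> r (fst z) (snd z)) has_vector_derivative \<phi>' r z) (at r)"
      "rsmooth k I (P \<times> Y) \<phi>'" using Suc.prems by auto
    define \<psi> where "\<psi> r p y = \<phi>' r (p, y)" for r p y
    have \<psi>: "rsmooth k I (P \<times> Y) (\<lambda>r z. \<psi> r (fst z) (snd z))"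
      using *(2) by (simp add: \<psi>_def)
    from Suc.IH[OF this] show ?case
    proof (rule rsmooth_SucI)
      show "continuous_on (I \<times> P) (\<lambda>z. LINT y|M. \<phi> (fst z) (snd z) y)"
        using cont rsmooth_continuous[OF Suc.prems] by simp
      fix r p assume r: "r \<in> I" and p: "p \<in> P"
      show "((\<lambda>r. LINT y|M. \<phi> r p y) has_vector_derivative (LINT y|M. \<psi> r p y)) (at r)"
      proof (rule has_vector_derivative_integral_param[OF I r])
        have c: "continuous_on (I \<times> Y) (\<lambda>z. (fst z, p, snd z))" by (intro continuous_intros)
        have i: "(\<lambda>z. (fst z, p, snd z)) ` (I \<times> Y) \<subseteq> I \<times> P \<times> Y" using p by auto
        show "continuous_on (I \<times> Y) (\<lambda>z. \<phi> (fst z) p (snd z))"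
          using continuous_on_compose2[OF rsmooth_continuous[OF Suc.prems] c i] by simp
        show "continuous_on (I \<times> Y) (\<lambda>z. \<psi> (fst z) p (snd z))"
          using continuous_on_compose2[OF rsmooth_continuous[OF \<psi>] c i] by simp
        show "((\<lambda>r. \<phi> r p y) has_vector_derivative \<psi> r p y) (at r)" if "r \<in> I" "y \<in> Y" for r y
          using *(1) that p by (auto simp: \<psi>_def)
      qed
    qed
  }
qed

end

text \<open>The derivatives in \<open>r\<close> fall on the kernel, so continuity of
  \<open>f\<close> suffices. All moving balls lie in the fixed ball of radius \<open>\<rho>\<close>,
  which gives a domain of integration independent of \<open>r\<close> and
  \<open>\<xi>\<close>.\<close>

lemma rsmooth_solid:
  fixes f :: "real ^ 'm::finite \<Rightarrow> complex"
  assumes I: "open I" "I \<subseteq> {0<..}" and f: "continuous_on (cball 0 \<rho>) f"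
    and \<rho>: "\<And>r. r \<in> I \<Longrightarrow> r + sqrt t \<le> \<rho>"
  shows "rsmooth k I (sphere 0 1) (\<lambda>r \<xi>. solid (Suc k) (r *\<^sub>R \<xi>) t f)"
proof -
  let ?Y = "cball 0 \<rho> :: (real ^ 'm) set"
  let ?M = "restrict_space lborel ?Y"
  interpret finite_measure ?M
  proof (rule finite_measureI)
    have "emeasure ?M (space ?M) = emeasure lborel ?Y"
      by (subst emeasure_restrict_space) (auto simp: space_restrict_space)
    also have "\<dots> < \<infinity>" by (rule emeasure_bounded_finite) simp
    finally show "emeasure ?M (space ?M) \<noteq> \<infinity>" by simp
  qed
  interpret compact_finite_measure ?M ?Y
  proof unfold_locales
    show "sets ?M = sets (restrict_space borel ?Y)" by (rule sets_restrict_space_cong) simp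
  qed (auto simp: space_restrict_space)
  define u where "u r z = t - (norm (r *\<^sub>R fst z - snd z))\<^sup>2" for r and z :: "(real ^ 'm) \<times> (real ^ 'm)"
  define u' where "u' r z = - 2 * (r * (fst z \<bullet> fst z) - fst z \<bullet> snd z)" for r and z :: "(real ^ 'm) \<times> (real ^ 'm)"
  have id: "rsmooth j I (sphere 0 1 \<times> ?Y) (\<lambda>r p. of_real r)" for j
    by (rule rsmooth_cong[OF I(1) _ rsmooth_powr[OF I(2), of _ _ 1]]) (use I in auto)
  have "rsmooth k I (sphere 0 1 \<times> ?Y) (\<lambda>r z. of_real ((max 0 (u r z)) ^ Suc k))"
  proof (rule rsmooth_pos_part_power)
    show "continuous_on (I \<times> sphere 0 1 \<times> ?Y) (\<lambda>z. u (fst z) (snd z))"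
      unfolding u_def by (intro continuous_intros)
    show "((\<lambda>r. u r p) has_real_derivative u' r p) (at r)" for r p
    proof -
      have "(\<lambda>r. u r p) = (\<lambda>r. t - (r\<^sup>2 * (fst p \<bullet> fst p) - 2 * r * (fst p \<bullet> snd p) + snd p \<bullet> snd p))"
        unfolding u_def power2_norm_eq_inner
        by (simp add: inner_diff_left inner_diff_right inner_commute algebra_simps power2_eq_square)
      then show ?thesis unfolding u'_def by (auto intro!: derivative_eq_intros simp: algebra_simps)
    qed
    have "rsmooth j I (sphere 0 1 \<times> ?Y) (\<lambda>r z. of_real r * of_real (- 2 * (fst z \<bullet> fst z)) + of_real (2 * (fst z \<bullet> snd z)))" for j
      by (intro rsmooth_add rsmooth_mult id rsmooth_param continuous_intros)
    then show "rsmooth j I (sphere 0 1 \<times> ?Y) (\<lambda>r z. of_real (u' r z))" for j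
      by (rule rsmooth_cong[OF I(1), rotated]) (simp add: u'_def algebra_simps)
  qed
  then have "rsmooth k I (sphere 0 1 \<times> ?Y) (\<lambda>r z. of_real ((max 0 (u r z)) ^ Suc k) * f (snd z))"
    by (intro rsmooth_mult rsmooth_param continuous_on_compose2[OF f] continuous_intros) auto
  then have "rsmooth k I (sphere 0 1 \<times> ?Y) (\<lambda>r z. of_real (weight (Suc k) (r *\<^sub>R fst z) t (snd z)) * f (snd z))"
    by (simp only: weight_Suc_max u_def norm_minus_commute)
  then have "rsmooth k I (sphere 0 1) (\<lambda>r \<xi>. LINT y|?M. of_real (weight (Suc k) (r *\<^sub>R \<xi>) t y) * f y)"
    by (rule rsmooth_integral[OF I(1), where \<phi> = "\<lambda>r \<xi> y. of_real (weight (Suc k) (r *\<^sub>R \<xi>) t y) * f y"])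
  then show ?thesis
  proof (rule rsmooth_cong[OF I(1), rotated])
    fix r and \<xi> :: "real ^ 'm" assume r: "r \<in> I" and \<xi>: "\<xi> \<in> sphere 0 1"
    have "(LINT y|?M. of_real (weight (Suc k) (r *\<^sub>R \<xi>) t y) * f y) =
        (LINT y|lborel. indicator ?Y y *\<^sub>R (of_real (weight (Suc k) (r *\<^sub>R \<xi>) t y) * f y))"
      by (rule integral_restrict_space) auto
    also have "\<dots> = solid (Suc k) (r *\<^sub>R \<xi>) t f"
      unfolding solid_def
    proof (intro Bochner_Integration.integral_cong refl)
      fix y
      have "weight (Suc k) (r *\<^sub>R \<xi>) t y = 0" if y: "y \<notin> ?Y"
      proof -
        have "norm y \<le> norm (y - r *\<^sub>R \<xi>) + norm (r *\<^sub>R \<xi>)" by (rule norm_triangle_sub[of y "r *\<^sub>R \<xi>", unfolded add.commute[of "norm (r *\<^sub>R \<xi>)"]])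
        moreover have "norm (r *\<^sub>R \<xi>) = r" using r \<xi> I by auto
        ultimately have "\<not> norm (y - r *\<^sub>R \<xi>) < sqrt t" using y \<rho>[OF r] by auto
        then show ?thesis using mem_ball_sqrt_iff[of y "r *\<^sub>R \<xi>" t]
          by (auto simp: weight_def dist_norm norm_minus_commute)
      qed
      then show "indicator ?Y y *\<^sub>R (of_real (weight (Suc k) (r *\<^sub>R \<xi>) t y) * f y) = weight (Suc k) (r *\<^sub>R \<xi>) t y *\<^sub>R f y"
        by (cases "y \<in> ?Y") (auto simp: scaleR_conv_of_real)
    qed
    finally show "(LINT y|?M. of_real (weight (Suc k) (r *\<^sub>R \<xi>) t y) * f y) = solid (Suc k) (r *\<^sub>R \<xi>) t f" .
  qed
qed

context polyharmonic_chain
begin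

text \<open>Downward induction on \<open>k\<close>, for all orders \<open>N\<close> at once: in
  Pizzetti's formula with exponent \<open>N + 1\<close> the solid integral supplies \<open>N\<close>
  derivatives in \<open>r\<close>, and the remaining terms belong to \<open>f (k + l)\<close> with
  \<open>l \<ge> 1\<close>, already treated.\<close>

lemma rsmooth_chain:
  assumes \<epsilon>: "0 < \<epsilon>" "\<epsilon> < 1" and \<Omega>: "cball 0 (1 + 2 * \<epsilon>) \<subseteq> \<Omega>"
  shows "rsmooth N {1 - \<epsilon><..<1 + \<epsilon>} (sphere 0 1) (\<lambda>r \<xi>. f k (r *\<^sub>R \<xi>))"
proof -
  let ?I = "{1 - \<epsilon><..<1 + \<epsilon>}"
  have I: "open ?I" "?I \<subseteq> {0<..}" using \<epsilon> by auto
  \<comment> \<open>Radius \<open>\<epsilon> / 2\<close>, strictly below \<open>\<epsilon>\<close>,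
    since \<open>solid_mean_eq\<close> needs room above \<open>t\<close>. Balls of radius
    \<open>\<epsilon>\<close> about points of norm below \<open>1 + \<epsilon>\<close> stay in the
    ball of radius \<open>1 + 2 * \<epsilon>\<close>.\<close>
  define t where "t = (\<epsilon> / 2)\<^sup>2"
  have t: "0 < t" "t < \<epsilon>\<^sup>2" "sqrt t = \<epsilon> / 2" using \<epsilon> by (auto simp: t_def power_divide real_sqrt_divide)
  have zero: "rsmooth N ?I (sphere 0 1) (\<lambda>r \<xi>. f j (r *\<^sub>R \<xi>))" if "j > n" for j N
    using that by (simp add: vanish rsmooth_param)
  have "\<forall>j\<ge>k. \<forall>N. rsmooth N ?I (sphere 0 1) (\<lambda>r \<xi>. f j (r *\<^sub>R \<xi>))" if "k \<le> Suc n" for k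
    using that
  proof (induction k rule: inc_induct)
    case base
    then show ?case using zero by auto
  next
    case (step k)
    have "rsmooth N ?I (sphere 0 1) (\<lambda>r \<xi>. f k (r *\<^sub>R \<xi>))" for N
    proof -
      let ?c = "of_real (1 / ball_const CARD('m) (Suc N)) :: complex"
      have "rsmooth N ?I (sphere 0 1) (\<lambda>r \<xi>. ?c * (of_real (t powr - (CARD('m) / 2 + Suc N)) * solid (Suc N) (r *\<^sub>R \<xi>) t (f k)
          + (\<Sum>l\<in>{1..n}. of_real (- (pizzetti_coeff CARD('m) (Suc N) k l * t ^ l)) * f (k + l) (r *\<^sub>R \<xi>))))"
      proof (intro rsmooth_mult rsmooth_add rsmooth_sum rsmooth_param continuous_intros)
        show "rsmooth N ?I (sphere 0 1) (\<lambda>r \<xi>. solid (Suc N) (r *\<^sub>R \<xi>) t (f k))"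
          by (rule rsmooth_solid[OF I continuous_on_subset[OF continuous_on_f \<Omega>]]) (use t \<epsilon> in auto)
        show "rsmooth N ?I (sphere 0 1) (\<lambda>r \<xi>. f (k + l) (r *\<^sub>R \<xi>))" if "l \<in> {1..n}" for l
          using step.IH that by auto
      qed
      then show ?thesis
      proof (rule rsmooth_cong[OF I(1), rotated])
        fix r and \<xi> :: "real ^ 'm" assume r: "r \<in> ?I" and \<xi>: "\<xi> \<in> sphere 0 1"
        have "cball (r *\<^sub>R \<xi>) (sqrt (\<epsilon>\<^sup>2)) \<subseteq> \<Omega>"
        proof
          fix y assume "y \<in> cball (r *\<^sub>R \<xi>) (sqrt (\<epsilon>\<^sup>2))"
          then have "norm (y - r *\<^sub>R \<xi>) \<le> \<epsilon>" using \<epsilon> by (simp add: dist_norm norm_minus_commute)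
          moreover have "norm y \<le> norm (r *\<^sub>R \<xi>) + norm (y - r *\<^sub>R \<xi>)" by (rule norm_triangle_sub)
          moreover have "norm (r *\<^sub>R \<xi>) = r" using r \<xi> \<epsilon> by auto
          ultimately show "y \<in> \<Omega>" using r \<Omega> by auto
        qed
        from solid_mean_eq[OF t(1,2) this, of N k]
        have "of_real (t powr - (CARD('m) / 2 + Suc N)) * solid (Suc N) (r *\<^sub>R \<xi>) t (f k) =
            (\<Sum>l\<le>n. of_real (pizzetti_coeff CARD('m) (Suc N) k l * t ^ l) * f (k + l) (r *\<^sub>R \<xi>))"
          by (simp only: solid_mean_def pizzetti_sum_def)
        also have "\<dots> = of_real (ball_const CARD('m) (Suc N)) * f k (r *\<^sub>R \<xi>) +
            (\<Sum>l\<in>{1..n}. of_real (pizzetti_coeff CARD('m) (Suc N) k l * t ^ l) * f (k + l) (r *\<^sub>R \<xi>))"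
          by (simp add: atMost_atLeast0 sum.atLeast_Suc_atMost pizzetti_coeff_0)
        finally show "?c * (of_real (t powr - (CARD('m) / 2 + Suc N)) * solid (Suc N) (r *\<^sub>R \<xi>) t (f k)
          + (\<Sum>l\<in>{1..n}. of_real (- (pizzetti_coeff CARD('m) (Suc N) k l * t ^ l)) * f (k + l) (r *\<^sub>R \<xi>))) = f k (r *\<^sub>R \<xi>)"
          using ball_const_pos[of "CARD('m)" "Suc N"]
          by (simp add: sum_negf field_simps)
      qed
    qed
    then show ?case using step.IH by (metis le_eq_less_or_eq Suc_leI)
  qed
  then show ?thesis using zero by (cases "k \<le> n") auto
qed

end

section \<open>Products of pairs of odd generators\<close>

text \<open>The generators occurring in the product of the even elements
  \<open>x_(2j-1) x_(2j)\<close> over \<open>j\<close> in \<open>S\<close>. Truncated subtraction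
  sends \<open>j = 0\<close> to the single index 0, hence the condition
  \<open>S \<subseteq> {1..}\<close> below.\<close>

definition pairs :: "nat set \<Rightarrow> nat set" where
  "pairs S = (\<lambda>j. 2 * j - 1) ` S \<union> (\<lambda>j. 2 * j) ` S"

lemma pairs_simps [simp]:
  "pairs {} = {}" "pairs (insert j S) = {2 * j - 1, 2 * j} \<union> pairs S"
  "pairs (S \<union> T) = pairs S \<union> pairs T"
  by (auto simp: pairs_def)

lemma finite_pairs [simp]: "finite S \<Longrightarrow> finite (pairs S)"
  by (simp add: pairs_def)

lemma mem_pairs_even:
  assumes "S \<subseteq> {1..}"
  shows "2 * j \<in> pairs S \<longleftrightarrow> j \<in> S" "1 \<le> j \<Longrightarrow> 2 * j - 1 \<in> pairs S \<longleftrightarrow> j \<in> S"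
proof -
  show "2 * j \<in> pairs S \<longleftrightarrow> j \<in> S"
  proof
    assume "2 * j \<in> pairs S"
    then obtain i where "i \<in> S" "2 * j = 2 * i - 1 \<or> 2 * j = 2 * i" by (auto simp: pairs_def)
    moreover from this have "1 \<le> i" using assms by auto
    ultimately have "i = j" by presburger
    then show "j \<in> S" using \<open>i \<in> S\<close> by simp
  qed (auto simp: pairs_def)
  show "2 * j - 1 \<in> pairs S \<longleftrightarrow> j \<in> S" if "1 \<le> j"
  proof
    assume "2 * j - 1 \<in> pairs S"
    then obtain i where "i \<in> S" "2 * j - 1 = 2 * i - 1 \<or> 2 * j - 1 = 2 * i" by (auto simp: pairs_def)
    moreover from this have "1 \<le> i" using assms by auto
    ultimately have "i = j" using that by presburger
    then show "j \<in> S" using \<open>i \<in> S\<close> by simp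
  qed (auto simp: pairs_def)
qed

lemma pairs_inject:
  assumes "S \<subseteq> {1..}" "T \<subseteq> {1..}" "pairs S = pairs T"
  shows "S = T"
  using mem_pairs_even(1)[OF assms(1)] mem_pairs_even(1)[OF assms(2)] assms(3) by auto

lemma pairs_atLeastAtMost: "pairs {1..n} = {1..2 * n}"
proof safe
  fix x assume x: "x \<in> {1..2 * n}"
  show "x \<in> pairs {1..n}"
  proof (cases "even x")
    case True
    then obtain j where "x = 2 * j" by (auto elim: evenE)
    then show ?thesis using x mem_pairs_even(1)[of "{1..n}"] by auto
  next
    case False
    then obtain j where "x = 2 * j + 1" by (auto elim: oddE)
    then show ?thesis using x mem_pairs_even(2)[of "{1..n}" "Suc j"] by auto
  qed
qed (auto simp: pairs_def)

lemma pairs_mono: "S \<subseteq> T \<Longrightarrow> pairs S \<subseteq> pairs T"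
  by (auto simp: pairs_def)

lemma pairs_Diff:
  assumes "S \<subseteq> {1..}" "T \<subseteq> {1..}"
  shows "pairs (S - T) = pairs S - pairs T"
proof -
  have "2 * j \<in> pairs T \<longleftrightarrow> j \<in> T" "2 * j - Suc 0 \<in> pairs T \<longleftrightarrow> j \<in> T" if "j \<in> S" for j
    using mem_pairs_even[OF assms(2), of j] that assms(1) by auto
  then show ?thesis unfolding pairs_def[of S] pairs_def[of "S - T"] by (auto simp: image_iff)
qed

text \<open>No element of \<open>B\<close> lies between \<open>2 * j - 1\<close> and
  \<open>2 * j\<close>, so every inversion with one of them comes with an inversion with the other:
  a pair is even and commutes with everything.\<close>

lemma gsign_pair:
  assumes "finite B" "{2 * j - 1, 2 * j} \<inter> B = {}" "1 \<le> j"
  shows "gsign {2 * j - 1, 2 * j} B = 1"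
proof -
  let ?L = "{b \<in> B. b < 2 * j - 1}"
  have *: "b < 2 * j \<longleftrightarrow> b < 2 * j - 1" if "b \<in> B" for b
  proof -
    have "b \<noteq> 2 * j - 1" using assms that by auto
    then show ?thesis by linarith
  qed
  have "{(a, b). a \<in> {2 * j - 1, 2 * j} \<and> b \<in> B \<and> b < a} = {2 * j - 1, 2 * j} \<times> ?L"
    using * by auto
  moreover have "card ({2 * j - 1, 2 * j} \<times> ?L) = 2 * card ?L"
    using assms(3) by (simp add: card_cartesian_product)
  ultimately show ?thesis by (simp only: gsign_def power_mult) simp
qed

lemma gsign_pairs:
  assumes "finite S" "finite B" "S \<subseteq> {1..}" "pairs S \<inter> B = {}"
  shows "gsign (pairs S) B = 1"
  using assms
proof (induction S)
  case empty
  then show ?case by (simp add: gsign_def)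
next
  case (insert j S)
  have "{(a, b). a \<in> pairs (insert j S) \<and> b \<in> B \<and> b < a} =
      {(a, b). a \<in> {2 * j - 1, 2 * j} \<and> b \<in> B \<and> b < a} \<union> {(a, b). a \<in> pairs S \<and> b \<in> B \<and> b < a}"
    (is "_ = ?P \<union> ?Q") by auto
  moreover have "?P \<inter> ?Q = {}"
    using mem_pairs_even[of S j] insert by auto
  moreover have "finite ?P" "finite ?Q"
    using insert finite_subset[of ?P "{2 * j - 1, 2 * j} \<times> B"]
      finite_subset[of ?Q "pairs S \<times> B"] by auto
  ultimately have "gsign (pairs (insert j S)) B = gsign {2 * j - 1, 2 * j} B * gsign (pairs S) B"
    by (simp only: gsign_def card_Un_disjoint power_add)
  then show ?case using insert gsign_pair[of B j] by auto
qed

text \<open>The pairs commute and square to zero, so the power expands into products of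
  \<open>k\<close> distinct pairs, each arising from \<open>fact k\<close> orderings.\<close>

lemma gpow_xsq:
  "gpow (xsq n) k = (\<lambda>A. if \<exists>S\<subseteq>{1..n}. card S = k \<and> A = pairs S then fact k else 0)"
proof (induction k)
  case 0
  show ?case
    by (auto simp: gone_def fun_eq_iff dest: finite_subset)
next
  case (Suc k)
  show ?case
  proof
    fix C :: "nat set"
    let ?P = "\<lambda>k A. \<exists>S\<subseteq>{1..n}. card S = k \<and> A = pairs S"
    have "gpow (xsq n) (Suc k) C =
        (\<Sum>A\<in>Pow C. if (\<exists>j\<in>{1..n}. A = {2 * j - 1, 2 * j}) \<and> ?P k (C - A) then fact k else 0)"
      unfolding gpow.simps Suc gmult_def
      unfolding xsq_def
    proof (intro sum.cong refl)
      fix A assume A: "A \<in> Pow C"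
      show "gsign A (C - A) * (if \<exists>j\<in>{1..n}. A = {2 * j - 1, 2 * j} then 1 else 0) *
          (if ?P k (C - A) then fact k else 0) =
          (if (\<exists>j\<in>{1..n}. A = {2 * j - 1, 2 * j}) \<and> ?P k (C - A) then fact k else 0)"
      proof (cases "(\<exists>j\<in>{1..n}. A = {2 * j - 1, 2 * j}) \<and> ?P k (C - A)")
        case True
        then obtain j S where "j \<in> {1..n}" "A = {2 * j - 1, 2 * j}" "S \<subseteq> {1..n}" "C - A = pairs S"
          by auto
        then have "gsign A (C - A) = 1"
          using gsign_pair[of "C - A" j] finite_subset[of S "{1..n}"] by auto
        then show ?thesis using True by simp
      qed auto
    qed
    also have "\<dots> = (if ?P (Suc k) C then fact (Suc k) else 0)"
    proof (cases "finite C")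
      \<comment> \<open>A sum over an infinite index set is 0 by convention, and no infinite
        \<open>C\<close> consists of finitely many pairs.\<close>
      case False
      have N: "\<not> ?P (Suc k) C" using False finite_subset[of _ "{1..n}"] by auto
      show ?thesis unfolding if_not_P[OF N] using False by simp
    next
      case fC: True
      \<comment> \<open>The possible first factors. If \<open>C\<close> consists of
        \<open>k + 1\<close> pairs there are \<open>k + 1\<close> of them, which turns
        \<open>fact k\<close> into \<open>fact (Suc k)\<close>.\<close>
      let ?X = "{A \<in> Pow C. (\<exists>j\<in>{1..n}. A = {2 * j - 1, 2 * j}) \<and> ?P k (C - A)}"
      have "(\<Sum>A\<in>Pow C. if (\<exists>j\<in>{1..n}. A = {2 * j - 1, 2 * j}) \<and> ?P k (C - A) then fact k else 0)
          = (of_nat (card ?X) * fact k :: complex)"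
        using fC by (subst sum.inter_filter[symmetric]) auto
      also have "\<dots> = (if ?P (Suc k) C then fact (Suc k) else 0)"
      proof (cases "?P (Suc k) C")
        case True
        then obtain S where S: "S \<subseteq> {1..n}" "card S = Suc k" "C = pairs S" by auto
        have fS: "finite S" using S finite_subset by blast
        have S1: "S \<subseteq> {1..}" using S by auto
        have "?X = (\<lambda>j. {2 * j - 1, 2 * j}) ` S"
        proof (intro equalityI subsetI)
          fix A assume "A \<in> ?X"
          then obtain j where "A \<subseteq> C" "j \<in> {1..n}" "A = {2 * j - 1, 2 * j}" by blast
          then have "2 * j \<in> pairs S" unfolding S(3)[symmetric] by blast
          then have "j \<in> S" using mem_pairs_even(1)[OF S1] by blast
          then show "A \<in> (\<lambda>j. {2 * j - 1, 2 * j}) ` S" using \<open>A = {2 * j - 1, 2 * j}\<close> by blast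
        next
          fix A assume "A \<in> (\<lambda>j. {2 * j - 1, 2 * j}) ` S"
          then obtain j where j: "j \<in> S" "A = {2 * j - 1, 2 * j}" by auto
          have A: "A = pairs {j}" using j by simp
          have "C - A = pairs (S - {j})"
            unfolding A S(3) by (rule pairs_Diff[symmetric]) (use S1 j in auto)
          moreover have "card (S - {j}) = k" using j S fS by simp
          moreover have "A \<subseteq> C" unfolding A S(3) by (rule pairs_mono) (use j in auto)
          moreover have "S - {j} \<subseteq> {1..n}" "j \<in> {1..n}" using S j by auto
          ultimately show "A \<in> ?X" using j(2) by blast
        qed
        moreover have "inj_on (\<lambda>j::nat. {2 * j - 1, 2 * j}) S"
          by (rule inj_onI) (auto simp: doubleton_eq_iff)
        ultimately have X: "card ?X = Suc k" using S by (simp add: card_image)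
        show ?thesis unfolding if_P[OF True] X by simp
      next
        case False
        have X: "?X = {}"
        proof (rule ccontr)
          assume "?X \<noteq> {}"
          then obtain A j S where *: "A \<subseteq> C" "j \<in> {1..n}" "A = {2 * j - 1, 2 * j}" "S \<subseteq> {1..n}"
            "card S = k" "C - A = pairs S" by blast
          have "S \<subseteq> {1..}" using *(4) by auto
          moreover have "2 * j \<notin> pairs S" unfolding *(6)[symmetric] *(3) by simp
          ultimately have "j \<notin> S" using mem_pairs_even(1)[of S j] by blast
          then have "card (insert j S) = Suc k" using * finite_subset[of S "{1..n}"] by auto
          moreover have "C = pairs (insert j S)" using * by auto
          moreover have "insert j S \<subseteq> {1..n}" using * by blast
          ultimately have "?P (Suc k) C" by (intro exI[of _ "insert j S"] conjI)
          then show False using False by (rule notE[rotated])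
        qed
        show ?thesis unfolding if_not_P[OF False] X by simp
      qed
      finally show ?thesis .
    qed
    finally show "gpow (xsq n) (Suc k) C = (if ?P (Suc k) C then fact (Suc k) else 0)" .
  qed
qed

section \<open>The Berezin integral and the fermionic Laplacian\<close>

lemma fder_seq_eq:
  assumes "\<forall>b\<in>B. k < b"
  shows "fder_seq k a B = a ({1..k} \<union> B)"
  using assms
proof (induction k arbitrary: B)
  case (Suc k)
  \<comment> \<open>All indices in \<open>B\<close> exceed \<open>Suc k\<close>, so the derivative
    with respect to this generator passes over no other one and no sign appears.\<close>
  have e: "{b \<in> B. b < Suc k} = {}" "Suc k \<notin> B" using Suc.prems by auto
  have "{1..k} \<union> insert (Suc k) B = {1..Suc k} \<union> B" by auto
  moreover have "\<forall>b\<in>insert (Suc k) B. k < b" using Suc.prems by auto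
  ultimately show ?case using Suc.IH[of "insert (Suc k) B"] by (simp add: fder_def e(2)) (simp add: e(1) del: One_nat_def)
qed simp

lemma berezin_eq: "berezin n a = a {1..2 * n} / complex_of_real (pi ^ n)"
  by (simp add: berezin_def fder_seq_eq)

text \<open>In top degree a product of \<open>j\<close> pairs meets the coefficient at its
  complement, which consists of \<open>n - j\<close> pairs. The signs are 1 by
  \<open>gsign_pairs\<close>, and the \<open>fact j\<close> of \<open>gpow_xsq\<close> cancels the
  denominator.\<close>

lemma berezin_gpow_gmult:
  assumes "j \<le> n"
  shows "berezin n (\<lambda>A. gmult (gpow (xsq n) j) g A / of_nat (fact j)) =
    (\<Sum>S | S \<subseteq> {1..n} \<and> card S = n - j. g (pairs S)) / complex_of_real (pi ^ n)"
proof -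
  let ?D = "{S. S \<subseteq> {1..n} \<and> card S = j}"
  have fin: "finite ?D" by (rule finite_subset[of _ "Pow {1..n}"]) auto
  have "gmult (gpow (xsq n) j) g {1..2 * n} =
      (\<Sum>A\<in>Pow {1..2 * n}. if A \<in> pairs ` ?D then fact j * g ({1..2 * n} - A) else 0)"
    unfolding gmult_def gpow_xsq
  proof (intro sum.cong refl)
    fix A assume "A \<in> Pow {1..2 * n}"
    have "gsign A ({1..2 * n} - A) = 1" if "S \<subseteq> {1..n}" "A = pairs S" for S
    proof -
      have "S \<subseteq> {1..}" using that by auto
      then show ?thesis
        using gsign_pairs[of S "{1..2 * n} - A"] that finite_subset[of S "{1..n}"] by auto
    qed
    then show "gsign A ({1..2 * n} - A) * (if \<exists>S\<subseteq>{1..n}. card S = j \<and> A = pairs S then fact j else 0) *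
        g ({1..2 * n} - A) = (if A \<in> pairs ` ?D then fact j * g ({1..2 * n} - A) else 0)"
      by auto
  qed
  also have "\<dots> = (\<Sum>A\<in>pairs ` ?D. fact j * g ({1..2 * n} - A))"
  proof -
    have "pairs ` ?D \<subseteq> Pow {1..2 * n}"
      using pairs_mono[of _ "{1..n}"] unfolding pairs_atLeastAtMost by blast
    then have "Pow {1..2 * n} \<inter> pairs ` ?D = pairs ` ?D" by blast
    then show ?thesis by (simp add: sum.If_cases)
  qed
  also have "\<dots> = (\<Sum>S\<in>?D. fact j * g ({1..2 * n} - pairs S))"
  proof (rule sum.reindex[unfolded comp_def])
    show "inj_on pairs ?D" by (rule inj_onI, rule pairs_inject) auto
  qed
  also have "\<dots> = (\<Sum>S\<in>?D. fact j * g (pairs ({1..n} - S)))"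
  proof (intro sum.cong refl)
    fix S assume S: "S \<in> ?D"
    have "pairs ({1..n} - S) = pairs {1..n} - pairs S"
      by (rule pairs_Diff) (use S in auto)
    then show "fact j * g ({1..2 * n} - pairs S) = fact j * g (pairs ({1..n} - S))"
      by (simp add: pairs_atLeastAtMost del: One_nat_def)
  qed
  also have "\<dots> = (\<Sum>S | S \<subseteq> {1..n} \<and> card S = n - j. fact j * g (pairs S))"
    by (rule sum.reindex_bij_witness[of _ "\<lambda>S. {1..n} - S" "\<lambda>S. {1..n} - S"])
      (use assms in \<open>auto simp: card_Diff_subset finite_subset double_diff\<close>)
  finally show ?thesis by (simp add: berezin_eq sum_distrib_left[symmetric])
qed

text \<open>The signs from elements of \<open>A\<close> below the pair occur twice and cancel; the
  remaining minus comes from \<open>2 * j - 1\<close> preceding \<open>2 * j\<close>. Together with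
  the -4 in \<open>super_laplace\<close> it makes the Laplacian of a super harmonic coefficient -4
  times a sum of coefficients.\<close>

lemma fder_fder_pair:
  assumes "1 \<le> j"
  shows "fder (2 * j - 1) (fder (2 * j) a) A =
    (if A \<inter> {2 * j - 1, 2 * j} = {} then - a (A \<union> {2 * j - 1, 2 * j}) else 0)"
proof (cases "A \<inter> {2 * j - 1, 2 * j} = {}")
  case True
  let ?L = "{b \<in> A. b < 2 * j - 1}"
  have "{b \<in> insert (2 * j - 1) A. b < 2 * j} = insert (2 * j - 1) ?L"
    using True assms by auto
  moreover have "insert (2 * j) (insert (2 * j - 1) A) = A \<union> {2 * j - 1, 2 * j}" by auto
  moreover have "2 * j \<noteq> 2 * j - 1" using assms by auto
  ultimately show ?thesis using True by (simp add: fder_def del: insert_iff) (simp add: power_add[symmetric])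
next
  case False
  then show ?thesis using assms by (auto simp: fder_def)
qed

declare rsmooth.simps(2) [simp del]

section \<open>Iterated derivatives with respect to the squared radius\<close>

lemma vector_derivative_cong_on:
  assumes "open I" "r \<in> I" "\<And>s. s \<in> I \<Longrightarrow> \<phi> s = \<psi> s"
  shows "vector_derivative \<phi> (at r) = vector_derivative \<psi> (at r)"
proof -
  have "(\<phi> has_vector_derivative D) (at r) \<longleftrightarrow> (\<psi> has_vector_derivative D) (at r)" for D
    using has_vector_derivative_transform_within_open[OF _ assms(1,2)] assms(3) by metis
  then show ?thesis by (simp add: vector_derivative_def)
qed

lemma rdop_cong:
  assumes "open I" "r \<in> I" "\<And>s. s \<in> I \<Longrightarrow> \<phi> s = \<psi> s"
  shows "rdop \<phi> r = rdop \<psi> r"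
  unfolding rdop_def using vector_derivative_cong_on[OF assms] by simp

lemma rdop_iter_cong:
  assumes "open I" "\<And>s. s \<in> I \<Longrightarrow> \<phi> s = \<psi> s"
  shows "r \<in> I \<Longrightarrow> (rdop ^^ j) \<phi> r = (rdop ^^ j) \<psi> r"
proof (induction j arbitrary: r)
  case (Suc j)
  then show ?case
    using rdop_cong[OF assms(1) Suc.prems, of "(rdop ^^ j) \<phi>" "(rdop ^^ j) \<psi>"] by simp
qed (use assms in simp)

lemma rdop_eq: "(\<phi> has_vector_derivative D) (at r) \<Longrightarrow> rdop \<phi> r = D / complex_of_real (2 * r)"
  by (simp add: rdop_def vector_derivative_at)

lemma rsmooth_rdop:
  assumes I: "open I" "I \<subseteq> {0<..}" and \<phi>: "rsmooth (Suc k) I P \<phi>"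
  shows "rsmooth k I P (\<lambda>r p. rdop (\<lambda>r. \<phi> r p) r)"
proof -
  obtain \<phi>' where *: "\<forall>r\<in>I. \<forall>p\<in>P. ((\<lambda>r. \<phi> r p) has_vector_derivative \<phi>' r p) (at r)" "rsmooth k I P \<phi>'"
    using \<phi> unfolding rsmooth.simps by blast
  have "rsmooth k I P (\<lambda>r p. \<phi>' r p * (of_real (1 / 2) * of_real (r powr - 1)))"
    by (intro rsmooth_mult rsmooth_powr rsmooth_param * I) auto
  then show ?thesis
  proof (rule rsmooth_cong[OF I(1), rotated])
    fix r p assume r: "r \<in> I" and p: "p \<in> P"
    then have "rdop (\<lambda>r. \<phi> r p) r = \<phi>' r p / complex_of_real (2 * r)" using * by (intro rdop_eq) auto
    moreover have "r > 0" using r I by auto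
    ultimately show "\<phi>' r p * (of_real (1 / 2) * of_real (r powr - 1)) = rdop (\<lambda>r. \<phi> r p) r"
      by (simp add: powr_minus field_simps)
  qed
qed

lemma rsmooth_rdop_iter:
  assumes I: "open I" "I \<subseteq> {0<..}"
  shows "rsmooth (j + k) I P \<phi> \<Longrightarrow> rsmooth k I P (\<lambda>r p. (rdop ^^ j) (\<lambda>r. \<phi> r p) r)"
proof (induction j arbitrary: k)
  case (Suc j)
  then have "rsmooth (Suc k) I P (\<lambda>r p. (rdop ^^ j) (\<lambda>r. \<phi> r p) r)" by simp
  from rsmooth_rdop[OF I this] show ?case by simp
qed simp

text \<open>\<open>vector_derivative\<close> is an arbitrary choice where no derivative exists, so
  linearity of \<open>rdop\<close> has to be backed by smoothness of each summand
  separately.\<close>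

lemma rdop_iter_sum:
  assumes I: "open I" "I \<subseteq> {0<..}"
    and \<phi>: "\<And>a. a \<in> A \<Longrightarrow> rsmooth j I P (\<phi> a)" and p: "p \<in> P"
  shows "r \<in> I \<Longrightarrow> (rdop ^^ j) (\<lambda>r. \<Sum>a\<in>A. \<phi> a r p) r = (\<Sum>a\<in>A. (rdop ^^ j) (\<lambda>r. \<phi> a r p) r)"
  using \<phi>
proof (induction j arbitrary: r)
  case (Suc j)
  have "\<exists>D. ((\<lambda>r. (rdop ^^ j) (\<lambda>r. \<phi> a r p) r) has_vector_derivative D) (at r)" if "a \<in> A" for a
  proof -
    have "rsmooth (Suc 0) I P (\<lambda>r p. (rdop ^^ j) (\<lambda>r. \<phi> a r p) r)"
      using rsmooth_rdop_iter[OF I, of j "Suc 0" P "\<phi> a"] Suc.prems(2)[OF that] by simp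
    then show ?thesis using Suc.prems(1) p unfolding rsmooth.simps by blast
  qed
  then obtain D where D: "\<And>a. a \<in> A \<Longrightarrow> ((\<lambda>r. (rdop ^^ j) (\<lambda>r. \<phi> a r p) r) has_vector_derivative D a) (at r)"
    by metis
  have "(rdop ^^ Suc j) (\<lambda>r. \<Sum>a\<in>A. \<phi> a r p) r = rdop (\<lambda>r. \<Sum>a\<in>A. (rdop ^^ j) (\<lambda>r. \<phi> a r p) r) r"
    unfolding funpow.simps comp_def
    by (rule rdop_cong[OF I(1) Suc.prems(1)], rule Suc.IH) (auto intro: rsmooth_Suc_imp Suc.prems(2))
  also have "\<dots> = (\<Sum>a\<in>A. D a) / complex_of_real (2 * r)"
    by (rule rdop_eq, rule has_vector_derivative_sum, rule D)
  also have "\<dots> = (\<Sum>a\<in>A. (rdop ^^ Suc j) (\<lambda>r. \<phi> a r p) r)"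
    using rdop_eq[OF D] by (simp add: sum_divide_distrib)
  finally show ?case .
qed simp

lemma (in compact_finite_measure) rdop_iter_integral:
  assumes I: "open I" "I \<subseteq> {0<..}" and \<phi>: "rsmooth j I Y \<phi>"
  shows "r \<in> I \<Longrightarrow> (rdop ^^ j) (\<lambda>r. LINT y|M. \<phi> r y) r = (LINT y|M. (rdop ^^ j) (\<lambda>r. \<phi> r y) r)"
  using \<phi>
proof (induction j arbitrary: r)
  case (Suc j)
  let ?\<psi> = "\<lambda>r y. (rdop ^^ j) (\<lambda>r. \<phi> r y) r"
  have \<psi>: "rsmooth (Suc 0) I Y ?\<psi>" using rsmooth_rdop_iter[OF I, of j "Suc 0" Y \<phi>] Suc.prems by simp
  then obtain \<psi>' where *: "\<forall>r\<in>I. \<forall>y\<in>Y. ((\<lambda>r. ?\<psi> r y) has_vector_derivative \<psi>' r y) (at r)"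
    "continuous_on (I \<times> Y) (\<lambda>z. \<psi>' (fst z) (snd z))" unfolding rsmooth.simps by blast
  have "(rdop ^^ Suc j) (\<lambda>r. LINT y|M. \<phi> r y) r = rdop (\<lambda>r. LINT y|M. ?\<psi> r y) r"
    unfolding funpow.simps comp_def
    by (rule rdop_cong[OF I(1) Suc.prems(1)], rule Suc.IH) (auto intro: rsmooth_Suc_imp Suc.prems(2))
  also have "\<dots> = (LINT y|M. \<psi>' r y) / complex_of_real (2 * r)"
    by (rule rdop_eq, rule has_vector_derivative_integral_param[OF I(1) Suc.prems(1) rsmooth_continuous[OF \<psi>] *(2)])
      (use * in auto)
  also have "\<dots> = (LINT y|M. \<psi>' r y / complex_of_real (2 * r))" by simp
  also have "\<dots> = (LINT y|M. (rdop ^^ Suc j) (\<lambda>r. \<phi> r y) r)"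
  proof (intro Bochner_Integration.integral_cong refl)
    fix y assume "y \<in> space M"
    then have "rdop (\<lambda>r. ?\<psi> r y) r = \<psi>' r y / complex_of_real (2 * r)"
      using * Suc.prems by (intro rdop_eq) (auto simp: space_M)
    then show "\<psi>' r y / complex_of_real (2 * r) = (rdop ^^ Suc j) (\<lambda>r. \<phi> r y) r" by simp
  qed
  finally show ?case .
qed simp

text \<open>In the variable \<open>r^2\<close> the summands are powers with exponent
  \<open>a l\<close>; each application of \<open>rdop\<close> contributes one factor of the falling
  factorial and lowers the exponent by one.\<close>

lemma rdop_iter_powr_sum:
  assumes I: "open I" "I \<subseteq> {0<..}"
  shows "r \<in> I \<Longrightarrow> (rdop ^^ j) (\<lambda>r. \<Sum>l\<in>L. of_real (r powr (2 * a l)) * c l) r =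
    (\<Sum>l\<in>L. of_real ((\<Prod>i<j. a l - real i) * r powr (2 * (a l - real j))) * c l)"
proof (induction j arbitrary: r)
  case (Suc j)
  let ?P = "\<lambda>l. \<Prod>i<j. a l - real i"
  have r: "r > 0" using Suc.prems I by auto
  have "(rdop ^^ Suc j) (\<lambda>r. \<Sum>l\<in>L. of_real (r powr (2 * a l)) * c l) r =
      rdop (\<lambda>r. \<Sum>l\<in>L. of_real (?P l * r powr (2 * (a l - real j))) * c l) r"
    unfolding funpow.simps comp_def by (rule rdop_cong[OF I(1) Suc.prems], rule Suc.IH)
  also have "\<dots> = (\<Sum>l\<in>L. of_real (?P l * (2 * (a l - real j) * r powr (2 * (a l - real j) - 1))) * c l)
      / complex_of_real (2 * r)"
  proof (intro rdop_eq has_vector_derivative_sum has_vector_derivative_mult_left has_vector_derivative_of_real)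
    show "((\<lambda>r. ?P l * r powr (2 * (a l - real j))) has_real_derivative
        ?P l * (2 * (a l - real j) * r powr (2 * (a l - real j) - 1))) (at r)" for l
      using r by (auto intro!: derivative_eq_intros)
  qed
  also have "\<dots> = (\<Sum>l\<in>L. of_real ((\<Prod>i<Suc j. a l - real i) * r powr (2 * (a l - real (Suc j)))) * c l)"
    unfolding sum_divide_distrib
  proof (intro sum.cong refl)
    fix l
    have "r powr (2 * (a l - real j) - 1) = r powr (1 + 2 * (a l - real (Suc j)))" by (simp add: algebra_simps)
    also have "\<dots> = r * r powr (2 * (a l - real (Suc j)))"
      using r powr_add[of r 1 "2 * (a l - real (Suc j))"] by simp
    finally have e: "?P l * (2 * (a l - real j) * r powr (2 * (a l - real j) - 1)) =
        (2 * r) * ((\<Prod>i<Suc j. a l - real i) * r powr (2 * (a l - real (Suc j))))"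
      by (simp only: prod.lessThan_Suc mult_ac)
    show "of_real (?P l * (2 * (a l - real j) * r powr (2 * (a l - real j) - 1))) * c l / complex_of_real (2 * r) =
        of_real ((\<Prod>i<Suc j. a l - real i) * r powr (2 * (a l - real (Suc j)))) * c l"
      unfolding e of_real_mult[of "2 * r"] using r by simp
  qed
  finally show ?case .
qed simp

text \<open>The functional equation of \<open>rGamma\<close> holds for every real argument, also at
  its zeros. The identity therefore survives when \<open>x - j\<close> is a non-positive integer,
  the source of the vanishing constant for even \<open>M \<le> 0\<close>.\<close>

lemma rGamma_falling: "(\<Prod>i<j. x - 1 - real i) * rGamma x = rGamma (x - real j)" for x :: real
proof (induction j)
  case (Suc j)
  have "(x - real (Suc j)) * rGamma (x - real (Suc j) + 1) = rGamma (x - real (Suc j))"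
    by (rule rGamma_plus1)
  then have "(x - 1 - real j) * rGamma (x - real j) = rGamma (x - real (Suc j))"
    by (simp add: algebra_simps)
  moreover have "(\<Prod>i<Suc j. x - 1 - real i) * rGamma x = (x - 1 - real j) * ((\<Prod>i<j. x - 1 - real i) * rGamma x)"
    by simp
  ultimately show ?case unfolding Suc.IH by simp
qed simp

interpretation sphere_measure: compact_finite_measure "sphere_measure :: (real ^ 'm::finite) measure" "sphere 0 1"
proof -
  interpret finite_measure "sphere_measure :: (real ^ 'm) measure" by (rule finite_measure_sphere_measure)
  show "compact_finite_measure (sphere_measure :: (real ^ 'm) measure) (sphere 0 1)"
    by unfold_locales (auto simp: space_sphere_measure sets_sphere_measure)
qed

context polyharmonic_chain
begin

text \<open>\<open>r^(m-2)\<close> times the \<open>r^(2l)\<close> of the spherical mean is the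
  power \<open>m/2 + l - 1\<close> of \<open>r^2\<close>. At \<open>r = 1\<close> the operator
  applied \<open>j\<close> times gives \<open>(m/2+l-1)...(m/2+l-j)\<close>, which
  \<open>rGamma_falling\<close> absorbs.\<close>

lemma rdop_iter_sphere_mean:
  assumes \<epsilon>: "0 < \<epsilon>" "\<epsilon> < 1" and \<Omega>: "cball 0 (1 + 2 * \<epsilon>) \<subseteq> \<Omega>"
  shows "(LINT \<xi>|sphere_measure. (rdop ^^ j) (\<lambda>r. of_real (r powi (int CARD('m) - 2)) * f k (r *\<^sub>R \<xi>)) 1) =
    of_real (2 * pi powr (CARD('m) / 2)) *
    (\<Sum>l\<le>n. of_real ((-1) ^ l * real ((k + l) choose l) * rGamma (CARD('m) / 2 + l - j)) * f (k + l) 0)"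
proof -
  let ?I = "{1 - \<epsilon><..<1 + \<epsilon>}" and ?m = "real CARD('m)"
  have I: "open ?I" "?I \<subseteq> {0<..}" "1 \<in> ?I" using \<epsilon> by auto
  let ?\<phi> = "\<lambda>r \<xi>. of_real (r powi (int CARD('m) - 2)) * f k (r *\<^sub>R \<xi>)"
  \<comment> \<open>In dimension 1 the exponent is -1. Since \<open>r > 0\<close>, the integer power
    can be written as \<open>powr\<close>, which also covers the half-integer powers of
    \<open>r^2\<close>.\<close>
  have pw: "r powi (int CARD('m) - 2) = r powr (?m - 2)" if "r > 0" for r :: real
    using powr_real_of_int'[of r "int CARD('m) - 2"] that by simp
  have "rsmooth j ?I (sphere 0 1) (\<lambda>r \<xi>. of_real (r powr (?m - 2)) * f k (r *\<^sub>R \<xi>))"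
    by (intro rsmooth_mult rsmooth_powr rsmooth_chain[OF \<epsilon> \<Omega>] I)
  then have "rsmooth j ?I (sphere 0 1) ?\<phi>"
  proof (rule rsmooth_cong[OF I(1), rotated])
    fix r and \<xi> :: "real ^ 'm" assume "r \<in> ?I"
    then have "r > 0" using I by auto
    then show "of_real (r powr (?m - 2)) * f k (r *\<^sub>R \<xi>) = ?\<phi> r \<xi>" by (simp only: pw)
  qed
  from sphere_measure.rdop_iter_integral[OF I(1,2) this I(3)]
  have "(LINT \<xi>|sphere_measure. (rdop ^^ j) (\<lambda>r. ?\<phi> r \<xi>) 1) = (rdop ^^ j) (\<lambda>r. LINT \<xi>|sphere_measure. ?\<phi> r \<xi>) 1"
    by simp
  also have "\<dots> = (rdop ^^ j) (\<lambda>r. \<Sum>l\<le>n. of_real (r powr (2 * (?m / 2 + l - 1))) *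
      (of_real ((-1) ^ l * real ((k + l) choose l) * (2 * pi powr (?m / 2) * rGamma (?m / 2 + l))) * f (k + l) 0)) 1"
  proof (rule rdop_iter_cong[OF I(1) _ I(3)])
    fix r assume r: "r \<in> ?I"
    then have r0: "r > 0" using I by auto
    have T: "0 < r\<^sup>2" "r\<^sup>2 < (1 + \<epsilon>)\<^sup>2" "cball 0 (sqrt ((1 + \<epsilon>)\<^sup>2)) \<subseteq> \<Omega>"
      using r r0 \<epsilon> \<Omega> subset_cball[of "1 + \<epsilon>" "1 + 2 * \<epsilon>" "0 :: real ^ 'm"] by (auto intro!: power_strict_mono)
    have "(LINT \<xi>|sphere_measure. ?\<phi> r \<xi>) = of_real (r powr (?m - 2)) * (LINT \<xi>|sphere_measure. f k (sqrt (r\<^sup>2) *\<^sub>R \<xi>))"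
      using r0 by (simp only: pw[OF r0] integral_mult_right_zero real_sqrt_abs abs_of_pos)
    also have "\<dots> = (\<Sum>l\<le>n. of_real (r powr (2 * (?m / 2 + l - 1))) *
      (of_real ((-1) ^ l * real ((k + l) choose l) * (2 * pi powr (?m / 2) * rGamma (?m / 2 + l))) * f (k + l) 0))"
      unfolding sphere_mean_eq[OF T] sum_distrib_left
    proof (intro sum.cong refl)
      fix l :: nat
      have "r powr (2 * (?m / 2 + l - 1)) = r powr ((?m - 2) + real (2 * l))" by (simp add: algebra_simps)
      also have "\<dots> = r powr (?m - 2) * (r\<^sup>2) ^ l"
        unfolding powr_add using r0 by (simp add: powr_realpow power_mult del: of_nat_mult)
      finally show "of_real (r powr (?m - 2)) * (of_real ((-1) ^ l * real ((k + l) choose l) *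
          (2 * pi powr (?m / 2) * rGamma (?m / 2 + l)) * (r\<^sup>2) ^ l) * f (k + l) 0) =
          of_real (r powr (2 * (?m / 2 + l - 1))) *
          (of_real ((-1) ^ l * real ((k + l) choose l) * (2 * pi powr (?m / 2) * rGamma (?m / 2 + l))) * f (k + l) 0)"
        by (simp only: of_real_mult mult_ac)
    qed
    finally show "(LINT \<xi>|sphere_measure. ?\<phi> r \<xi>) = (\<Sum>l\<le>n. of_real (r powr (2 * (?m / 2 + l - 1))) *
      (of_real ((-1) ^ l * real ((k + l) choose l) * (2 * pi powr (?m / 2) * rGamma (?m / 2 + l))) * f (k + l) 0))" .
  qed
  also have "\<dots> = (\<Sum>l\<le>n. of_real ((\<Prod>i<j. ?m / 2 + l - 1 - real i) * 1 powr (2 * (?m / 2 + l - 1 - real j))) *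
      (of_real ((-1) ^ l * real ((k + l) choose l) * (2 * pi powr (?m / 2) * rGamma (?m / 2 + l))) * f (k + l) 0))"
    by (rule rdop_iter_powr_sum[OF I])
  also have "\<dots> = (\<Sum>l\<le>n. of_real (2 * pi powr (?m / 2)) *
      (of_real ((-1) ^ l * real ((k + l) choose l) * rGamma (?m / 2 + l - j)) * f (k + l) 0))"
  proof (intro sum.cong refl)
    fix l :: nat
    show "of_real ((\<Prod>i<j. ?m / 2 + l - 1 - real i) * 1 powr (2 * (?m / 2 + l - 1 - real j))) *
        (of_real ((-1) ^ l * real ((k + l) choose l) * (2 * pi powr (?m / 2) * rGamma (?m / 2 + l))) * f (k + l) 0) =
        of_real (2 * pi powr (?m / 2)) * (of_real ((-1) ^ l * real ((k + l) choose l) * rGamma (?m / 2 + l - j)) * f (k + l) 0)"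
      unfolding rGamma_falling[where j = j and x = "?m / 2 + real l", symmetric] by simp
  qed
  finally show ?thesis by (simp only: sum_distrib_left)
qed

end

section \<open>Super harmonic functions\<close>

lemma C2_on_has_laplacian:
  fixes g :: "real ^ 'm::finite \<Rightarrow> complex"
  assumes "C2_on \<Omega> g"
  shows "has_laplacian \<Omega> g (\<lambda>x. \<Sum>i\<in>UNIV. pd i (pd i g) x)"
  unfolding has_laplacian_def
proof (rule exI[of _ "\<lambda>i. pd i g"], rule exI[of _ "\<lambda>i. pd i (pd i g)"], intro conjI allI ballI refl)
  have "((\<lambda>s. u (y + s *\<^sub>R axis i 1)) has_vector_derivative pd i u y) (at 0)"
    if "(\<lambda>t. u (y + t *\<^sub>R axis i 1)) differentiable (at 0)" for u i and y :: "real ^ 'm"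
    using that unfolding pd_def by (simp only: vector_derivative_works)
  then show "has_partial \<Omega> i g (pd i g)" "has_partial \<Omega> i (pd i g) (pd i (pd i g))" for i
    using assms unfolding C2_on_def has_partial_def by blast+
qed

text \<open>By super harmonicity, the Laplacian of the coefficient at A is -4 times the sum of the
  coefficients at A together with one more pair 2j-1, 2j. Iterating it yields, up to factors, the sums
  of the coefficients at A together with l pairs.\<close>
definition pair_supersets :: "nat \<Rightarrow> nat set \<Rightarrow> nat \<Rightarrow> nat set set" where
  "pair_supersets n A l = {S. S \<subseteq> {1..n} \<and> card S = l \<and> pairs S \<inter> A = {}}"

definition coeff_sum :: "nat \<Rightarrow> (real ^ 'm::finite \<Rightarrow> grass) \<Rightarrow> nat set \<Rightarrow> nat \<Rightarrow> real ^ 'm \<Rightarrow> complex" where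
  "coeff_sum n h A l x = (\<Sum>S\<in>pair_supersets n A l. h x (A \<union> pairs S))"

lemma finite_pair_supersets [simp]: "finite (pair_supersets n A l)"
  by (rule finite_subset[of _ "Pow {1..n}"]) (auto simp: pair_supersets_def)

lemma pair_supersets_0: "pair_supersets n A 0 = {{}}"
  by (auto simp: pair_supersets_def dest: finite_subset)

lemma pair_supersets_vanish:
  assumes "l > n"
  shows "pair_supersets n A l = {}"
proof (rule equals0I)
  fix S assume "S \<in> pair_supersets n A l"
  then have S: "S \<subseteq> {1..n}" "card S = l" by (auto simp: pair_supersets_def)
  from card_mono[OF _ S(1)] S(2) assms show False by simp
qed

text \<open>Double counting: a set \<open>S\<close> of \<open>l\<close> pairs with a new
  \<open>j\<close> corresponds to a set \<open>T\<close> of \<open>l + 1\<close> pairs with a marked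
  element, and each \<open>T\<close> has \<open>l + 1\<close> markings.\<close>

lemma sum_insert_pair_supersets:
  fixes X :: "nat set \<Rightarrow> complex"
  shows "(\<Sum>S\<in>pair_supersets n A l. \<Sum>j\<in>{1..n}. if (A \<union> pairs S) \<inter> {2 * j - 1, 2 * j} = {} then X (insert j S) else 0) =
    of_nat (Suc l) * (\<Sum>T\<in>pair_supersets n A (Suc l). X T)"
proof -
  let ?J = "\<lambda>S. {j \<in> {1..n}. (A \<union> pairs S) \<inter> {2 * j - 1, 2 * j} = {}}"
  \<comment> \<open>The condition on \<open>j\<close> excludes the pairs already in \<open>S\<close>
    as well as those meeting \<open>A\<close>, so inserting \<open>j\<close> always enlarges
    \<open>S\<close>.\<close>
  have notin: "j \<notin> S" if "S \<in> pair_supersets n A l" "j \<in> ?J S" for S j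
    using that mem_pairs_even(1)[of S j] by (fastforce simp: pair_supersets_def)
  have "(\<Sum>S\<in>pair_supersets n A l. \<Sum>j\<in>{1..n}. if (A \<union> pairs S) \<inter> {2 * j - 1, 2 * j} = {} then X (insert j S) else 0) =
      (\<Sum>S\<in>pair_supersets n A l. \<Sum>j\<in>?J S. X (insert j S))"
    by (intro sum.cong refl sum.inter_filter[symmetric]) simp
  also have "\<dots> = (\<Sum>(S, j)\<in>(SIGMA S:pair_supersets n A l. ?J S). X (insert j S))"
    by (rule sum.Sigma) auto
  also have "\<dots> = (\<Sum>(T, j)\<in>(SIGMA T:pair_supersets n A (Suc l). T). X T)"
  proof (rule sum.reindex_bij_witness[of _ "\<lambda>(T, j). (T - {j}, j)" "\<lambda>(S, j). (insert j S, j)"])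
    fix a assume "a \<in> (SIGMA S:pair_supersets n A l. ?J S)"
    then obtain S j where a: "a = (S, j)" "S \<in> pair_supersets n A l" "j \<in> ?J S" by blast
    have j: "j \<notin> S" using notin a by blast
    have S: "S \<subseteq> {1..n}" "card S = l" "pairs S \<inter> A = {}" using a by (auto simp: pair_supersets_def)
    have "finite S" using S finite_subset by blast
    show "(\<lambda>(T, j). (T - {j}, j)) ((\<lambda>(S, j). (insert j S, j)) a) = a" using a(1) j by simp
    have "pairs (insert j S) \<inter> A = {}" using S(3) a(3) by auto
    then have "insert j S \<in> pair_supersets n A (Suc l)"
      using S j \<open>finite S\<close> a(3) unfolding pair_supersets_def by simp
    then show "(\<lambda>(S, j). (insert j S, j)) a \<in> (SIGMA T:pair_supersets n A (Suc l). T)" using a(1) by simp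
    show "(case (\<lambda>(S, j). (insert j S, j)) a of (T, j) \<Rightarrow> X T) = (case a of (S, j) \<Rightarrow> X (insert j S))"
      using a(1) by simp
  next
    fix b assume "b \<in> (SIGMA T:pair_supersets n A (Suc l). T)"
    then obtain T j where b: "b = (T, j)" "T \<in> pair_supersets n A (Suc l)" "j \<in> T" by blast
    have T: "T \<subseteq> {1..n}" "card T = Suc l" "pairs T \<inter> A = {}" using b by (auto simp: pair_supersets_def)
    have fT: "finite T" using T finite_subset by blast
    have ins: "insert j (T - {j}) = T" using b by auto
    show "(\<lambda>(S, j). (insert j S, j)) ((\<lambda>(T, j). (T - {j}, j)) b) = b" using b(1) ins by simp
    have "pairs (T - {j}) \<subseteq> pairs T" by (rule pairs_mono) auto
    then have "pairs (T - {j}) \<inter> A = {}" using T(3) by blast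
    then have D: "T - {j} \<in> pair_supersets n A l"
      using T fT b(3) unfolding pair_supersets_def by auto
    have T1: "T - {j} \<subseteq> {1..}" and j1: "1 \<le> j" "j \<le> n" using T b(3) by auto
    have "2 * j - 1 \<notin> pairs (T - {j})" "2 * j \<notin> pairs (T - {j})"
      using mem_pairs_even[OF T1, of j] j1 by simp_all
    moreover have "{2 * j - 1, 2 * j} \<subseteq> pairs T" using b(3) by (auto simp: pairs_def)
    ultimately have "(A \<union> pairs (T - {j})) \<inter> {2 * j - 1, 2 * j} = {}" using T(3) by blast
    then show "(\<lambda>(T, j). (T - {j}, j)) b \<in> (SIGMA S:pair_supersets n A l. ?J S)"
      using b(1) D j1 by simp
  qed
  also have "\<dots> = (\<Sum>T\<in>pair_supersets n A (Suc l). \<Sum>j\<in>T. X T)"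
    by (rule sum.Sigma[symmetric]) (auto simp: pair_supersets_def dest: finite_subset)
  also have "\<dots> = of_nat (Suc l) * (\<Sum>T\<in>pair_supersets n A (Suc l). X T)"
    unfolding sum_distrib_left by (intro sum.cong refl) (simp add: pair_supersets_def)
  finally show ?thesis .
qed

lemma polyharmonic_chain_coeff_sum:
  fixes h :: "real ^ 'm::finite \<Rightarrow> grass"
  assumes C2: "\<forall>A. C2_on \<Omega> (\<lambda>x. h x A)"
    and harm: "\<forall>x\<in>\<Omega>. \<forall>A. super_laplace n h x A = 0"
  shows "polyharmonic_chain \<Omega> (coeff_sum n h A) n"
proof
  fix k
  let ?L = "\<lambda>B x. - 4 * (\<Sum>j\<in>{1..n}. if B \<inter> {2 * j - 1, 2 * j} = {} then h x (B \<union> {2 * j - 1, 2 * j}) else 0)"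
  have lap: "has_laplacian \<Omega> (\<lambda>x. h x B) (?L B)" for B
  proof (rule has_laplacian_cong[OF C2_on_has_laplacian[OF C2[rule_format]]])
    fix y assume "y \<in> \<Omega>"
    then have "(\<Sum>i\<in>UNIV. pd i (pd i (\<lambda>x. h x B)) y) = 4 * (\<Sum>j\<in>{1..n}. fder (2 * j - 1) (fder (2 * j) (h y)) B)"
      using harm by (simp add: super_laplace_def)
    also have "(\<Sum>j\<in>{1..n}. fder (2 * j - 1) (fder (2 * j) (h y)) B) =
        (\<Sum>j\<in>{1..n}. - (if B \<inter> {2 * j - 1, 2 * j} = {} then h y (B \<union> {2 * j - 1, 2 * j}) else 0))"
      by (intro sum.cong refl) (subst fder_fder_pair, auto)
    finally show "(\<Sum>i\<in>UNIV. pd i (pd i (\<lambda>x. h x B)) y) = ?L B y"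
      by (simp only: sum_negf) simp
  qed
  show "has_laplacian \<Omega> (coeff_sum n h A k) (\<lambda>x. - 4 * of_nat (Suc k) * coeff_sum n h A (Suc k) x)"
    unfolding coeff_sum_def
  proof (rule has_laplacian_cong[OF has_laplacian_sum[OF lap]])
    fix y
    have "(\<Sum>S\<in>pair_supersets n A k. ?L (A \<union> pairs S) y) = - 4 * (\<Sum>S\<in>pair_supersets n A k. \<Sum>j\<in>{1..n}.
        if (A \<union> pairs S) \<inter> {2 * j - 1, 2 * j} = {} then h y (A \<union> pairs (insert j S)) else 0)"
      unfolding sum_distrib_left by (intro sum.cong refl) (simp add: Un_ac insert_commute)
    also have "\<dots> = - 4 * of_nat (Suc k) * (\<Sum>T\<in>pair_supersets n A (Suc k). h y (A \<union> pairs T))"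
      unfolding sum_insert_pair_supersets[where X = "\<lambda>T. h y (A \<union> pairs T)"] by (simp only: mult.assoc)
    finally show "(\<Sum>S\<in>pair_supersets n A k. ?L (A \<union> pairs S) y) =
        - 4 * of_nat (Suc k) * (\<Sum>T\<in>pair_supersets n A (Suc k). h y (A \<union> pairs T))" .
  qed
next
  show "coeff_sum n h A k x = 0" if "k > n" for k x
    using pair_supersets_vanish[OF that] by (simp add: coeff_sum_def)
qed

lemma alternating_binomial_sum:
  fixes G :: "nat \<Rightarrow> complex"
  assumes "\<And>i. i > n \<Longrightarrow> G i = 0"
  shows "(\<Sum>k\<le>n. \<Sum>l\<le>n. (-1) ^ l * of_nat ((k + l) choose l) * G (k + l)) = G 0"
proof -
  let ?t = "\<lambda>l k. (-1) ^ l * of_nat ((k + l) choose l) * G (k + l)"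
  have "(\<Sum>k\<le>n. \<Sum>l\<le>n. ?t l k) = (\<Sum>l\<le>n. \<Sum>k\<le>n. ?t l k)"
    by (rule sum.swap)
  also have "\<dots> = (\<Sum>(l, k)\<in>{..n} \<times> {..n}. ?t l k)"
    by (rule sum.cartesian_product)
  \<comment> \<open>\<open>G\<close> vanishes beyond \<open>n\<close>, so the square is cut down to
    the triangle \<open>l + k \<le> n\<close> and summed along its diagonals
    \<open>k + l = i\<close>.\<close>
  also have "\<dots> = (\<Sum>(l, k)\<in>{(l, k). l + k \<le> n}. ?t l k)"
  proof (rule sum.mono_neutral_right)
    have "i \<le> n" if "G i \<noteq> 0" for i using assms[of i] that not_le by blast
    then show "\<forall>z\<in>{..n} \<times> {..n} - {(l, k). l + k \<le> n}. (case z of (l, k) \<Rightarrow> ?t l k) = 0"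
      by (auto simp: add.commute)
  qed auto
  also have "\<dots> = (\<Sum>i\<le>n. \<Sum>l\<le>i. ?t l (i - l))"
    by (rule sum.triangle_reindex_eq)
  also have "\<dots> = (\<Sum>i\<le>n. (\<Sum>l\<le>i. (-1) ^ l * of_nat (i choose l)) * G i)"
    unfolding sum_distrib_right by (intro sum.cong refl) auto
  also have "\<dots> = (\<Sum>i\<le>n. if i = 0 then G 0 else 0)"
    by (intro sum.cong refl) (auto simp: choose_alternating_sum)
  also have "\<dots> = G 0" by simp
  finally show ?thesis .
qed

text \<open>The margin provided by compactness is split in two: one \<open>\<epsilon>\<close> for
  the interval of radii about 1, the other for the balls over which solid means are taken.
  \<open>\<epsilon> < 1\<close> keeps the radii positive.\<close>

lemma cball_enlarge:
  fixes \<Omega> :: "(real ^ 'm::finite) set"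
  assumes "open \<Omega>" "cball 0 1 \<subseteq> \<Omega>"
  obtains \<epsilon> where "0 < \<epsilon>" "\<epsilon> < 1" "cball 0 (1 + 2 * \<epsilon>) \<subseteq> \<Omega>"
proof -
  obtain e where e: "e > 0" "(\<Union>x\<in>cball 0 1. cball x e) \<subseteq> \<Omega>"
    using compact_subset_open_imp_cball_epsilon_subset[OF compact_cball assms] by blast
  define d where "d = min e 1"
  have d: "0 < d" "d \<le> e" "d \<le> 1" using e by (auto simp: d_def)
  have "cball 0 (1 + d) \<subseteq> \<Omega>"
  proof
    fix y :: "real ^ 'm" assume y: "y \<in> cball 0 (1 + d)"
    \<comment> \<open>The contraction of \<open>y\<close> into the unit ball, at distance at most
      \<open>d\<close> from \<open>y\<close>.\<close>
    let ?x = "(1 / (1 + d)) *\<^sub>R y"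
    have x: "?x \<in> cball 0 1" using y d by (simp add: field_simps)
    have "y - ?x = (d / (1 + d)) *\<^sub>R y"
    proof -
      have "d / (1 + d) = 1 - 1 / (1 + d)" using d by (simp add: field_simps)
      then show ?thesis by (simp add: scaleR_diff_left)
    qed
    then have "dist ?x y = d / (1 + d) * norm y" using d by (simp add: dist_norm norm_minus_commute)
    also have "\<dots> \<le> d / (1 + d) * (1 + d)" using y d by (intro mult_left_mono) auto
    also have "\<dots> \<le> e" using d by simp
    finally have "y \<in> cball ?x e" by simp
    then show "y \<in> \<Omega>" using e x by blast
  qed
  then show ?thesis using that[of "d / 2"] d by simp
qed

theorem theorem19:
  fixes n :: nat and \<Omega> :: "(real^'m::finite) set" and h :: "real^'m \<Rightarrow> grass"
  assumes "open \<Omega>" and "cball 0 1 \<subseteq> \<Omega>"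
    and "is_superfunction n h"
    and "\<forall>A. C2_on \<Omega> (\<lambda>x. h x A)"
    and "\<forall>x\<in>\<Omega>. \<forall>A. super_laplace n h x A = 0"
  shows "supersphere_integral n h =
    complex_of_real (2 * pi powr (real_of_int (int CARD('m) - 2 * int n) / 2)
                     * rGamma (real_of_int (int CARD('m) - 2 * int n) / 2)) * h 0 {}"
proof -
  let ?m = "real CARD('m)"
  obtain \<epsilon> where \<epsilon>: "0 < \<epsilon>" "\<epsilon> < 1" "cball 0 (1 + 2 * \<epsilon>) \<subseteq> \<Omega>"
    using cball_enlarge[OF assms(1,2)] .
  let ?I = "{1 - \<epsilon><..<1 + \<epsilon>}"
  have I: "open ?I" "?I \<subseteq> {0<..}" "1 \<in> ?I" using \<epsilon> by auto
  interpret chain: polyharmonic_chain \<Omega> "coeff_sum n h A" n for A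
    by (rule polyharmonic_chain_coeff_sum[OF assms(4,5)])
  define F where "F = coeff_sum n h {}"
  have F0: "F 0 x = h x {}" for x
    by (simp add: F_def coeff_sum_def pair_supersets_0)
  let ?\<phi> = "\<lambda>S r \<xi>. of_real (r powi (int CARD('m) - 2)) * h (r *\<^sub>R \<xi>) (pairs S)"
  \<comment> \<open>Each coefficient at \<open>pairs S\<close> is the zeroth member of its own
    chain, the one starting at \<open>pairs S\<close>. Hence the interpretation for every
    \<open>A\<close>, although the values are computed in the single chain \<open>F\<close>.\<close>
  have smooth: "rsmooth N ?I (sphere 0 1) (?\<phi> S)" for N S
  proof -
    have "rsmooth N ?I (sphere 0 1) (\<lambda>r \<xi>. of_real (r powr (?m - 2)) * coeff_sum n h (pairs S) 0 (r *\<^sub>R \<xi>))"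
      by (intro rsmooth_mult rsmooth_powr chain.rsmooth_chain[OF \<epsilon>] I)
    then show ?thesis
    proof (rule rsmooth_cong[OF I(1), rotated])
      fix r and \<xi> :: "real ^ 'm" assume "r \<in> ?I"
      then have r: "r > 0" using I by auto
      show "of_real (r powr (?m - 2)) * coeff_sum n h (pairs S) 0 (r *\<^sub>R \<xi>) = ?\<phi> S r \<xi>"
        using powr_real_of_int'[of r "int CARD('m) - 2"] r
        by (simp add: coeff_sum_def pair_supersets_0)
    qed
  qed
  have term_eq: "(LINT \<xi>|sphere_measure. berezin n (\<lambda>A. gmult (gpow (xsq n) j) (radial_term j h \<xi>) A / of_nat (fact j))) =
      of_real (2 * pi powr (?m / 2) / pi ^ n) *
      (\<Sum>l\<le>n. (-1) ^ l * of_nat (((n - j) + l) choose l) * (of_real (rGamma (?m / 2 + real ((n - j) + l) - n)) * F ((n - j) + l) 0))"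
    if j: "j \<le> n" for j
  proof -
    let ?D = "{S. S \<subseteq> {1..n} \<and> card S = n - j}"
    have D: "?D = pair_supersets n {} (n - j)" by (simp add: pair_supersets_def)
    have "(LINT \<xi>|sphere_measure. berezin n (\<lambda>A. gmult (gpow (xsq n) j) (radial_term j h \<xi>) A / of_nat (fact j))) =
        (LINT \<xi>|sphere_measure. (rdop ^^ j) (\<lambda>r. of_real (r powi (int CARD('m) - 2)) * F (n - j) (r *\<^sub>R \<xi>)) 1 / of_real (pi ^ n))"
    proof (intro Bochner_Integration.integral_cong refl)
      fix \<xi> :: "real ^ 'm" assume "\<xi> \<in> space sphere_measure"
      then have \<xi>: "\<xi> \<in> sphere 0 1" by (simp add: space_sphere_measure)
      have "(\<Sum>S\<in>?D. radial_term j h \<xi> (pairs S)) = (\<Sum>S\<in>?D. (rdop ^^ j) (\<lambda>r. ?\<phi> S r \<xi>) 1)"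
        by (simp add: radial_term_def)
      \<comment> \<open>The sum over \<open>S\<close> has to move inside the derivatives to form
        \<open>F (n - j)\<close>; this is where smoothness of the individual coefficients
        enters.\<close>
      also have "\<dots> = (rdop ^^ j) (\<lambda>r. \<Sum>S\<in>?D. ?\<phi> S r \<xi>) 1"
        by (rule rdop_iter_sum[OF I(1,2) smooth \<xi> I(3), symmetric])
      also have "(\<lambda>r. \<Sum>S\<in>?D. ?\<phi> S r \<xi>) = (\<lambda>r. of_real (r powi (int CARD('m) - 2)) * F (n - j) (r *\<^sub>R \<xi>))"
        unfolding F_def coeff_sum_def D sum_distrib_left by simp
      finally show "berezin n (\<lambda>A. gmult (gpow (xsq n) j) (radial_term j h \<xi>) A / of_nat (fact j)) =
          (rdop ^^ j) (\<lambda>r. of_real (r powi (int CARD('m) - 2)) * F (n - j) (r *\<^sub>R \<xi>)) 1 / of_real (pi ^ n)"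
        unfolding berezin_gpow_gmult[OF j] by simp
    qed
    also have "\<dots> = (LINT \<xi>|sphere_measure. (rdop ^^ j) (\<lambda>r. of_real (r powi (int CARD('m) - 2)) * F (n - j) (r *\<^sub>R \<xi>)) 1) / of_real (pi ^ n)"
      by (rule integral_divide_zero)
    also have "\<dots> = of_real (2 * pi powr (?m / 2) / pi ^ n) *
        (\<Sum>l\<le>n. of_real ((-1) ^ l * real (((n - j) + l) choose l) * rGamma (?m / 2 + l - j)) * F ((n - j) + l) 0)"
      unfolding F_def chain.rdop_iter_sphere_mean[OF \<epsilon>] by simp
    also have "(\<Sum>l\<le>n. of_real ((-1) ^ l * real (((n - j) + l) choose l) * rGamma (?m / 2 + l - j)) * F ((n - j) + l) 0) =
        (\<Sum>l\<le>n. (-1) ^ l * of_nat (((n - j) + l) choose l) * (of_real (rGamma (?m / 2 + real ((n - j) + l) - n)) * F ((n - j) + l) 0))"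
    proof (intro sum.cong refl)
      fix l
      \<comment> \<open>Written this way, the argument of \<open>rGamma\<close> depends only on the
        index \<open>(n - j) + l\<close> of the chain member, so both factors together are a
        function of that index, as \<open>alternating_binomial_sum\<close> requires.\<close>
      have e: "?m / 2 + l - j = ?m / 2 + real ((n - j) + l) - n" using j by simp
      show "of_real ((-1) ^ l * real (((n - j) + l) choose l) * rGamma (?m / 2 + l - j)) * F ((n - j) + l) 0 =
          (-1) ^ l * of_nat (((n - j) + l) choose l) * (of_real (rGamma (?m / 2 + real ((n - j) + l) - n)) * F ((n - j) + l) 0)"
        unfolding e by (simp only: of_real_mult of_real_power of_real_minus of_real_1 of_real_of_nat_eq mult.assoc)
    qed
    finally show ?thesis .
  qed
  let ?G = "\<lambda>i. of_real (rGamma (?m / 2 + real i - n)) * F i 0"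
  have "supersphere_integral n h = (\<Sum>j\<le>n. of_real (2 * pi powr (?m / 2) / pi ^ n) *
      (\<Sum>l\<le>n. (-1) ^ l * of_nat (((n - j) + l) choose l) * ?G ((n - j) + l)))"
    unfolding supersphere_integral_def atMost_atLeast0[symmetric] by (intro sum.cong refl term_eq) simp
  also have "\<dots> = of_real (2 * pi powr (?m / 2) / pi ^ n) *
      (\<Sum>j\<le>n. \<Sum>l\<le>n. (-1) ^ l * of_nat (((n - j) + l) choose l) * ?G ((n - j) + l))"
    by (simp only: sum_distrib_left)
  also have "(\<Sum>j\<le>n. \<Sum>l\<le>n. (-1) ^ l * of_nat (((n - j) + l) choose l) * ?G ((n - j) + l)) =
      (\<Sum>k\<le>n. \<Sum>l\<le>n. (-1) ^ l * of_nat ((k + l) choose l) * ?G (k + l))"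
    by (rule sum.reindex_bij_witness[of _ "\<lambda>k. n - k" "\<lambda>j. n - j"]) auto
  also have "\<dots> = ?G 0"
    by (rule alternating_binomial_sum) (simp add: F_def chain.vanish)
  also have "of_real (2 * pi powr (?m / 2) / pi ^ n) * ?G 0 =
      complex_of_real (2 * pi powr ((?m - 2 * n) / 2) * rGamma ((?m - 2 * n) / 2)) * h 0 {}"
  proof -
    have "pi powr ((?m - 2 * n) / 2) = pi powr (?m / 2 - n)" by (simp add: diff_divide_distrib)
    also have "\<dots> = pi powr (?m / 2) / pi ^ n" by (simp add: powr_diff powr_realpow)
    finally have e1: "pi powr ((?m - 2 * n) / 2) = pi powr (?m / 2) / pi ^ n" .
    have e2: "?m / 2 + real 0 - n = (?m - 2 * n) / 2" by (simp add: diff_divide_distrib)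
    show ?thesis unfolding F0 e1 e2 by simp
  qed
  finally show ?thesis by simp
qed

end
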